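(* Let $\Sigma$ be a lightlike hypersurface in a spacetime $(M,g)$ of dimension $n+2\ge4$, endowed with an integrable screen distribution $\mathcal S$, and let $U$ be a globally defined lightlike vector field on $\Sigma$. Then $\Sigma$ is totally umbilical if and only if each leaf of $\mathcal S$ is umbilical along $U$ as a codimension-two spacelike submanifold of $M$. In particular, $\Sigma$ is totally geodesic if and only if, in addition, the restriction of $U$ to each leaf is stationary.
   Context: A spacetime $(M,g)$ is a connected time-oriented Lorentzian manifold of signature $(-,+,\dots,+)$ with Levi-Civita connection $\widetilde\nabla$. A vector $v$ is lightlike if $g(v,v)=0$ and $v\ne0$. A lightlike hypersurface $\Sigma\subset M$ is a (connected) codimension-one submanifold on which the induced metric is everywhere degenerate; its radical $\mathrm{Rad}(\Sigma)=T\Sigma\cap T^\perp\Sigma$ is a line bundle, spanned by any lightlike $U\in\mathfrak X(\Sigma)$. A screen distribution is a distribution $\mathcal S$ on $\Sigma$ complementary to $\mathrm{Rad}(\Sigma)$ in $T\Sigma$ (necessarily spacelike). $B_U(X,Y)=-g(\widetilde\nabla_XU,Y)$ for $X,Y\in\mathfrak X(\Sigma)$; $\Sigma$ is totally umbilical if $B_U=\mu g$ for some smooth function $\mu$ on $\Sigma$, and totally geodesic if $B_U=0$. For a codimension-two spacelike submanifold $L$ of $M$ and a normal field $\zeta$ on $L$, the shape operator is $A_\zeta X=-(\widetilde\nabla_X\zeta)^\top$; $L$ is umbilical along $U$ if $A_{U|_L}=\rho I$ for some function $\rho$ on $L$; $\zeta$ is stationary if $\operatorname{trace}(A_\zeta)=0$.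 *)

theory Defs
  imports "HOL-Analysis.Analysis"
begin

section \<open>Smooth manifolds\<close>

text \<open>
  \<open>C\<^sup>k\<close> and smooth maps between Euclidean spaces. The derivatives are taken at full
  neighbourhoods, so these predicates are meant for (and only used with) open sets \<open>S\<close>.
\<close>

primrec Ck_on :: "nat \<Rightarrow> 'e::euclidean_space set \<Rightarrow> ('e \<Rightarrow> 'b::real_normed_vector) \<Rightarrow> bool" where
  "Ck_on 0 S f \<longleftrightarrow> continuous_on S f"
| "Ck_on (Suc k) S f \<longleftrightarrow> (\<forall>x\<in>S. f differentiable (at x)) \<and>
     (\<forall>v. Ck_on k S (\<lambda>x. frechet_derivative f (at x) v))"

definition smooth_on :: "'e::euclidean_space set \<Rightarrow> ('e \<Rightarrow> 'b::real_normed_vector) \<Rightarrow> bool" where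
  "smooth_on S f \<longleftrightarrow> (\<forall>k. Ck_on k S f)"

text \<open>
  A chart is a pair of a domain and a coordinate map. A manifold consists of a topology, whose
  \<^const>\<open>topspace\<close> is the set of points, and a (not necessarily maximal) atlas of charts into
  the Euclidean model space \<open>'e\<close>, so its dimension is \<open>DIM('e)\<close>. Topology and atlas
  are data rather than being inherited from the ambient type, so that a submanifold can be
  a subset of the ambient manifold with a topology and smooth structure of its own. Manifolds are
  Hausdorff; second countability is not required.
\<close>

type_synonym ('a, 'e) chart = "'a set \<times> ('a \<Rightarrow> 'e)"

record ('a, 'e) manifold =
  mtop :: "'a topology"
  atlas :: "('a, 'e) chart set"

definition chart_inv :: "('a, 'e) chart \<Rightarrow> 'e \<Rightarrow> 'a" where
  "chart_inv c = inv_into (fst c) (snd c)"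

definition smooth_manifold :: "('a, 'e::euclidean_space) manifold \<Rightarrow> bool" where
  "smooth_manifold M \<longleftrightarrow>
     Hausdorff_space (mtop M) \<and>
     topspace (mtop M) = (\<Union>c\<in>atlas M. fst c) \<and>
     (\<forall>c\<in>atlas M. openin (mtop M) (fst c) \<and> open (snd c ` fst c) \<and>
        homeomorphic_map (subtopology (mtop M) (fst c)) (top_of_set (snd c ` fst c)) (snd c)) \<and>
     (\<forall>c\<in>atlas M. \<forall>d\<in>atlas M. smooth_on (snd c ` (fst c \<inter> fst d)) (snd d \<circ> chart_inv c))"

definition smooth_function_on ::
  "('a, 'e::euclidean_space) manifold \<Rightarrow> 'a set \<Rightarrow> ('a \<Rightarrow> real) \<Rightarrow> bool" where
  "smooth_function_on M W f \<longleftrightarrow>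
     (\<forall>c\<in>atlas M. smooth_on (snd c ` (fst c \<inter> W)) (f \<circ> chart_inv c))"

definition smooth_map ::
  "('a, 'e::euclidean_space) manifold \<Rightarrow> ('b, 'f::euclidean_space) manifold \<Rightarrow> ('a \<Rightarrow> 'b) \<Rightarrow> bool" where
  "smooth_map M N f \<longleftrightarrow> continuous_map (mtop M) (mtop N) f \<and>
     (\<forall>c\<in>atlas M. \<forall>d\<in>atlas N.
        smooth_on (snd c ` (fst c \<inter> f -` fst d)) (snd d \<circ> f \<circ> chart_inv c))"


subsection \<open>Tangent vectors and vector fields\<close>

text \<open>
  Fix for every point \<open>p\<close> a preferred chart \<open>chart_at M p\<close> of the atlas around \<open>p\<close>. It identifies
  the tangent space \<open>T\<^sub>pM\<close> with the model space \<open>'e\<close>, and a tangent vector at \<open>p\<close> is represented by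
  its components in that chart. No relation between the preferred charts of different points is
  assumed; hence a vector field \<open>X :: 'a \<Rightarrow> 'e\<close> is smooth when its components \<^emph>\<open>in the charts
  of the atlas\<close> are.
\<close>

definition chart_at :: "('a, 'e::euclidean_space) manifold \<Rightarrow> 'a \<Rightarrow> ('a, 'e) chart" where
  "chart_at M p = (SOME c. c \<in> atlas M \<and> p \<in> fst c)"

text \<open>The derivative \<open>v(f) = df\<^sub>p(v)\<close> of a vector-valued function along \<open>v \<in> T\<^sub>pM\<close>.\<close>

definition dir_deriv ::
  "('a, 'e::euclidean_space) manifold \<Rightarrow> ('a \<Rightarrow> 'b::real_normed_vector) \<Rightarrow> 'a \<Rightarrow> 'e \<Rightarrow> 'b" where
  "dir_deriv M f p v =
     frechet_derivative (f \<circ> chart_inv (chart_at M p)) (at (snd (chart_at M p) p)) v"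

text \<open>The tangent map \<open>T\<^sub>pM \<rightarrow> T\<^bsub>f(p)\<^esub>N\<close> of a map between manifolds.\<close>

definition tangent_map ::
  "('a, 'e::euclidean_space) manifold \<Rightarrow> ('b, 'f::euclidean_space) manifold \<Rightarrow> ('a \<Rightarrow> 'b) \<Rightarrow> 'a \<Rightarrow> 'e \<Rightarrow> 'f" where
  "tangent_map M N f p = dir_deriv M (snd (chart_at N (f p)) \<circ> f) p"

text \<open>Components \<open>dc\<^sub>p(v)\<close> of \<open>v \<in> T\<^sub>pM\<close> in an arbitrary chart \<open>c\<close>, and conversely the vector
  at \<open>p\<close> with components \<open>u\<close>; for fixed \<open>c\<close> and \<open>u\<close> the latter is a coordinate field.\<close>

definition components :: "('a, 'e::euclidean_space) manifold \<Rightarrow> ('a, 'e) chart \<Rightarrow> 'a \<Rightarrow> 'e \<Rightarrow> 'e" where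
  "components M c p v = dir_deriv M (snd c) p v"

definition coord_field :: "('a, 'e::euclidean_space) manifold \<Rightarrow> ('a, 'e) chart \<Rightarrow> 'e \<Rightarrow> 'a \<Rightarrow> 'e" where
  "coord_field M c u p = frechet_derivative (snd (chart_at M p) \<circ> chart_inv c) (at (snd c p)) u"

definition vector_field_on ::
  "('a, 'e::euclidean_space) manifold \<Rightarrow> 'a set \<Rightarrow> ('a \<Rightarrow> 'e) \<Rightarrow> bool" where
  "vector_field_on M W X \<longleftrightarrow>
     (\<forall>c\<in>atlas M. smooth_on (snd c ` (fst c \<inter> W))
        ((\<lambda>q. components M c q (X q)) \<circ> chart_inv c))"

abbreviation vector_field :: "('a, 'e::euclidean_space) manifold \<Rightarrow> ('a \<Rightarrow> 'e) \<Rightarrow> bool" where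
  "vector_field M X \<equiv> vector_field_on M (topspace (mtop M)) X"

text \<open>\<open>[X,Y] = dY(X) - dX(Y)\<close> in the coordinates of the preferred chart at \<open>p\<close>.\<close>

definition lie_bracket ::
  "('a, 'e::euclidean_space) manifold \<Rightarrow> ('a \<Rightarrow> 'e) \<Rightarrow> ('a \<Rightarrow> 'e) \<Rightarrow> 'a \<Rightarrow> 'e" where
  "lie_bracket M X Y p =
     dir_deriv M (\<lambda>q. components M (chart_at M p) q (Y q)) p (X p) -
     dir_deriv M (\<lambda>q. components M (chart_at M p) q (X q)) p (Y p)"


subsection \<open>Submanifolds, distributions, leaves\<close>

text \<open>
  Submanifolds are immersed: \<open>N\<close> is a subset of \<open>M\<close> with its own smooth structure, whose inclusion
  is a smooth immersion. Embedded submanifolds are included; leaves of a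
  distribution need not be embedded.
\<close>

abbreviation incl ::
  "('a, 'f::euclidean_space) manifold \<Rightarrow> ('a, 'e::euclidean_space) manifold \<Rightarrow> 'a \<Rightarrow> 'f \<Rightarrow> 'e" where
  "incl N M p \<equiv> tangent_map N M (\<lambda>q. q) p"

definition submanifold ::
  "('a, 'f::euclidean_space) manifold \<Rightarrow> ('a, 'e::euclidean_space) manifold \<Rightarrow> bool" where
  "submanifold N M \<longleftrightarrow> smooth_manifold N \<and> topspace (mtop N) \<subseteq> topspace (mtop M) \<and>
     smooth_map N M (\<lambda>q. q) \<and> (\<forall>p\<in>topspace (mtop N). inj (incl N M p))"

definition distribution :: "('a, 'e::euclidean_space) manifold \<Rightarrow> ('a \<Rightarrow> 'e set) \<Rightarrow> bool" where
  "distribution M S \<longleftrightarrow> (\<exists>k. \<forall>p\<in>topspace (mtop M). \<exists>W E. openin (mtop M) W \<and> p \<in> W \<and>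
     (\<forall>i<k. vector_field_on M W (E i)) \<and>
     (\<forall>q\<in>W. inj_on (\<lambda>i::nat. E i q) {..<k} \<and> independent ((\<lambda>i. E i q) ` {..<k}) \<and>
        S q = span ((\<lambda>i. E i q) ` {..<k})))"

definition integral_manifold ::
  "('a, 'e::euclidean_space) manifold \<Rightarrow> ('a \<Rightarrow> 'e set) \<Rightarrow> ('a, 'f::euclidean_space) manifold \<Rightarrow> bool" where
  "integral_manifold M S L \<longleftrightarrow> submanifold L M \<and> connected_space (mtop L) \<and>
     (\<forall>p\<in>topspace (mtop L). range (incl L M p) = S p)"

text \<open>The type argument is the model space of the integral manifolds.\<close>

definition integrable_distribution ::
  "'f::euclidean_space itself \<Rightarrow> ('a, 'e::euclidean_space) manifold \<Rightarrow> ('a \<Rightarrow> 'e set) \<Rightarrow> bool" where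
  "integrable_distribution _ M S \<longleftrightarrow> distribution M S \<and>
     (\<forall>p\<in>topspace (mtop M). \<exists>L :: ('a, 'f) manifold.
        integral_manifold M S L \<and> p \<in> topspace (mtop L))"

text \<open>Leaves are the maximal (connected) integral manifolds.\<close>

definition leaf ::
  "('a, 'e::euclidean_space) manifold \<Rightarrow> ('a \<Rightarrow> 'e set) \<Rightarrow> ('a, 'f::euclidean_space) manifold \<Rightarrow> bool" where
  "leaf M S L \<longleftrightarrow> integral_manifold M S L \<and>
     (\<forall>L' :: ('a, 'f) manifold. integral_manifold M S L' \<and> submanifold L L' \<longrightarrow>
        topspace (mtop L') = topspace (mtop L))"


section \<open>Spacetimes\<close>

definition lorentz_form :: "('e::euclidean_space \<Rightarrow> 'e \<Rightarrow> real) \<Rightarrow> bool" where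
  "lorentz_form b \<longleftrightarrow> bilinear b \<and> (\<forall>x y. b x y = b y x) \<and>
     (\<exists>F :: 'e \<Rightarrow> 'e. \<exists>e\<^sub>0\<in>Basis. linear F \<and> bij F \<and>
        (\<forall>i\<in>Basis. \<forall>j\<in>Basis.
           b (F i) (F j) = (if i \<noteq> j then 0 else if i = e\<^sub>0 then - 1 else 1)))"

definition lorentzian_metric ::
  "('a, 'e::euclidean_space) manifold \<Rightarrow> ('a \<Rightarrow> 'e \<Rightarrow> 'e \<Rightarrow> real) \<Rightarrow> bool" where
  "lorentzian_metric M g \<longleftrightarrow> (\<forall>p\<in>topspace (mtop M). lorentz_form (g p)) \<and>
     (\<forall>W X Y. openin (mtop M) W \<and> vector_field_on M W X \<and> vector_field_on M W Y \<longrightarrow>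
        smooth_function_on M W (\<lambda>p. g p (X p) (Y p)))"

text \<open>The time orientation is given by a timelike vector field \<open>T\<close>.\<close>

definition spacetime ::
  "('a, 'e::euclidean_space) manifold \<Rightarrow> ('a \<Rightarrow> 'e \<Rightarrow> 'e \<Rightarrow> real) \<Rightarrow> ('a \<Rightarrow> 'e) \<Rightarrow> bool" where
  "spacetime M g T \<longleftrightarrow> smooth_manifold M \<and> connected_space (mtop M) \<and> lorentzian_metric M g \<and>
     vector_field M T \<and> (\<forall>p\<in>topspace (mtop M). g p (T p) (T p) < 0)"

text \<open>
  \<open>D p v Y\<close> is the covariant derivative \<open>\<nabla>\<^sub>vY\<close> at \<open>p\<close>, for \<open>v \<in> T\<^sub>pM\<close> and a vector field \<open>Y\<close> smooth
  near \<open>p\<close>. The axioms are stated for locally defined fields, so locality is one of them.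
\<close>

definition affine_connection ::
  "('a, 'e::euclidean_space) manifold \<Rightarrow> ('a \<Rightarrow> 'e \<Rightarrow> ('a \<Rightarrow> 'e) \<Rightarrow> 'e) \<Rightarrow> bool" where
  "affine_connection M D \<longleftrightarrow> (\<forall>W. openin (mtop M) W \<longrightarrow>
     (\<forall>Y. vector_field_on M W Y \<longrightarrow>
        (\<forall>p\<in>W. linear (\<lambda>v. D p v Y)) \<and>
        (\<forall>X. vector_field_on M W X \<longrightarrow> vector_field_on M W (\<lambda>p. D p (X p) Y)) \<and>
        (\<forall>Z. vector_field_on M W Z \<longrightarrow>
           (\<forall>p\<in>W. \<forall>v. D p v (\<lambda>q. Y q + Z q) = D p v Y + D p v Z)) \<and>
        (\<forall>f. smooth_function_on M W f \<longrightarrow>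
           (\<forall>p\<in>W. \<forall>v. D p v (\<lambda>q. f q *\<^sub>R Y q) = dir_deriv M f p v *\<^sub>R Y p + f p *\<^sub>R D p v Y)) \<and>
        (\<forall>Y'. (\<forall>q\<in>W. Y' q = Y q) \<longrightarrow> (\<forall>p\<in>W. \<forall>v. D p v Y' = D p v Y))))"

definition levi_civita ::
  "('a, 'e::euclidean_space) manifold \<Rightarrow> ('a \<Rightarrow> 'e \<Rightarrow> 'e \<Rightarrow> real) \<Rightarrow>
   ('a \<Rightarrow> 'e \<Rightarrow> ('a \<Rightarrow> 'e) \<Rightarrow> 'e) \<Rightarrow> bool" where
  "levi_civita M g D \<longleftrightarrow> affine_connection M D \<and>
     (\<forall>W X Y. openin (mtop M) W \<and> vector_field_on M W X \<and> vector_field_on M W Y \<longrightarrow>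
        (\<forall>p\<in>W. D p (X p) Y - D p (Y p) X = lie_bracket M X Y p \<and>
           (\<forall>v. dir_deriv M (\<lambda>q. g q (X q) (Y q)) p v = g p (D p v X) (Y p) + g p (X p) (D p v Y))))"

text \<open>
  The induced covariant derivative \<open>\<nabla>\<^sub>vY\<close> of a field \<open>Y\<close> of \<open>M\<close>-vectors that is only defined along a
  submanifold \<open>N\<close>, in a direction \<open>v \<in> T\<^sub>pN\<close>. Near \<open>p\<close> write \<open>Y = \<Sum>\<^sub>b Y\<^sup>b \<partial>\<^sub>b\<close> with the coordinate fields
  of the preferred chart at \<open>p\<close>; then \<open>\<nabla>\<^sub>vY = \<Sum>\<^sub>b v(Y\<^sup>b) \<partial>\<^sub>b + Y\<^sup>b(p) \<nabla>\<^sub>v\<partial>\<^sub>b\<close>. At \<open>p\<close> itself, \<open>\<partial>\<^sub>b\<close> is the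
  basis vector \<open>b\<close> and \<open>Y\<^sup>b(p) = Y p \<bullet> b\<close>, by the choice of chart.
\<close>

definition nabla_along ::
  "('a, 'e::euclidean_space) manifold \<Rightarrow> ('a \<Rightarrow> 'e \<Rightarrow> ('a \<Rightarrow> 'e) \<Rightarrow> 'e) \<Rightarrow>
   ('a, 'f::euclidean_space) manifold \<Rightarrow> ('a \<Rightarrow> 'e) \<Rightarrow> 'a \<Rightarrow> 'f \<Rightarrow> 'e" where
  "nabla_along M D N Y p v =
     dir_deriv N (\<lambda>q. components M (chart_at M p) q (Y q)) p v +
     (\<Sum>b\<in>Basis. (Y p \<bullet> b) *\<^sub>R D p (incl N M p v) (coord_field M (chart_at M p) b))"


subsection \<open>Lightlike hypersurfaces\<close>

text \<open>\<open>Rad\<^sub>p = T\<^sub>pH \<inter> T\<^sub>p\<^sup>\<bottom>H\<close>, as a subspace of \<open>T\<^sub>pH\<close>.\<close>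

definition radical ::
  "('a, 'e::euclidean_space) manifold \<Rightarrow> ('a \<Rightarrow> 'e \<Rightarrow> 'e \<Rightarrow> real) \<Rightarrow>
   ('a, 'f::euclidean_space) manifold \<Rightarrow> 'a \<Rightarrow> 'f set" where
  "radical M g H p = {v. \<forall>w. g p (incl H M p v) (incl H M p w) = 0}"

definition lightlike_hypersurface ::
  "('a, 'e::euclidean_space) manifold \<Rightarrow> ('a \<Rightarrow> 'e \<Rightarrow> 'e \<Rightarrow> real) \<Rightarrow>
   ('a, 'f::euclidean_space) manifold \<Rightarrow> bool" where
  "lightlike_hypersurface M g H \<longleftrightarrow> submanifold H M \<and> connected_space (mtop H) \<and>
     DIM('e) = DIM('f) + 1 \<and> (\<forall>p\<in>topspace (mtop H). radical M g H p \<noteq> {0})"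

definition screen_distribution ::
  "('a, 'e::euclidean_space) manifold \<Rightarrow> ('a \<Rightarrow> 'e \<Rightarrow> 'e \<Rightarrow> real) \<Rightarrow>
   ('a, 'f::euclidean_space) manifold \<Rightarrow> ('a \<Rightarrow> 'f set) \<Rightarrow> bool" where
  "screen_distribution M g H S \<longleftrightarrow> distribution H S \<and>
     (\<forall>p\<in>topspace (mtop H). S p \<inter> radical M g H p = {0} \<and>
        {x + y |x y. x \<in> S p \<and> y \<in> radical M g H p} = UNIV)"

text \<open>A vector field tangent to \<open>H\<close>, regarded as a field of \<open>M\<close>-vectors along \<open>H\<close>.\<close>

definition push ::
  "('a, 'e::euclidean_space) manifold \<Rightarrow> ('a, 'f::euclidean_space) manifold \<Rightarrow> ('a \<Rightarrow> 'f) \<Rightarrow> 'a \<Rightarrow> 'e" where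
  "push M H U p = incl H M p (U p)"

definition lightlike_field ::
  "('a, 'e::euclidean_space) manifold \<Rightarrow> ('a \<Rightarrow> 'e \<Rightarrow> 'e \<Rightarrow> real) \<Rightarrow>
   ('a, 'f::euclidean_space) manifold \<Rightarrow> ('a \<Rightarrow> 'f) \<Rightarrow> bool" where
  "lightlike_field M g H U \<longleftrightarrow> vector_field H U \<and>
     (\<forall>p\<in>topspace (mtop H). g p (push M H U p) (push M H U p) = 0 \<and> push M H U p \<noteq> 0)"

text \<open>The tensor \<open>B\<^sub>U(x,y) = -g(\<nabla>\<^sub>xU, y)\<close>, evaluated on \<open>x, y \<in> T\<^sub>pH\<close>.\<close>

definition null_form ::
  "('a, 'e::euclidean_space) manifold \<Rightarrow> ('a \<Rightarrow> 'e \<Rightarrow> 'e \<Rightarrow> real) \<Rightarrow> ('a \<Rightarrow> 'e \<Rightarrow> ('a \<Rightarrow> 'e) \<Rightarrow> 'e) \<Rightarrow>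
   ('a, 'f::euclidean_space) manifold \<Rightarrow> ('a \<Rightarrow> 'f) \<Rightarrow> 'a \<Rightarrow> 'f \<Rightarrow> 'f \<Rightarrow> real" where
  "null_form M g D H U p x y = - g p (nabla_along M D H (push M H U) p x) (incl H M p y)"

definition totally_umbilical ::
  "('a, 'e::euclidean_space) manifold \<Rightarrow> ('a \<Rightarrow> 'e \<Rightarrow> 'e \<Rightarrow> real) \<Rightarrow> ('a \<Rightarrow> 'e \<Rightarrow> ('a \<Rightarrow> 'e) \<Rightarrow> 'e) \<Rightarrow>
   ('a, 'f::euclidean_space) manifold \<Rightarrow> ('a \<Rightarrow> 'f) \<Rightarrow> bool" where
  "totally_umbilical M g D H U \<longleftrightarrow> (\<exists>\<mu>. smooth_function_on H (topspace (mtop H)) \<mu> \<and>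
     (\<forall>p\<in>topspace (mtop H). \<forall>x y.
        null_form M g D H U p x y = \<mu> p * g p (incl H M p x) (incl H M p y)))"

definition totally_geodesic ::
  "('a, 'e::euclidean_space) manifold \<Rightarrow> ('a \<Rightarrow> 'e \<Rightarrow> 'e \<Rightarrow> real) \<Rightarrow> ('a \<Rightarrow> 'e \<Rightarrow> ('a \<Rightarrow> 'e) \<Rightarrow> 'e) \<Rightarrow>
   ('a, 'f::euclidean_space) manifold \<Rightarrow> ('a \<Rightarrow> 'f) \<Rightarrow> bool" where
  "totally_geodesic M g D H U \<longleftrightarrow>
     (\<forall>p\<in>topspace (mtop H). \<forall>x y. null_form M g D H U p x y = 0)"


subsection \<open>Codimension-two spacelike submanifolds\<close>

definition spacelike_codim2 ::
  "('a, 'e::euclidean_space) manifold \<Rightarrow> ('a \<Rightarrow> 'e \<Rightarrow> 'e \<Rightarrow> real) \<Rightarrow>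
   ('a, 'f::euclidean_space) manifold \<Rightarrow> bool" where
  "spacelike_codim2 M g L \<longleftrightarrow> submanifold L M \<and> DIM('e) = DIM('f) + 2 \<and>
     (\<forall>p\<in>topspace (mtop L). \<forall>x. x \<noteq> 0 \<longrightarrow> g p (incl L M p x) (incl L M p x) > 0)"

text \<open>The orthogonal projection \<open>T\<^sub>pM \<rightarrow> T\<^sub>pL\<close>; it is determined uniquely when \<open>L\<close> is spacelike.\<close>

definition tangential_part ::
  "('a, 'e::euclidean_space) manifold \<Rightarrow> ('a \<Rightarrow> 'e \<Rightarrow> 'e \<Rightarrow> real) \<Rightarrow>
   ('a, 'f::euclidean_space) manifold \<Rightarrow> 'a \<Rightarrow> 'e \<Rightarrow> 'f" where
  "tangential_part M g L p v =
     (THE t. \<forall>w. g p (v - incl L M p t) (incl L M p w) = 0)"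

definition shape_operator ::
  "('a, 'e::euclidean_space) manifold \<Rightarrow> ('a \<Rightarrow> 'e \<Rightarrow> 'e \<Rightarrow> real) \<Rightarrow> ('a \<Rightarrow> 'e \<Rightarrow> ('a \<Rightarrow> 'e) \<Rightarrow> 'e) \<Rightarrow>
   ('a, 'f::euclidean_space) manifold \<Rightarrow> ('a \<Rightarrow> 'e) \<Rightarrow> 'a \<Rightarrow> 'f \<Rightarrow> 'f" where
  "shape_operator M g D L \<zeta> p x = - tangential_part M g L p (nabla_along M D L \<zeta> p x)"

definition umbilical_along ::
  "('a, 'e::euclidean_space) manifold \<Rightarrow> ('a \<Rightarrow> 'e \<Rightarrow> 'e \<Rightarrow> real) \<Rightarrow> ('a \<Rightarrow> 'e \<Rightarrow> ('a \<Rightarrow> 'e) \<Rightarrow> 'e) \<Rightarrow>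
   ('a, 'f::euclidean_space) manifold \<Rightarrow> ('a \<Rightarrow> 'e) \<Rightarrow> bool" where
  "umbilical_along M g D L \<zeta> \<longleftrightarrow>
     (\<exists>\<rho>. \<forall>p\<in>topspace (mtop L). \<forall>x. shape_operator M g D L \<zeta> p x = \<rho> p *\<^sub>R x)"

definition stationary ::
  "('a, 'e::euclidean_space) manifold \<Rightarrow> ('a \<Rightarrow> 'e \<Rightarrow> 'e \<Rightarrow> real) \<Rightarrow> ('a \<Rightarrow> 'e \<Rightarrow> ('a \<Rightarrow> 'e) \<Rightarrow> 'e) \<Rightarrow>
   ('a, 'f::euclidean_space) manifold \<Rightarrow> ('a \<Rightarrow> 'e) \<Rightarrow> bool" where
  "stationary M g D L \<zeta> \<longleftrightarrow>
     (\<forall>p\<in>topspace (mtop L). (\<Sum>b\<in>Basis. shape_operator M g D L \<zeta> p b \<bullet> b) = 0)"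

end

theory Submission
  imports Defs
begin

text \<open>
  Every leaf has tangent spaces \<open>\<S>\<^sub>p\<close>, and for \<open>x, y \<in> \<S>\<^sub>p\<close> the number \<open>g(A\<^sub>U x, y)\<close> is \<open>B\<^sub>U(x, y)\<close>. So the
  condition on the leaf through \<open>p\<close> says that \<open>B\<^sub>U\<close> is proportional to \<open>g\<close> on \<open>\<S>\<^sub>p\<close>. The field \<open>U\<close> spans the
  radical, hence \<open>g(U, \<cdot>) = 0\<close> on \<open>T\<Sigma>\<close>; also \<open>B\<^sub>U(\<cdot>, U) = 0\<close> because \<open>g(U, U) = 0\<close>, and \<open>B\<^sub>U\<close> is
  symmetric because the connection is torsion-free. Thus proportionality on \<open>\<S>\<^sub>p\<close> is the same as
  proportionality on \<open>T\<^sub>p\<Sigma>\<close>. The factor \<open>\<mu> = B\<^sub>U(X, X) / g(X, X)\<close>, for a local section \<open>X\<close> of \<open>\<S>\<close>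
  without zeros, is smooth, and \<open>trace A\<^sub>U = n \<mu>\<close>.

  That a leaf passes through every point follows from Zorn's lemma: the union of a chain of integral
  manifolds through \<open>p\<close>, each a submanifold of the next, is an integral manifold, since by invariance
  of domain and the inverse function theorem each is an open submanifold of the larger ones.
\<close>

section \<open>Calculus of smooth maps\<close>

text \<open>The umbilicity of the leaves is a pointwise condition: every leaf brings its own factor
  \<rho>, and nothing is assumed about how these factors fit together across leaves. Total
  umbilicity asks for a smooth \<mu>, which is why \<mu> has to be written as a quotient of
  functions already known to be smooth on \<open>H\<close>. The delicate one is the numerator,
  because \<open>nabla_along\<close> is computed in a chart that is chosen separately at each point
  and may jump from point to point. Much of the work along a submanifold therefore consists in
  replacing it by a formula in one fixed chart, \<open>nabla_chart\<close>.

  Integrability only provides some integral manifold through each point, whereas the leaf conditions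
  speak of maximal ones; without a leaf through \<open>p\<close> they would say nothing at
  \<open>p\<close>.

  For the symmetry of B_U, \<open>U\<close> is paired with coordinate fields of \<open>H\<close>
  rather than of \<open>M\<close>. The torsion condition on \<open>M\<close> then leaves one further
  ingredient, the symmetry of the second derivatives of the inclusion in coordinates.\<close>

lemma Ck_on_subset: "Ck_on k S f \<Longrightarrow> T \<subseteq> S \<Longrightarrow> Ck_on k T f"
  by (induction k arbitrary: f) (auto intro: continuous_on_subset)

text \<open>Openness enters because \<open>frechet_derivative\<close> looks at a full neighbourhood
  of the point: agreement on \<open>S\<close> is then enough for the derivatives on \<open>S\<close>
  to agree.\<close>

lemma Ck_on_cong:
  assumes "open S" "\<And>x. x \<in> S \<Longrightarrow> f x = g x" "Ck_on k S f"
  shows "Ck_on k S g"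
  using assms(2,3)
proof (induction k arbitrary: f g)
  case 0
  then show ?case using continuous_on_cong by force
next
  case (Suc k)
  have d: "g differentiable (at x) \<and> frechet_derivative f (at x) = frechet_derivative g (at x)"
    if "x \<in> S" for x
  proof -
    have "(f has_derivative frechet_derivative f (at x)) (at x)"
      using Suc.prems(2) that frechet_derivative_works by auto
    then have "(g has_derivative frechet_derivative f (at x)) (at x)"
      using has_derivative_transform_within_open[OF _ assms(1) that] Suc.prems(1) by blast
    then show ?thesis
      using frechet_derivative_at[of g "frechet_derivative f (at x)" x] differentiableI by metis
  qed
  have "Ck_on k S (\<lambda>x. frechet_derivative g (at x) v)" for v
    by (rule Suc.IH[of "\<lambda>x. frechet_derivative f (at x) v"]) (use Suc.prems(2) d in auto)
  then show ?case using d by simp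
qed

lemma Ck_on_local:
  assumes "\<And>x. x \<in> S \<Longrightarrow> \<exists>N. open N \<and> x \<in> N \<and> Ck_on k N f"
  shows "Ck_on k S f"
  using assms
proof (induction k arbitrary: f)
  case 0
  have "isCont f x" if "x \<in> S" for x
    using 0[OF that] by (auto simp: continuous_on_eq_continuous_at)
  then show ?case by (simp add: continuous_at_imp_continuous_on)
next
  case (Suc k)
  then show ?case by (fastforce intro!: Suc.IH)
qed

lemma Ck_on_SucD: "Ck_on (Suc k) S f \<Longrightarrow> Ck_on k S f"
proof (induction k arbitrary: f)
  case 0
  then show ?case
    by (auto intro!: continuous_at_imp_continuous_on differentiable_imp_continuous_within)
next
  case (Suc k)
  have "Ck_on k S (\<lambda>x. frechet_derivative f (at x) v)" for v
    using Suc.prems by (intro Suc.IH) simp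
  then show ?case using Suc.prems by simp
qed

text \<open>Lets an explicit derivative formula stand in for the chosen
  \<open>frechet_derivative\<close>; this is the induction step of the closure properties that
  follow.\<close>

lemma Ck_on_SucI:
  assumes "open S"
    "\<And>x. x \<in> S \<Longrightarrow> (f has_derivative f' x) (at x)" "\<And>v. Ck_on k S (\<lambda>x. f' x v)"
  shows "Ck_on (Suc k) S f"
proof -
  have "frechet_derivative f (at x) = f' x" if "x \<in> S" for x
    using assms(2)[OF that] frechet_derivative_at by metis
  then have "Ck_on k S (\<lambda>x. frechet_derivative f (at x) v)" for v
    by (intro Ck_on_cong[OF assms(1) _ assms(3)[of v]]) simp
  then show ?thesis using assms(2) by (auto simp: differentiable_def)
qed

lemma Ck_on_has_derivative:
  "Ck_on (Suc k) S f \<Longrightarrow> x \<in> S \<Longrightarrow> (f has_derivative frechet_derivative f (at x)) (at x)"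
  using frechet_derivative_works by auto

lemma Ck_on_const: "Ck_on k S (\<lambda>x. c)"
proof (induction k arbitrary: c)
  case (Suc k)
  then show ?case by simp
qed simp

lemma Ck_on_bounded_linear_compose:
  assumes "open S" "bounded_linear h" "Ck_on k S f"
  shows "Ck_on k S (\<lambda>x. h (f x))"
  using assms(3)
proof (induction k arbitrary: f)
  case 0
  then show ?case by (simp add: bounded_linear.continuous_on[OF assms(2)])
next
  case (Suc k)
  show ?case
    by (rule Ck_on_SucI[OF assms(1) bounded_linear.has_derivative[OF assms(2) Ck_on_has_derivative[OF Suc.prems]]])
      (use Suc in auto)
qed

lemma Ck_on_add:
  assumes "open S" "Ck_on k S f" "Ck_on k S g"
  shows "Ck_on k S (\<lambda>x. f x + g x)"
  using assms(2,3)
proof (induction k arbitrary: f g)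
  case 0
  then show ?case by (simp add: continuous_on_add)
next
  case (Suc k)
  show ?case
    by (rule Ck_on_SucI[OF assms(1) has_derivative_add[OF Ck_on_has_derivative[OF Suc.prems(1)]
          Ck_on_has_derivative[OF Suc.prems(2)]]])
      (use Suc in auto)
qed

lemma Ck_on_sum:
  assumes "open S" "\<And>i. i \<in> I \<Longrightarrow> Ck_on k S (f i)"
  shows "Ck_on k S (\<lambda>x. \<Sum>i\<in>I. f i x)"
  using assms(2)
  by (induction I rule: infinite_finite_induct) (auto intro: Ck_on_const Ck_on_add[OF assms(1)])

lemma Ck_on_scaleR:
  assumes "open S" "Ck_on k S f" "Ck_on k S g"
  shows "Ck_on k S (\<lambda>x. f x *\<^sub>R g x)"
  using assms(2,3)
proof (induction k arbitrary: f g)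
  case 0
  then show ?case by (simp add: continuous_on_scaleR)
next
  case (Suc k)
  show ?case
    by (rule Ck_on_SucI[OF assms(1) has_derivative_scaleR[OF Ck_on_has_derivative[OF Suc.prems(1)]
          Ck_on_has_derivative[OF Suc.prems(2)]]])
      (use Suc Ck_on_SucD[OF Suc.prems(1)] Ck_on_SucD[OF Suc.prems(2)] in \<open>auto intro!: Ck_on_add[OF assms(1)]\<close>)
qed

lemma Ck_on_inverse:
  fixes f :: "'e::euclidean_space \<Rightarrow> real"
  assumes "open S" "Ck_on k S f" "\<And>x. x \<in> S \<Longrightarrow> f x \<noteq> 0"
  shows "Ck_on k S (\<lambda>x. inverse (f x))"
  using assms(2)
proof (induction k)
  case 0
  then show ?case using assms(3) by (simp add: continuous_on_inverse)
next
  case (Suc k)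
  \<comment> \<open>The derivative -(1/f) f' (1/f) is written with \<open>scaleR\<close> throughout,
    so that closure under products applies to it, with the induction hypothesis for 1/f.\<close>
  have d: "((\<lambda>x. inverse (f x)) has_derivative
      (\<lambda>v. - 1 *\<^sub>R (inverse (f x) *\<^sub>R (frechet_derivative f (at x) v *\<^sub>R inverse (f x))))) (at x)"
    if "x \<in> S" for x
    using Deriv.has_derivative_inverse[OF assms(3)[OF that] Ck_on_has_derivative[OF Suc.prems that]] by (simp add: mult.assoc)
  have i: "Ck_on k S (\<lambda>x. inverse (f x))" using Suc.IH Ck_on_SucD[OF Suc.prems] by blast
  show ?case
    by (intro Ck_on_SucI[OF assms(1) d] Ck_on_scaleR[OF assms(1)] Ck_on_const i) (use Suc.prems in auto)
qed

lemma linear_basis_expand: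
  fixes f :: "'e::euclidean_space \<Rightarrow> 'b::real_vector"
  assumes "linear f"
  shows "f w = (\<Sum>b\<in>Basis. (w \<bullet> b) *\<^sub>R f b)"
proof -
  have "f (\<Sum>b\<in>Basis. (w \<bullet> b) *\<^sub>R b) = (\<Sum>b\<in>Basis. (w \<bullet> b) *\<^sub>R f b)"
    by (simp only: linear_sum[OF assms] linear_scale[OF assms])
  then show ?thesis by (simp only: euclidean_representation)
qed

text \<open>In the chain rule the direction fed into the derivative of \<open>h\<close> varies with
  the point, while the induction hypothesis only covers fixed directions. Expanding that direction
  in the basis leaves products and sums of functions of class C^k.\<close>

lemma Ck_on_compose:
  fixes f :: "'e::euclidean_space \<Rightarrow> 'f::euclidean_space"
  assumes "open S" "open R" "Ck_on k S f" "Ck_on k R h" "f ` S \<subseteq> R"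
  shows "Ck_on k S (\<lambda>x. h (f x))"
  using assms(3,4)
proof (induction k arbitrary: h)
  case 0
  then show ?case using assms(5) by (auto intro: continuous_on_compose2)
next
  case (Suc k)
  have d: "((\<lambda>x. h (f x)) has_derivative
      (\<lambda>v. \<Sum>b\<in>Basis. (frechet_derivative f (at x) v \<bullet> b) *\<^sub>R frechet_derivative h (at (f x)) b)) (at x)"
    if "x \<in> S" for x
  proof -
    have h: "(h has_derivative frechet_derivative h (at (f x))) (at (f x))"
      using assms(5) that Suc.prems(2) by (intro Ck_on_has_derivative) auto
    have "((\<lambda>x. h (f x)) has_derivative
        (\<lambda>v. frechet_derivative h (at (f x)) (frechet_derivative f (at x) v))) (at x)"
      by (rule has_derivative_compose[OF Ck_on_has_derivative[OF Suc.prems(1) that] h])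
    also have "(\<lambda>v. frechet_derivative h (at (f x)) (frechet_derivative f (at x) v)) =
        (\<lambda>v. \<Sum>b\<in>Basis. (frechet_derivative f (at x) v \<bullet> b) *\<^sub>R frechet_derivative h (at (f x)) b)"
      by (rule ext) (rule linear_basis_expand[OF has_derivative_linear[OF h]])
    finally show ?thesis .
  qed
  have f: "Ck_on k S f" using Ck_on_SucD Suc.prems by blast
  show ?case
  proof (rule Ck_on_SucI[OF assms(1) d])
    fix v
    have "Ck_on k S (\<lambda>x. frechet_derivative f (at x) v \<bullet> b)" for b
      by (rule Ck_on_bounded_linear_compose[OF assms(1) bounded_linear_inner_left]) (use Suc.prems in simp)
    moreover have "Ck_on k S (\<lambda>x. frechet_derivative h (at (f x)) b)" for b
      by (rule Suc.IH[OF f]) (use Suc.prems in simp)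
    ultimately show "Ck_on k S (\<lambda>x. \<Sum>b\<in>Basis. (frechet_derivative f (at x) v \<bullet> b) *\<^sub>R
        frechet_derivative h (at (f x)) b)"
      by (intro Ck_on_sum[OF assms(1)] Ck_on_scaleR[OF assms(1)])
  qed
qed

lemma smooth_on_subset: "smooth_on S f \<Longrightarrow> T \<subseteq> S \<Longrightarrow> smooth_on T f"
  by (auto simp: smooth_on_def intro: Ck_on_subset)

lemma smooth_on_cong: "open S \<Longrightarrow> (\<And>x. x \<in> S \<Longrightarrow> f x = g x) \<Longrightarrow> smooth_on S f \<Longrightarrow> smooth_on S g"
  unfolding smooth_on_def using Ck_on_cong by blast

lemma smooth_on_local:
  "(\<And>x. x \<in> S \<Longrightarrow> \<exists>N. open N \<and> x \<in> N \<and> smooth_on N f) \<Longrightarrow> smooth_on S f"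
  unfolding smooth_on_def using Ck_on_local by metis

lemma smooth_on_const: "smooth_on S (\<lambda>x. c)"
  by (simp add: smooth_on_def Ck_on_const)

lemma smooth_on_bounded_linear_compose:
  "open S \<Longrightarrow> bounded_linear h \<Longrightarrow> smooth_on S f \<Longrightarrow> smooth_on S (\<lambda>x. h (f x))"
  by (simp add: smooth_on_def Ck_on_bounded_linear_compose)

lemma smooth_on_sum:
  "open S \<Longrightarrow> (\<And>i. i \<in> I \<Longrightarrow> smooth_on S (f i)) \<Longrightarrow> smooth_on S (\<lambda>x. \<Sum>i\<in>I. f i x)"
  by (simp add: smooth_on_def Ck_on_sum)

lemma smooth_on_scaleR:
  "open S \<Longrightarrow> smooth_on S f \<Longrightarrow> smooth_on S g \<Longrightarrow> smooth_on S (\<lambda>x. f x *\<^sub>R g x)"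
  by (simp add: smooth_on_def Ck_on_scaleR)

lemma smooth_on_inverse:
  fixes f :: "'e::euclidean_space \<Rightarrow> real"
  shows "open S \<Longrightarrow> smooth_on S f \<Longrightarrow> (\<And>x. x \<in> S \<Longrightarrow> f x \<noteq> 0) \<Longrightarrow> smooth_on S (\<lambda>x. inverse (f x))"
  by (simp add: smooth_on_def Ck_on_inverse)

lemma smooth_on_compose:
  fixes f :: "'e::euclidean_space \<Rightarrow> 'f::euclidean_space"
  shows "open S \<Longrightarrow> open R \<Longrightarrow> smooth_on S f \<Longrightarrow> smooth_on R h \<Longrightarrow> f ` S \<subseteq> R \<Longrightarrow>
    smooth_on S (\<lambda>x. h (f x))"
  unfolding smooth_on_def using Ck_on_compose by blast

lemma smooth_on_frechet:
  assumes "smooth_on S f"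
  shows "smooth_on S (\<lambda>x. frechet_derivative f (at x) v)"
proof -
  have "Ck_on (Suc k) S f" for k using assms unfolding smooth_on_def by blast
  then show ?thesis by (simp add: smooth_on_def)
qed

lemma smooth_on_has_derivative:
  assumes "smooth_on S f" "x \<in> S"
  shows "(f has_derivative frechet_derivative f (at x)) (at x)"
  using assms Ck_on_has_derivative[of 0] unfolding smooth_on_def by blast

lemma smooth_on_continuous_on: "smooth_on S f \<Longrightarrow> continuous_on S f"
  unfolding smooth_on_def by (metis Ck_on.simps(1))

text \<open>
  The derivative of \<open>y \<mapsto> A\<^sub>y\<^sup>-\<^sup>1 v\<close> is obtained by inverting the map \<open>(y, u) \<mapsto> (y, A\<^sub>y u)\<close>.
\<close>

lemma has_derivative_inverse_family:
  fixes A :: "'e::euclidean_space \<Rightarrow> 'f::euclidean_space \<Rightarrow> 'f"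
  assumes R: "open R" "y \<in> R"
    and lin: "\<And>z. z \<in> R \<Longrightarrow> linear (A z)"
    and BA: "\<And>z u. z \<in> R \<Longrightarrow> B z (A z u) = u"
    and AB: "\<And>u. A y (B y u) = u" and linB: "linear (B y)"
    and dA: "\<And>z u. z \<in> R \<Longrightarrow> ((\<lambda>z. A z u) has_derivative A' z u) (at z)"
  shows "((\<lambda>z. B z v) has_derivative (\<lambda>h. - B y (A' y (B y v) h))) (at y)"
proof -
  \<comment> \<open>The basis expansion makes the joint differentiability in (y, u) visible: only
    the finitely many maps \<open>A z b\<close> with fixed \<open>b\<close> have to be
    differentiated in \<open>z\<close>.\<close>
  define \<Phi> where "\<Phi> = (\<lambda>p::'e \<times> 'f. (fst p, \<Sum>b\<in>Basis. (snd p \<bullet> b) *\<^sub>R A (fst p) b))"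
  define \<Psi> where "\<Psi> = (\<lambda>p::'e \<times> 'f. (fst p, B (fst p) (snd p)))"
  define u where "u = B y v"
  have \<Phi>: "\<Phi> p = (fst p, A (fst p) (snd p))" if "fst p \<in> R" for p
    using linear_basis_expand[OF lin[OF that], of "snd p"] by (simp add: \<Phi>_def)
  have dA1: "((\<lambda>p::'e\<times>'f. A (fst p) b) has_derivative (\<lambda>p. A' (fst q) b (fst p))) (at q)"
    if "fst q \<in> R" for b q
    using has_derivative_compose[OF has_derivative_fst[OF has_derivative_ident] dA[OF that, of b]] by simp
  have d: "(\<Phi> has_derivative (\<lambda>h. (fst h, \<Sum>b\<in>Basis. (snd q \<bullet> b) *\<^sub>R A' (fst q) b (fst h) +
      (snd h \<bullet> b) *\<^sub>R A (fst q) b))) (at q)" if "fst q \<in> R" for q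
    unfolding \<Phi>_def
    by (rule has_derivative_Pair has_derivative_fst has_derivative_ident has_derivative_sum
        has_derivative_scaleR has_derivative_inner_left has_derivative_snd dA1[OF that])+
  have cont: "continuous_on (R \<times> UNIV) \<Phi>"
    by (rule continuous_at_imp_continuous_on) (use d has_derivative_continuous in fastforce)
  have op: "open (R \<times> (UNIV::'f set))" using R by (simp add: open_Times)
  have mem: "(y, u) \<in> R \<times> UNIV" using R by simp
  have inverse: "\<Psi> (\<Phi> p) = p" if "p \<in> R \<times> UNIV" for p
    using that BA by (auto simp: \<Psi>_def \<Phi>)
  \<comment> \<open>The derivative of \<open>A z u\<close> in \<open>z\<close> inherits linearity in
    \<open>u\<close> from \<open>A z\<close>, by uniqueness of derivatives.\<close>
  have A'u: "A' y u h = (\<Sum>b\<in>Basis. (u \<bullet> b) *\<^sub>R A' y b h)" for h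
  proof -
    have "((\<lambda>z. \<Sum>b\<in>Basis. (u \<bullet> b) *\<^sub>R A z b) has_derivative (\<lambda>h. \<Sum>b\<in>Basis. (u \<bullet> b) *\<^sub>R A' y b h)) (at y)"
      by (intro has_derivative_sum has_derivative_scaleR_right dA R)
    then have "((\<lambda>z. A z u) has_derivative (\<lambda>h. \<Sum>b\<in>Basis. (u \<bullet> b) *\<^sub>R A' y b h)) (at y)"
      by (rule has_derivative_transform_within_open[OF _ R])
        (rule linear_basis_expand[OF lin, symmetric])
    then show ?thesis using has_derivative_unique[OF dA[OF R(2), of u]] by metis
  qed
  have d': "(\<Phi> has_derivative (\<lambda>h. (fst h, A' y u (fst h) + A y (snd h)))) (at (y, u))"
  proof -
    have "(\<Sum>b\<in>Basis. (u \<bullet> b) *\<^sub>R A' y b (fst h) + (snd h \<bullet> b) *\<^sub>R A y b) =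
        A' y u (fst h) + A y (snd h)" for h :: "'e \<times> 'f"
      unfolding sum.distrib A'u by (subst linear_basis_expand[OF lin[OF R(2)], of "snd h"]) (rule refl)
    moreover have "fst (y, u) \<in> R" using R(2) by simp
    note d[OF this]
    ultimately show ?thesis by (simp only: fst_conv snd_conv)
  qed
  \<comment> \<open>The derivative of \<Phi> is block triangular with diagonal blocks the identity
    and \<open>A y\<close>; solving for the second component gives its inverse.\<close>
  have "(\<lambda>h. (fst h, A' y u (fst h) + A y (snd h))) \<circ>
      (\<lambda>h. (fst h, B y (snd h - A' y u (fst h)))) = id"
    using AB by (auto simp: fun_eq_iff)
  from has_derivative_inverse_strong[OF op mem cont inverse d' this]
  have "(\<Psi> has_derivative (\<lambda>h. (fst h, B y (snd h - A' y u (fst h))))) (at (\<Phi> (y, u)))" .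
  moreover have "\<Phi> (y, u) = (y, v)" using R(2) AB by (simp add: \<Phi> u_def)
  ultimately have 1: "(\<Psi> has_derivative (\<lambda>h. (fst h, B y (snd h - A' y u (fst h))))) (at (y, v))"
    by simp
  have "((\<lambda>z. (z, v)) has_derivative (\<lambda>h. (h, 0))) (at y)"
    by (intro derivative_intros)
  from has_derivative_snd[OF has_derivative_compose[OF this 1]]
  show ?thesis by (simp add: \<Psi>_def u_def linear_neg[OF linB])
qed

text \<open>A bootstrap on the pair of \<open>g\<close> and \<open>B\<close>, where
  \<open>B y\<close> inverts the derivative of \<open>f\<close> at \<open>g y\<close>. The
  derivative of \<open>g\<close> is \<open>B\<close>, and that of \<open>B\<close> is an expression
  in \<open>B\<close> and the second derivative of \<open>f\<close> composed with \<open>g\<close>,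
  so class C^k of both yields class C^(k+1) of both.\<close>

lemma smooth_on_inverse_function:
  fixes f :: "'e::euclidean_space \<Rightarrow> 'e"
  assumes S: "open S" and R: "open R" and f: "smooth_on S f" and "f ` S \<subseteq> R" "g ` R \<subseteq> S"
    and gf: "\<And>x. x \<in> S \<Longrightarrow> g (f x) = x" and fg: "\<And>y. y \<in> R \<Longrightarrow> f (g y) = y"
    and inj: "\<And>x. x \<in> S \<Longrightarrow> inj (frechet_derivative f (at x))"
  shows "smooth_on R g"
proof -
  define F where "F x = frechet_derivative f (at x)" for x
  define B where "B y = inv (F (g y))" for y
  define F2 where "F2 x u = frechet_derivative (\<lambda>x. F x u) (at x)" for x u
  have g: "g y \<in> S" if "y \<in> R" for y using assms(5) that by blast
  have linF: "linear (F x)" if "x \<in> S" for x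
    unfolding F_def using smooth_on_has_derivative[OF f that] has_derivative_linear by blast
  have bij: "bij (F x)" if "x \<in> S" for x
    using linear_injective_imp_surjective[OF linF[OF that]] inj[OF that] by (auto simp: F_def bij_def)
  have linB: "linear (B y)" if "y \<in> R" for y
    unfolding B_def
    using inj_linear_imp_inv_linear[OF linF[OF g[OF that]]] bij[OF g[OF that]]
    by (simp add: bij_def)
  have FB: "F (g y) (B y u) = u" and BF: "B y (F (g y) u) = u" if "y \<in> R" for y u
    using bij[OF g[OF that]] by (auto simp: B_def bij_def surj_f_inv_f)
  have dg: "(g has_derivative B y) (at y)" if "y \<in> R" for y
    using has_derivative_inverse_strong[OF S g[OF that] smooth_on_continuous_on[OF f] gf
        smooth_on_has_derivative[OF f g[OF that]], of "B y"] FB[OF that] fg[OF that]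
    by (auto simp: F_def fun_eq_iff)
  have F: "smooth_on S (\<lambda>x. F x u)" for u
    unfolding F_def by (rule smooth_on_frechet[OF f])
  have F2: "smooth_on S (\<lambda>x. F2 x u w)" for u w
    unfolding F2_def by (rule smooth_on_frechet[OF F])
  have linF2: "linear (F2 x u)" if "x \<in> S" for x u
    unfolding F2_def using smooth_on_has_derivative[OF F that] has_derivative_linear by blast
  \<comment> \<open>The directions \<open>B y v\<close> and \<open>B y h\<close> will move with
    \<open>y\<close>; expanding both slots leaves second derivatives in fixed directions, which
    compose smoothly with \<open>g\<close>.\<close>
  have F2_expand: "F2 x u w = (\<Sum>b\<in>Basis. (u \<bullet> b) *\<^sub>R (\<Sum>a\<in>Basis. (w \<bullet> a) *\<^sub>R F2 x b a))"
    if "x \<in> S" for x u w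
  proof -
    have "((\<lambda>x. \<Sum>b\<in>Basis. (u \<bullet> b) *\<^sub>R F x b) has_derivative (\<lambda>h. \<Sum>b\<in>Basis. (u \<bullet> b) *\<^sub>R F2 x b h)) (at x)"
      unfolding F2_def by (intro has_derivative_sum has_derivative_scaleR_right smooth_on_has_derivative[OF F that])
    then have "((\<lambda>x. F x u) has_derivative (\<lambda>h. \<Sum>b\<in>Basis. (u \<bullet> b) *\<^sub>R F2 x b h)) (at x)"
      by (rule has_derivative_transform_within_open[OF _ S that])
        (rule linear_basis_expand[OF linF, symmetric])
    from fun_cong[OF frechet_derivative_at[OF this], of w]
    have "F2 x u w = (\<Sum>b\<in>Basis. (u \<bullet> b) *\<^sub>R F2 x b w)"
      unfolding F2_def by simp
    also have "\<dots> = (\<Sum>b\<in>Basis. (u \<bullet> b) *\<^sub>R (\<Sum>a\<in>Basis. (w \<bullet> a) *\<^sub>R F2 x b a))"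
      by (intro sum.cong refl arg_cong2[where f=scaleR] linear_basis_expand[OF linF2[OF that]])
    finally show ?thesis .
  qed
  have dB: "((\<lambda>z. B z v) has_derivative (\<lambda>h. - B y (F2 (g y) (B y v) (B y h)))) (at y)" if "y \<in> R" for y v
  proof (rule has_derivative_inverse_family[OF R that, where A="\<lambda>z. F (g z)" and A'="\<lambda>z u h. F2 (g z) u (B z h)"])
    fix z u assume z: "z \<in> R"
    show "((\<lambda>z. F (g z) u) has_derivative (\<lambda>h. F2 (g z) u (B z h))) (at z)"
      unfolding F2_def by (rule has_derivative_compose[OF dg[OF z] smooth_on_has_derivative[OF F g[OF z]]])
  qed (use linF g FB BF linB that in auto)
  have "Ck_on k R g \<and> (\<forall>v. Ck_on k R (\<lambda>y. B y v))" for k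
  proof (induction k)
    case 0
    show ?case
      using dg dB by (auto intro!: continuous_at_imp_continuous_on dest: has_derivative_continuous)
  next
    case (Suc k)
    have F2g: "Ck_on k R (\<lambda>y. F2 (g y) b a)" for a b
      using Ck_on_compose[OF R S _ _ assms(5)] Suc F2 unfolding smooth_on_def by blast
    have Bc: "Ck_on k R (\<lambda>y. B y v \<bullet> b)" for b v
      using Ck_on_bounded_linear_compose[OF R bounded_linear_inner_left] Suc by blast
    define q where "q y v h = (\<Sum>b\<in>Basis. (B y v \<bullet> b) *\<^sub>R (\<Sum>a\<in>Basis. (B y h \<bullet> a) *\<^sub>R F2 (g y) b a))" for y v h
    have q: "Ck_on k R (\<lambda>y. q y v h)" for v h
      unfolding q_def by (intro Ck_on_sum[OF R] Ck_on_scaleR[OF R] Bc F2g)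
    have 1: "Ck_on k R (\<lambda>y. - 1 *\<^sub>R (\<Sum>c\<in>Basis. (q y v h \<bullet> c) *\<^sub>R B y c))" for v h
      by (intro Ck_on_sum[OF R] Ck_on_scaleR[OF R] Ck_on_const
          Ck_on_bounded_linear_compose[OF R bounded_linear_inner_left] q) (use Suc in auto)
    have "Ck_on k R (\<lambda>y. - B y (F2 (g y) (B y v) (B y h)))" for v h
    proof (rule Ck_on_cong[OF R _ 1[of v h]])
      fix y assume y: "y \<in> R"
      show "- 1 *\<^sub>R (\<Sum>c\<in>Basis. (q y v h \<bullet> c) *\<^sub>R B y c) = - B y (F2 (g y) (B y v) (B y h))"
        using linear_basis_expand[OF linB[OF y], of "q y v h"] F2_expand[OF g[OF y], of "B y v" "B y h"]
        by (simp add: q_def)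
    qed
    then have "Ck_on (Suc k) R (\<lambda>y. B y v)" for v
      using dB by (intro Ck_on_SucI[OF R, where f'="\<lambda>y h. - B y (F2 (g y) (B y v) (B y h))"]) auto
    moreover have "Ck_on (Suc k) R g"
      using dg Suc by (intro Ck_on_SucI[OF R]) auto
    ultimately show ?case by blast
  qed
  then show ?thesis by (simp add: smooth_on_def)
qed

section \<open>Symmetry of second derivatives\<close>

lemma second_difference_mean_value:
  fixes f :: "'e::euclidean_space \<Rightarrow> real"
  assumes f: "smooth_on (ball x r) f" and h: "h > 0" "h * (norm u + norm v) < r"
  shows "\<exists>y. dist x y \<le> h * (norm u + norm v) \<and>
    f (x + h *\<^sub>R u + h *\<^sub>R v) - f (x + h *\<^sub>R u) - f (x + h *\<^sub>R v) + f x =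
    h * h * frechet_derivative (\<lambda>x. frechet_derivative f (at x) u) (at y) v"
proof -
  define F where "F x = frechet_derivative f (at x) u" for x
  have near: "dist x (x + s *\<^sub>R u + t *\<^sub>R v) \<le> h * (norm u + norm v)"
    if "0 \<le> s" "s \<le> h" "0 \<le> t" "t \<le> h" for s t
  proof -
    have "dist x (x + s *\<^sub>R u + t *\<^sub>R v) = norm (s *\<^sub>R u + t *\<^sub>R v)"
      by (metis add.assoc dist_norm norm_minus_commute add_diff_cancel_left')
    also have "\<dots> \<le> s * norm u + t * norm v"
      using norm_triangle_ineq[of "s *\<^sub>R u" "t *\<^sub>R v"] that by simp
    also have "\<dots> \<le> h * norm u + h * norm v"
      using that by (intro add_mono mult_right_mono) auto
    finally show ?thesis by (simp add: algebra_simps)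
  qed
  have inb: "x + s *\<^sub>R u + t *\<^sub>R v \<in> ball x r"
    if "0 \<le> s" "s \<le> h" "0 \<le> t" "t \<le> h" for s t
    using near[OF that] h by simp
  have d1: "((\<lambda>s. f (x + s *\<^sub>R u + t *\<^sub>R v)) has_real_derivative F (x + s *\<^sub>R u + t *\<^sub>R v)) (at s)"
    if "0 \<le> s" "s \<le> h" "0 \<le> t" "t \<le> h" for s t
  proof -
    have D: "(f has_derivative frechet_derivative f (at (x + s *\<^sub>R u + t *\<^sub>R v))) (at (x + s *\<^sub>R u + t *\<^sub>R v))"
      by (rule smooth_on_has_derivative[OF f inb[OF that]])
    have "((\<lambda>s. x + s *\<^sub>R u + t *\<^sub>R v) has_derivative (\<lambda>h. h *\<^sub>R u)) (at s)"
      by (auto intro!: derivative_eq_intros)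
    from has_derivative_compose[OF this D] has_derivative_linear[OF D]
    show ?thesis by (simp add: has_field_derivative_def F_def linear_scale mult.commute[of _ "frechet_derivative _ _ _"])
  qed
  have Fs: "smooth_on (ball x r) F" unfolding F_def by (rule smooth_on_frechet[OF f])
  have d2: "((\<lambda>t. F (x + s *\<^sub>R u + t *\<^sub>R v)) has_real_derivative
      frechet_derivative F (at (x + s *\<^sub>R u + t *\<^sub>R v)) v) (at t)"
    if "0 \<le> s" "s \<le> h" "0 \<le> t" "t \<le> h" for s t
  proof -
    have D: "(F has_derivative frechet_derivative F (at (x + s *\<^sub>R u + t *\<^sub>R v))) (at (x + s *\<^sub>R u + t *\<^sub>R v))"
      by (rule smooth_on_has_derivative[OF Fs inb[OF that]])
    have "((\<lambda>t. x + s *\<^sub>R u + t *\<^sub>R v) has_derivative (\<lambda>h. h *\<^sub>R v)) (at t)"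
      by (auto intro!: derivative_eq_intros)
    from has_derivative_compose[OF this D] has_derivative_linear[OF D]
    show ?thesis by (simp add: has_field_derivative_def linear_scale mult.commute[of _ "frechet_derivative _ _ _"])
  qed
  \<comment> \<open>The second difference is the increment over s of the increment in direction
    \<open>v\<close>. The mean value theorem in s, and then in t, turns it into a single mixed
    derivative.\<close>
  have "((\<lambda>s. f (x + s *\<^sub>R u + h *\<^sub>R v) - f (x + s *\<^sub>R u + 0 *\<^sub>R v)) has_real_derivative
      F (x + s *\<^sub>R u + h *\<^sub>R v) - F (x + s *\<^sub>R u + 0 *\<^sub>R v)) (at s)"
    if "0 \<le> s" "s \<le> h" for s
    by (rule DERIV_diff[OF d1 d1]) (use that h in auto)
  from MVT2[OF h(1) this] obtain s where s: "0 < s" "s < h" and 1: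
    "(f (x + h *\<^sub>R u + h *\<^sub>R v) - f (x + h *\<^sub>R u + 0 *\<^sub>R v)) - (f (x + 0 *\<^sub>R u + h *\<^sub>R v) - f (x + 0 *\<^sub>R u + 0 *\<^sub>R v)) =
      (h - 0) * (F (x + s *\<^sub>R u + h *\<^sub>R v) - F (x + s *\<^sub>R u + 0 *\<^sub>R v))"
    by blast
  obtain t where t: "0 < t" "t < h" and 2:
    "F (x + s *\<^sub>R u + h *\<^sub>R v) - F (x + s *\<^sub>R u + 0 *\<^sub>R v) =
      (h - 0) * frechet_derivative F (at (x + s *\<^sub>R u + t *\<^sub>R v)) v"
    using MVT2[OF h(1) d2[of s]] s by auto
  show ?thesis
    using 1 2 near[of s t] s t unfolding F_def
    by (intro exI[of _ "x + s *\<^sub>R u + t *\<^sub>R v"]) (simp add: algebra_simps)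
qed

text \<open>The second difference does not change when \<open>u\<close> and \<open>v\<close> are
  exchanged, so the two mixed derivatives agree at points arbitrarily close to \<open>x\<close>, and
  by continuity at \<open>x\<close>. Real-valued functions are treated by contradiction,
  vector-valued ones coordinate by coordinate.\<close>

lemma symmetric_second_derivative:
  fixes f :: "'e::euclidean_space \<Rightarrow> 'f::euclidean_space"
  assumes S: "open S" "x \<in> S" and f: "smooth_on S f"
  shows "frechet_derivative (\<lambda>x. frechet_derivative f (at x) u) (at x) v =
    frechet_derivative (\<lambda>x. frechet_derivative f (at x) v) (at x) u"
proof -
  have real: "frechet_derivative (\<lambda>x. frechet_derivative f (at x) u) (at x) v =
    frechet_derivative (\<lambda>x. frechet_derivative f (at x) v) (at x) u"
    if f: "smooth_on S f" for f :: "'e \<Rightarrow> real"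
  proof (rule ccontr)
    define G where "G u v y = frechet_derivative (\<lambda>x. frechet_derivative f (at x) u) (at y) v" for u v y
    assume "\<not> ?thesis"
    then have ne: "G u v x \<noteq> G v u x" by (simp add: G_def)
    define e where "e = \<bar>G u v x - G v u x\<bar> / 2"
    have e: "e > 0" using ne by (simp add: e_def)
    have cont: "isCont (G a b) x" for a b
      using smooth_on_continuous_on[OF smooth_on_frechet[OF smooth_on_frechet[OF f]]] S
      unfolding G_def[abs_def] by (auto simp: continuous_on_eq_continuous_at)
    obtain d1 where d1: "d1 > 0" "\<And>y. dist y x < d1 \<Longrightarrow> dist (G u v y) (G u v x) < e"
      using cont[of u v] e unfolding continuous_at_eps_delta by blast
    obtain d2 where d2: "d2 > 0" "\<And>y. dist y x < d2 \<Longrightarrow> dist (G v u y) (G v u x) < e"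
      using cont[of v u] e unfolding continuous_at_eps_delta by blast
    obtain r where r: "r > 0" "ball x r \<subseteq> S" using S openE by blast
    define m where "m = min r (min d1 d2)"
    \<comment> \<open>The summand 1 keeps the denominator positive when \<open>u\<close> and
      \<open>v\<close> vanish, and makes the bound h (|u| + |v|) < m strict.\<close>
    define h where "h = m / (norm u + norm v + 1)"
    have m: "m > 0" using r d1 d2 by (simp add: m_def)
    have n: "norm u + norm v + 1 > 0" by (simp add: add_nonneg_pos)
    have h: "h > 0" using m n by (simp add: h_def)
    have "h * (norm u + norm v) < h * (norm u + norm v + 1)" using h by simp
    also have "\<dots> = m" using n by (simp add: h_def)
    finally have hm: "h * (norm u + norm v) < m" .
    have fb: "smooth_on (ball x r) f" using smooth_on_subset[OF f r(2)] .
    have hr: "h * (norm u + norm v) < r" "h * (norm v + norm u) < r" using hm by (auto simp: m_def add.commute)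
    obtain y where y: "dist x y \<le> h * (norm u + norm v)"
      "f (x + h *\<^sub>R u + h *\<^sub>R v) - f (x + h *\<^sub>R u) - f (x + h *\<^sub>R v) + f x = h * h * G u v y"
      using second_difference_mean_value[OF fb h hr(1)] unfolding G_def by blast
    obtain z where z: "dist x z \<le> h * (norm v + norm u)"
      "f (x + h *\<^sub>R v + h *\<^sub>R u) - f (x + h *\<^sub>R v) - f (x + h *\<^sub>R u) + f x = h * h * G v u z"
      using second_difference_mean_value[OF fb h hr(2)] unfolding G_def by blast
    have "f (x + h *\<^sub>R v + h *\<^sub>R u) = f (x + h *\<^sub>R u + h *\<^sub>R v)" by (simp add: add.assoc add.commute[of "h *\<^sub>R v"])
    then have "h * h * G u v y = h * h * G v u z" using y(2) z(2) by linarith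
    then have "G u v y = G v u z" using h by simp
    moreover have "dist (G u v y) (G u v x) < e" "dist (G v u z) (G v u x) < e"
      using y(1) z(1) hm by (auto intro!: d1(2) d2(2) simp: m_def dist_commute[of _ x] add.commute)
    ultimately show False unfolding e_def dist_real_def by argo
  qed
  have inner: "frechet_derivative (\<lambda>x. frechet_derivative f (at x) u) (at x) v \<bullet> c =
      frechet_derivative (\<lambda>x. frechet_derivative (\<lambda>x. f x \<bullet> c) (at x) u) (at x) v" for u v c
  proof -
    have 1: "frechet_derivative (\<lambda>x. f x \<bullet> c) (at y) u = frechet_derivative f (at y) u \<bullet> c" if "y \<in> S" for y
      using frechet_derivative_at[OF has_derivative_inner_left[OF smooth_on_has_derivative[OF f that]]] by metis
    have "((\<lambda>x. frechet_derivative f (at x) u \<bullet> c) has_derivative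
        (\<lambda>v. frechet_derivative (\<lambda>x. frechet_derivative f (at x) u) (at x) v \<bullet> c)) (at x)"
      by (rule has_derivative_inner_left[OF smooth_on_has_derivative[OF smooth_on_frechet[OF f] S(2)]])
    then have "((\<lambda>x. frechet_derivative (\<lambda>x. f x \<bullet> c) (at x) u) has_derivative
        (\<lambda>v. frechet_derivative (\<lambda>x. frechet_derivative f (at x) u) (at x) v \<bullet> c)) (at x)"
      by (rule has_derivative_transform_within_open[OF _ S]) (simp add: 1)
    then show ?thesis using frechet_derivative_at by metis
  qed
  show ?thesis
  proof (rule euclidean_eqI)
    fix c :: 'f assume "c \<in> Basis"
    have "smooth_on S (\<lambda>x. f x \<bullet> c)"
      by (rule smooth_on_bounded_linear_compose[OF S(1) bounded_linear_inner_left f])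
    then show "frechet_derivative (\<lambda>x. frechet_derivative f (at x) u) (at x) v \<bullet> c =
      frechet_derivative (\<lambda>x. frechet_derivative f (at x) v) (at x) u \<bullet> c"
      unfolding inner by (rule real)
  qed
qed

section \<open>Smooth functions and vector fields on manifolds\<close>

text \<open>Vector values are allowed so that chart maps and component functions of fields count as
  smooth functions too.\<close>

definition smooth_fun_on ::
  "('a, 'e::euclidean_space) manifold \<Rightarrow> 'a set \<Rightarrow> ('a \<Rightarrow> 'b::real_normed_vector) \<Rightarrow> bool" where
  "smooth_fun_on M W f \<longleftrightarrow>
     (\<forall>c\<in>atlas M. smooth_on (snd c ` (fst c \<inter> W)) (f \<circ> chart_inv c))"

lemma smooth_function_on_iff: "smooth_function_on M W f \<longleftrightarrow> smooth_fun_on M W f"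
  by (simp add: smooth_function_on_def smooth_fun_on_def)

lemma smooth_fun_on_subset: "smooth_fun_on M W f \<Longrightarrow> V \<subseteq> W \<Longrightarrow> smooth_fun_on M V f"
  unfolding smooth_fun_on_def by (meson Int_mono image_mono order_refl smooth_on_subset)

lemma vector_field_on_subset: "vector_field_on M W X \<Longrightarrow> V \<subseteq> W \<Longrightarrow> vector_field_on M V X"
  unfolding vector_field_on_def by (meson Int_mono image_mono order_refl smooth_on_subset)

locale smooth_mfd =
  fixes M :: "('a, 'e::euclidean_space) manifold"
  assumes mfd: "smooth_manifold M"
begin

lemma chart_open: "c \<in> atlas M \<Longrightarrow> openin (mtop M) (fst c)"
  and chart_homeo: "c \<in> atlas M \<Longrightarrow>
    homeomorphic_map (subtopology (mtop M) (fst c)) (top_of_set (snd c ` fst c)) (snd c)"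
  and chart_range_open: "c \<in> atlas M \<Longrightarrow> open (snd c ` fst c)"
  and transition: "c \<in> atlas M \<Longrightarrow> d \<in> atlas M \<Longrightarrow>
    smooth_on (snd c ` (fst c \<inter> fst d)) (snd d \<circ> chart_inv c)"
  and topspace_charts: "topspace (mtop M) = (\<Union>c\<in>atlas M. fst c)"
  using mfd unfolding smooth_manifold_def by auto

lemma chart_subset: "c \<in> atlas M \<Longrightarrow> fst c \<subseteq> topspace (mtop M)"
  using chart_open openin_subset by blast

lemma topspace_chart: "c \<in> atlas M \<Longrightarrow> topspace (subtopology (mtop M) (fst c)) = fst c"
  using chart_subset[of c] by auto

lemma chart_inj: "c \<in> atlas M \<Longrightarrow> inj_on (snd c) (fst c)"
  using chart_homeo topspace_chart unfolding homeomorphic_map_def by metis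

lemma chart_inv_chart: "c \<in> atlas M \<Longrightarrow> p \<in> fst c \<Longrightarrow> chart_inv c (snd c p) = p"
  by (simp add: chart_inv_def chart_inj)

lemma chart_at:
  assumes "p \<in> topspace (mtop M)"
  shows "chart_at M p \<in> atlas M" "p \<in> fst (chart_at M p)"
proof -
  have "\<exists>c. c \<in> atlas M \<and> p \<in> fst c" using assms topspace_charts by auto
  then have "chart_at M p \<in> atlas M \<and> p \<in> fst (chart_at M p)"
    unfolding chart_at_def by (rule someI_ex)
  then show "chart_at M p \<in> atlas M" "p \<in> fst (chart_at M p)" by auto
qed

lemma chart_image_open:
  assumes c: "c \<in> atlas M" and W: "openin (mtop M) W"
  shows "open (snd c ` (fst c \<inter> W))"
proof -
  have "openin (subtopology (mtop M) (fst c)) (fst c \<inter> W)"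
    using W by (simp add: openin_subtopology_Int2)
  then have "openin (top_of_set (snd c ` fst c)) (snd c ` (fst c \<inter> W))"
    using homeomorphic_imp_open_map[OF chart_homeo[OF c]] unfolding open_map_def by blast
  then show ?thesis using chart_range_open[OF c] openin_open_eq by blast
qed

lemma chart_preimage_open:
  assumes c: "c \<in> atlas M" and R: "open R"
  shows "openin (mtop M) {q \<in> fst c. snd c q \<in> R}"
proof -
  have "openin (top_of_set (snd c ` fst c)) (snd c ` fst c \<inter> R)"
    using R by (rule openin_open_Int)
  from openin_continuous_map_preimage[OF homeomorphic_imp_continuous_map[OF chart_homeo[OF c]] this]
  have "openin (subtopology (mtop M) (fst c)) {q \<in> fst c. snd c q \<in> snd c ` fst c \<inter> R}"
    unfolding topspace_chart[OF c] .
  then have "openin (mtop M) {q \<in> fst c. snd c q \<in> snd c ` fst c \<inter> R}"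
    unfolding openin_open_subtopology[OF chart_open[OF c]] ..
  moreover have "{q \<in> fst c. snd c q \<in> snd c ` fst c \<inter> R} = {q \<in> fst c. snd c q \<in> R}" by auto
  ultimately show ?thesis by simp
qed

text \<open>Transition maps are smooth, so a single chart around each point suffices to test
  smoothness.\<close>

lemma smooth_fun_onI:
  assumes "\<And>p. p \<in> W \<Longrightarrow> \<exists>c\<in>atlas M. \<exists>V. openin (mtop M) V \<and> p \<in> V \<and> V \<subseteq> fst c \<and>
    smooth_on (snd c ` V) (f \<circ> chart_inv c)"
  shows "smooth_fun_on M W f"
  unfolding smooth_fun_on_def
proof (intro ballI smooth_on_local)
  fix d x assume d: "d \<in> atlas M" and x: "x \<in> snd d ` (fst d \<inter> W)"
  then obtain p where p: "p \<in> fst d" "p \<in> W" "x = snd d p" by auto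
  obtain c V where c: "c \<in> atlas M" and V: "openin (mtop M) V" "p \<in> V" "V \<subseteq> fst c"
    and f: "smooth_on (snd c ` V) (f \<circ> chart_inv c)"
    using assms[OF p(2)] by blast
  have oN: "open (snd d ` (fst d \<inter> V))" using chart_image_open[OF d V(1)] .
  have oV: "open (snd c ` V)" using chart_image_open[OF c V(1)] V(3) by (simp add: Int_absorb1)
  have "smooth_on (snd d ` (fst d \<inter> V)) (snd c \<circ> chart_inv d)"
    by (rule smooth_on_subset[OF transition[OF d c]]) (use V in auto)
  moreover have "(snd c \<circ> chart_inv d) ` (snd d ` (fst d \<inter> V)) \<subseteq> snd c ` V"
    using chart_inv_chart[OF d] by auto
  ultimately have "smooth_on (snd d ` (fst d \<inter> V)) (\<lambda>x. (f \<circ> chart_inv c) ((snd c \<circ> chart_inv d) x))"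
    by (rule smooth_on_compose[OF oN oV _ f])
  then have "smooth_on (snd d ` (fst d \<inter> V)) (f \<circ> chart_inv d)"
    by (rule smooth_on_cong[OF oN, rotated])
      (use V chart_inv_chart[OF d] chart_inv_chart[OF c] in auto)
  then show "\<exists>N. open N \<and> x \<in> N \<and> smooth_on N (f \<circ> chart_inv d)"
    using oN p V by blast
qed

lemma smooth_fun_on_local:
  assumes "\<And>p. p \<in> W \<Longrightarrow> \<exists>V. openin (mtop M) V \<and> p \<in> V \<and> smooth_fun_on M V f"
  shows "smooth_fun_on M W f"
proof (rule smooth_fun_onI)
  fix p assume "p \<in> W"
  then obtain V where V: "openin (mtop M) V" "p \<in> V" "smooth_fun_on M V f" using assms by blast
  then have p: "p \<in> topspace (mtop M)" using openin_subset by blast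
  show "\<exists>c\<in>atlas M. \<exists>V. openin (mtop M) V \<and> p \<in> V \<and> V \<subseteq> fst c \<and> smooth_on (snd c ` V) (f \<circ> chart_inv c)"
    using V chart_at[OF p] chart_open[OF chart_at(1)[OF p]]
    by (intro bexI[of _ "chart_at M p"] exI[of _ "fst (chart_at M p) \<inter> V"])
      (auto simp: smooth_fun_on_def)
qed

lemma smooth_fun_on_cong:
  assumes W: "openin (mtop M) W" and fg: "\<And>q. q \<in> W \<Longrightarrow> f q = g q" and f: "smooth_fun_on M W f"
  shows "smooth_fun_on M W g"
  unfolding smooth_fun_on_def
proof
  fix c assume c: "c \<in> atlas M"
  show "smooth_on (snd c ` (fst c \<inter> W)) (g \<circ> chart_inv c)"
    by (rule smooth_on_cong[OF chart_image_open[OF c W], of "f \<circ> chart_inv c"])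
      (use f fg chart_inv_chart[OF c] c in \<open>auto simp: smooth_fun_on_def\<close>)
qed

lemma smooth_fun_on_const: "smooth_fun_on M W (\<lambda>q. k)"
  by (simp add: smooth_fun_on_def o_def smooth_on_const)

lemma smooth_fun_on_bounded_linear:
  "openin (mtop M) W \<Longrightarrow> bounded_linear h \<Longrightarrow> smooth_fun_on M W f \<Longrightarrow> smooth_fun_on M W (\<lambda>q. h (f q))"
  unfolding smooth_fun_on_def o_def
  by (rule ballI, rule smooth_on_bounded_linear_compose[where h=h]) (simp_all add: chart_image_open)

lemma smooth_fun_on_sum:
  "openin (mtop M) W \<Longrightarrow> (\<And>i. i \<in> I \<Longrightarrow> smooth_fun_on M W (f i)) \<Longrightarrow> smooth_fun_on M W (\<lambda>q. \<Sum>i\<in>I. f i q)"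
  unfolding smooth_fun_on_def o_def by (intro ballI smooth_on_sum chart_image_open) simp_all

lemma smooth_fun_on_scaleR:
  "openin (mtop M) W \<Longrightarrow> smooth_fun_on M W f \<Longrightarrow> smooth_fun_on M W g \<Longrightarrow>
    smooth_fun_on M W (\<lambda>q. f q *\<^sub>R g q)"
  unfolding smooth_fun_on_def o_def by (intro ballI smooth_on_scaleR chart_image_open) simp_all

lemma smooth_fun_on_add:
  assumes "openin (mtop M) W" "smooth_fun_on M W f" "smooth_fun_on M W g"
  shows "smooth_fun_on M W (\<lambda>q. f q + g q)"
  \<comment> \<open>Addition is treated as a sum indexed by the two booleans.\<close>
  using smooth_fun_on_sum[OF assms(1), of "UNIV::bool set" "\<lambda>b. if b then f else g"] assms
  by (simp add: UNIV_bool add.commute)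

lemma smooth_fun_on_inverse:
  fixes f :: "'a \<Rightarrow> real"
  assumes "openin (mtop M) W" "smooth_fun_on M W f" "\<And>q. q \<in> W \<Longrightarrow> f q \<noteq> 0"
  shows "smooth_fun_on M W (\<lambda>q. inverse (f q))"
  unfolding smooth_fun_on_def o_def
  by (intro ballI smooth_on_inverse chart_image_open assms(1))
    (use assms chart_inv_chart in \<open>auto simp: smooth_fun_on_def o_def\<close>)

lemma smooth_fun_on_chart: "c \<in> atlas M \<Longrightarrow> smooth_fun_on M (fst c) (snd c)"
  unfolding smooth_fun_on_def by (simp add: transition)

lemma smooth_fun_on_has_derivative:
  "smooth_fun_on M W f \<Longrightarrow> c \<in> atlas M \<Longrightarrow> p \<in> W \<Longrightarrow> p \<in> fst c \<Longrightarrow>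
    (f \<circ> chart_inv c has_derivative frechet_derivative (f \<circ> chart_inv c) (at (snd c p))) (at (snd c p))"
  by (rule smooth_on_has_derivative[of "snd c ` (fst c \<inter> W)"]) (auto simp: smooth_fun_on_def)

lemma chart_change_has_derivative:
  assumes c: "c \<in> atlas M" and d: "d \<in> atlas M" and p: "p \<in> fst c" "p \<in> fst d"
    and f: "(f \<circ> chart_inv c has_derivative f') (at (snd c p))"
  shows "(f \<circ> chart_inv d has_derivative
    (\<lambda>u. f' (frechet_derivative (snd c \<circ> chart_inv d) (at (snd d p)) u))) (at (snd d p))"
proof -
  have o: "open (snd d ` (fst d \<inter> fst c))" by (rule chart_image_open[OF d chart_open[OF c]])
  have x: "snd d p \<in> snd d ` (fst d \<inter> fst c)" using p by auto
  have "(f \<circ> chart_inv c has_derivative f') (at ((snd c \<circ> chart_inv d) (snd d p)))"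
    using f chart_inv_chart[OF d p(2)] by simp
  from has_derivative_compose[OF smooth_on_has_derivative[OF transition[OF d c] x] this]
  show ?thesis
    by (rule has_derivative_transform_within_open[OF _ o x])
      (use chart_inv_chart[OF d] chart_inv_chart[OF c] in auto)
qed

text \<open>Frees \<open>dir_deriv\<close> from the preferred chart: since preferred charts at
  different points are unrelated, statements about the dependence on the point have to be made in
  one chart \<open>c\<close>.\<close>

lemma dir_deriv_chart:
  assumes f: "smooth_fun_on M W f" and c: "c \<in> atlas M" and p: "p \<in> W" "p \<in> fst c"
  shows "dir_deriv M f p v = frechet_derivative (f \<circ> chart_inv c) (at (snd c p)) (components M c p v)"
proof -
  have t: "p \<in> topspace (mtop M)" using chart_subset[OF c] p by auto
  show ?thesis
    using frechet_derivative_at[OF chart_change_has_derivative[OF c chart_at(1)[OF t] p(2) chart_at(2)[OF t]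
        smooth_fun_on_has_derivative[OF f c p]]]
    unfolding dir_deriv_def components_def by metis
qed

lemma dir_deriv_has_derivative:
  assumes "smooth_fun_on M W f" "p \<in> W" "p \<in> topspace (mtop M)"
  shows "(f \<circ> chart_inv (chart_at M p) has_derivative dir_deriv M f p) (at (snd (chart_at M p) p))"
  using smooth_fun_on_has_derivative[OF assms(1) chart_at(1) assms(2) chart_at(2)] assms(3)
  unfolding dir_deriv_def[abs_def] by simp

lemma dir_derivI:
  assumes "(f \<circ> chart_inv (chart_at M p) has_derivative f') (at (snd (chart_at M p) p))"
  shows "dir_deriv M f p v = f' v"
  using frechet_derivative_at[OF assms] unfolding dir_deriv_def by simp

lemma linear_dir_deriv:
  "smooth_fun_on M W f \<Longrightarrow> p \<in> W \<Longrightarrow> p \<in> topspace (mtop M) \<Longrightarrow> linear (dir_deriv M f p)"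
  using dir_deriv_has_derivative has_derivative_linear by blast

lemma dir_deriv_const: "dir_deriv M (\<lambda>q. k) p v = 0"
  by (simp add: dir_deriv_def o_def)

lemma dir_deriv_cong:
  assumes W: "openin (mtop M) W" "p \<in> W" and fg: "\<And>q. q \<in> W \<Longrightarrow> f q = g q" and f: "smooth_fun_on M W f"
  shows "dir_deriv M g p v = dir_deriv M f p v"
proof (rule dir_derivI)
  let ?c = "chart_at M p"
  have p: "p \<in> topspace (mtop M)" using openin_subset W by blast
  show "(g \<circ> chart_inv ?c has_derivative dir_deriv M f p) (at (snd ?c p))"
    by (rule has_derivative_transform_within_open[OF dir_deriv_has_derivative[OF f W(2) p]
          chart_image_open[OF chart_at(1)[OF p] W(1)]])
      (use fg W chart_at[OF p] chart_inv_chart[OF chart_at(1)[OF p]] in auto)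
qed

lemma dir_deriv_sum:
  assumes "\<And>i. i \<in> I \<Longrightarrow> smooth_fun_on M W (f i)" "p \<in> W" "p \<in> topspace (mtop M)"
  shows "dir_deriv M (\<lambda>q. \<Sum>i\<in>I. f i q) p v = (\<Sum>i\<in>I. dir_deriv M (f i) p v)"
proof (rule dir_derivI)
  show "((\<lambda>q. \<Sum>i\<in>I. f i q) \<circ> chart_inv (chart_at M p) has_derivative
      (\<lambda>v. \<Sum>i\<in>I. dir_deriv M (f i) p v)) (at (snd (chart_at M p) p))"
    using has_derivative_sum[of I "\<lambda>i. f i \<circ> chart_inv (chart_at M p)"]
      dir_deriv_has_derivative[OF assms(1) assms(2,3)] by (simp add: o_def)
qed

lemma dir_deriv_scaleR:
  assumes "smooth_fun_on M W f" "smooth_fun_on M W g" "p \<in> W" "p \<in> topspace (mtop M)"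
  shows "dir_deriv M (\<lambda>q. f q *\<^sub>R g q) p v = f p *\<^sub>R dir_deriv M g p v + dir_deriv M f p v *\<^sub>R g p"
proof (rule dir_derivI)
  show "((\<lambda>q. f q *\<^sub>R g q) \<circ> chart_inv (chart_at M p) has_derivative
      (\<lambda>v. f p *\<^sub>R dir_deriv M g p v + dir_deriv M f p v *\<^sub>R g p)) (at (snd (chart_at M p) p))"
    using has_derivative_scaleR[OF dir_deriv_has_derivative[OF assms(1,3,4)] dir_deriv_has_derivative[OF assms(2,3,4)]]
    by (simp add: o_def chart_inv_chart chart_at assms(4))
qed

lemma dir_deriv_bounded_linear:
  assumes "bounded_linear h" "smooth_fun_on M W f" "p \<in> W" "p \<in> topspace (mtop M)"
  shows "dir_deriv M (\<lambda>q. h (f q)) p v = h (dir_deriv M f p v)"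
proof (rule dir_derivI)
  show "((\<lambda>q. h (f q)) \<circ> chart_inv (chart_at M p) has_derivative (\<lambda>v. h (dir_deriv M f p v)))
      (at (snd (chart_at M p) p))"
    using bounded_linear.has_derivative[OF assms(1) dir_deriv_has_derivative[OF assms(2-)]] by (simp add: o_def)
qed

text \<open>Going from \<open>c\<close> to \<open>d\<close> and back is the identity near the point,
  so the chain rule and uniqueness of derivatives make the two Jacobians inverse to each
  other.\<close>

lemma transition_derivative_inverse:
  assumes c: "c \<in> atlas M" and d: "d \<in> atlas M" and p: "p \<in> fst c" "p \<in> fst d"
  shows "frechet_derivative (snd c \<circ> chart_inv d) (at (snd d p))
    (frechet_derivative (snd d \<circ> chart_inv c) (at (snd c p)) u) = u"
proof -
  have "(snd c \<circ> chart_inv d has_derivative frechet_derivative (snd c \<circ> chart_inv d) (at (snd d p))) (at (snd d p))"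
    by (rule smooth_on_has_derivative[OF transition[OF d c]]) (use p in auto)
  from chart_change_has_derivative[OF d c p(2,1) this]
  have "(snd c \<circ> chart_inv c has_derivative (\<lambda>u. frechet_derivative (snd c \<circ> chart_inv d) (at (snd d p))
    (frechet_derivative (snd d \<circ> chart_inv c) (at (snd c p)) u))) (at (snd c p))" .
  moreover have "(snd c \<circ> chart_inv c has_derivative (\<lambda>u. u)) (at (snd c p))"
    by (rule has_derivative_transform_within_open[OF has_derivative_ident chart_range_open[OF c]])
      (use p chart_inv_chart[OF c] in auto)
  ultimately show ?thesis by (metis has_derivative_unique)
qed

lemma components_coord_field:
  assumes c: "c \<in> atlas M" and p: "p \<in> fst c"
  shows "components M c p (coord_field M c u p) = u"
  using transition_derivative_inverse[OF c chart_at(1) p chart_at(2)] chart_subset[OF c] p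
  unfolding components_def coord_field_def dir_deriv_def by blast

lemma coord_field_components:
  assumes c: "c \<in> atlas M" and p: "p \<in> fst c"
  shows "coord_field M c (components M c p v) p = v"
  using transition_derivative_inverse[OF chart_at(1) c chart_at(2) p] chart_subset[OF c] p
  unfolding components_def coord_field_def dir_deriv_def by blast

lemma linear_components: "c \<in> atlas M \<Longrightarrow> p \<in> fst c \<Longrightarrow> linear (components M c p)"
  unfolding components_def[abs_def]
  using linear_dir_deriv[OF smooth_fun_on_chart] chart_subset by blast

lemma linear_coord_field:
  assumes "c \<in> atlas M" "p \<in> fst c" shows "linear (\<lambda>u. coord_field M c u p)"
proof -
  have p: "p \<in> topspace (mtop M)" using assms chart_subset by blast
  show ?thesis
    unfolding coord_field_def
    using has_derivative_linear[OF smooth_fun_on_has_derivative[OF smooth_fun_on_chart[OF chart_at(1)[OF p]] assms(1) chart_at(2)[OF p] assms(2)]] .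
qed

lemma components_chart_at:
  assumes "p \<in> topspace (mtop M)" shows "components M (chart_at M p) p v = v"
proof -
  let ?c = "chart_at M p"
  have "(snd ?c \<circ> chart_inv ?c has_derivative (\<lambda>u. u)) (at (snd ?c p))"
    by (rule has_derivative_transform_within_open[OF has_derivative_ident chart_range_open[OF chart_at(1)[OF assms]]])
      (use chart_at[OF assms] chart_inv_chart[OF chart_at(1)[OF assms]] in auto)
  then show ?thesis using dir_derivI unfolding components_def by blast
qed

lemma coord_field_chart_at:
  assumes "p \<in> topspace (mtop M)" shows "coord_field M (chart_at M p) u p = u"
  by (metis assms chart_at components_chart_at components_coord_field)

lemma smooth_fun_on_frechet:
  assumes W: "openin (mtop M) W" and f: "smooth_fun_on M W f" and c: "c \<in> atlas M"
  shows "smooth_fun_on M (fst c \<inter> W) (\<lambda>q. frechet_derivative (f \<circ> chart_inv c) (at (snd c q)) u)"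
proof (rule smooth_fun_onI)
  fix p assume p: "p \<in> fst c \<inter> W"
  have 1: "smooth_on (snd c ` (fst c \<inter> W)) (\<lambda>x. frechet_derivative (f \<circ> chart_inv c) (at x) u)"
    using f c by (intro smooth_on_frechet) (auto simp: smooth_fun_on_def)
  have "smooth_on (snd c ` (fst c \<inter> W))
      ((\<lambda>q. frechet_derivative (f \<circ> chart_inv c) (at (snd c q)) u) \<circ> chart_inv c)"
    by (rule smooth_on_cong[OF chart_image_open[OF c W] _ 1]) (use chart_inv_chart[OF c] in auto)
  then show "\<exists>c'\<in>atlas M. \<exists>V. openin (mtop M) V \<and> p \<in> V \<and> V \<subseteq> fst c' \<and>
      smooth_on (snd c' ` V) ((\<lambda>q. frechet_derivative (f \<circ> chart_inv c) (at (snd c q)) u) \<circ> chart_inv c')"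
    using c p W chart_open[OF c] by (intro bexI[of _ c] exI[of _ "fst c \<inter> W"]) auto
qed

text \<open>In a fixed chart the derivative along \<open>X\<close> is the sum of the components of
  \<open>X\<close> times partial derivatives, all of them smooth.\<close>

lemma smooth_fun_on_dir_deriv:
  assumes W: "openin (mtop M) W" and f: "smooth_fun_on M W f" and X: "vector_field_on M W X"
  shows "smooth_fun_on M W (\<lambda>q. dir_deriv M f q (X q))"
  unfolding smooth_fun_on_def
proof
  fix c assume c: "c \<in> atlas M"
  let ?S = "snd c ` (fst c \<inter> W)"
  have S: "open ?S" by (rule chart_image_open[OF c W])
  have fc: "smooth_on ?S (f \<circ> chart_inv c)" using f c by (auto simp: smooth_fun_on_def)
  have "smooth_on ?S ((\<lambda>q. components M c q (X q)) \<circ> chart_inv c)"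
    using X c by (auto simp: vector_field_on_def)
  then have 1: "smooth_on ?S (\<lambda>x. \<Sum>b\<in>Basis. (((\<lambda>q. components M c q (X q)) \<circ> chart_inv c) x \<bullet> b) *\<^sub>R
      frechet_derivative (f \<circ> chart_inv c) (at x) b)"
    by (intro smooth_on_sum[OF S] smooth_on_scaleR[OF S]
        smooth_on_bounded_linear_compose[OF S bounded_linear_inner_left] smooth_on_frechet[OF fc])
  show "smooth_on ?S ((\<lambda>q. dir_deriv M f q (X q)) \<circ> chart_inv c)"
  proof (rule smooth_on_cong[OF S _ 1])
    fix x assume "x \<in> ?S"
    then obtain q where q: "q \<in> fst c" "q \<in> W" "x = snd c q" by auto
    have "linear (frechet_derivative (f \<circ> chart_inv c) (at (snd c q)))"
      using smooth_fun_on_has_derivative[OF f c q(2,1)] has_derivative_linear by blast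
    from linear_basis_expand[OF this, of "components M c q (X q)"]
    show "(\<Sum>b\<in>Basis. (((\<lambda>q. components M c q (X q)) \<circ> chart_inv c) x \<bullet> b) *\<^sub>R
      frechet_derivative (f \<circ> chart_inv c) (at x) b) = ((\<lambda>q. dir_deriv M f q (X q)) \<circ> chart_inv c) x"
      using q chart_inv_chart[OF c q(1)] dir_deriv_chart[OF f c q(2,1)] by simp
  qed
qed

lemma smooth_fun_on_components:
  assumes "openin (mtop M) W" "vector_field_on M W X" "c \<in> atlas M"
  shows "smooth_fun_on M (fst c \<inter> W) (\<lambda>q. components M c q (X q))"
  unfolding components_def
  by (rule smooth_fun_on_dir_deriv)
    (use assms chart_open[OF assms(3)] vector_field_on_subset[OF assms(2)] smooth_fun_on_subset[OF smooth_fun_on_chart[OF assms(3)]] in auto)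

lemma vector_field_onI:
  assumes "\<And>c. c \<in> atlas M \<Longrightarrow> smooth_fun_on M (fst c \<inter> W) (\<lambda>q. components M c q (X q))"
  shows "vector_field_on M W X"
  unfolding vector_field_on_def
proof
  fix c assume c: "c \<in> atlas M"
  have "fst c \<inter> (fst c \<inter> W) = fst c \<inter> W" by auto
  then show "smooth_on (snd c ` (fst c \<inter> W)) ((\<lambda>q. components M c q (X q)) \<circ> chart_inv c)"
    using assms[OF c] c unfolding smooth_fun_on_def by metis
qed

lemma components_coord_field_transition:
  assumes c: "c \<in> atlas M" and d: "d \<in> atlas M" and q: "q \<in> fst c" "q \<in> fst d"
  shows "components M d q (coord_field M c u q) = frechet_derivative (snd d \<circ> chart_inv c) (at (snd c q)) u"
  using dir_deriv_chart[OF smooth_fun_on_chart[OF d] c q(2,1)] components_coord_field[OF c q(1)]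
  unfolding components_def[of M d] by simp

lemma vector_field_coord_field:
  assumes c: "c \<in> atlas M"
  shows "vector_field_on M (fst c) (coord_field M c u)"
proof (rule vector_field_onI)
  fix d assume d: "d \<in> atlas M"
  have o: "openin (mtop M) (fst d \<inter> fst c)" using chart_open c d by blast
  have "smooth_fun_on M (fst d \<inter> fst c) (\<lambda>q. frechet_derivative (snd d \<circ> chart_inv c) (at (snd c q)) u)"
    using smooth_fun_on_frechet[OF chart_open[OF d] smooth_fun_on_chart[OF d] c] by (simp add: Int_commute)
  then show "smooth_fun_on M (fst d \<inter> fst c) (\<lambda>q. components M d q (coord_field M c u q))"
    by (rule smooth_fun_on_cong[OF o, rotated]) (simp add: components_coord_field_transition[OF c d])
qed

end

section \<open>Inclusions between manifolds and their tangent maps\<close>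

lemma openin_incl:
  assumes "continuous_map (mtop N) (mtop M) (\<lambda>q. q)" "openin (mtop M) W"
  shows "openin (mtop N) (W \<inter> topspace (mtop N))"
proof -
  have "{q \<in> topspace (mtop N). q \<in> W} = W \<inter> topspace (mtop N)" by auto
  then show ?thesis using openin_continuous_map_preimage[OF assms] by simp
qed

lemma smooth_map_id_iff:
  assumes "smooth_manifold N"
  shows "smooth_map N M (\<lambda>q. q) \<longleftrightarrow> continuous_map (mtop N) (mtop M) (\<lambda>q. q) \<and>
     (\<forall>d\<in>atlas M. smooth_fun_on N (fst d \<inter> topspace (mtop N)) (snd d))"
proof -
  interpret smooth_mfd N using assms by unfold_locales
  have "fst c \<inter> (fst d \<inter> topspace (mtop N)) = fst c \<inter> (\<lambda>q. q) -` fst d" if "c \<in> atlas N" for c d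
    using chart_subset[OF that] by auto
  moreover have "snd d \<circ> (\<lambda>q. q) \<circ> chart_inv c = snd d \<circ> chart_inv c" for d :: "('a, 'b) chart" and c
    by (simp add: o_def)
  ultimately show ?thesis unfolding smooth_map_def smooth_fun_on_def by (metis (no_types, lifting))
qed

text \<open>Injectivity of the tangent maps is kept apart from smoothness of the inclusion: for the
  union of a chain it can only be derived once the inclusions into and out of the union are known to
  be smooth.\<close>

locale incl_mfd = N: smooth_mfd N + M: smooth_mfd M
  for N :: "('a, 'f::euclidean_space) manifold" and M :: "('a, 'e::euclidean_space) manifold" +
  assumes smooth_incl: "smooth_map N M (\<lambda>q. q)"
begin

lemma cont_incl: "continuous_map (mtop N) (mtop M) (\<lambda>q. q)"
  using smooth_incl smooth_map_def by blast

lemma topspace_incl: "topspace (mtop N) \<subseteq> topspace (mtop M)"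
  using cont_incl by (auto simp: continuous_map_def)

lemma smooth_fun_on_chart_incl: "d \<in> atlas M \<Longrightarrow> smooth_fun_on N (fst d \<inter> topspace (mtop N)) (snd d)"
  using smooth_incl smooth_map_id_iff[OF N.mfd] by blast

lemma smooth_fun_on_incl:
  assumes W: "openin (mtop M) W" and f: "smooth_fun_on M W f"
  shows "smooth_fun_on N (W \<inter> topspace (mtop N)) f"
proof (rule N.smooth_fun_onI)
  fix p assume p: "p \<in> W \<inter> topspace (mtop N)"
  then have pM: "p \<in> topspace (mtop M)" using topspace_incl by blast
  define c where "c = chart_at N p"
  define d where "d = chart_at M p"
  define V where "V = fst c \<inter> ((fst d \<inter> W) \<inter> topspace (mtop N))"
  have c: "c \<in> atlas N" "p \<in> fst c" and d: "d \<in> atlas M" "p \<in> fst d"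
    using N.chart_at M.chart_at p pM by (auto simp: c_def d_def)
  have V: "openin (mtop N) V"
    unfolding V_def by (intro openin_Int N.chart_open c openin_incl[OF cont_incl] M.chart_open d W)
  have oV: "open (snd c ` V)" using N.chart_image_open[OF c(1) V] by (simp add: V_def Int_assoc)
  have "smooth_on (snd c ` V) (snd d \<circ> chart_inv c)"
    by (rule smooth_on_subset[of "snd c ` (fst c \<inter> (fst d \<inter> topspace (mtop N)))"])
      (use smooth_fun_on_chart_incl[OF d(1)] c in \<open>auto simp: V_def smooth_fun_on_def\<close>)
  moreover have "smooth_on (snd d ` (fst d \<inter> W)) (f \<circ> chart_inv d)"
    using f d by (auto simp: smooth_fun_on_def)
  moreover have "(snd d \<circ> chart_inv c) ` (snd c ` V) \<subseteq> snd d ` (fst d \<inter> W)"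
    using N.chart_inv_chart[OF c(1)] by (auto simp: V_def)
  ultimately have "smooth_on (snd c ` V) (\<lambda>x. (f \<circ> chart_inv d) ((snd d \<circ> chart_inv c) x))"
    using smooth_on_compose[OF oV M.chart_image_open[OF d(1) W]] by blast
  then have "smooth_on (snd c ` V) (f \<circ> chart_inv c)"
    by (rule smooth_on_cong[OF oV, rotated])
      (use N.chart_inv_chart[OF c(1)] M.chart_inv_chart[OF d(1)] in \<open>auto simp: V_def\<close>)
  then show "\<exists>c\<in>atlas N. \<exists>V. openin (mtop N) V \<and> p \<in> V \<and> V \<subseteq> fst c \<and> smooth_on (snd c ` V) (f \<circ> chart_inv c)"
    using c d V p by (intro bexI[of _ c] exI[of _ V]) (auto simp: V_def)
qed

lemma incl_eq: "incl N M p v = dir_deriv N (snd (chart_at M p)) p v"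
  by (simp add: tangent_map_def o_def)

lemma linear_incl:
  assumes "p \<in> topspace (mtop N)" shows "linear (incl N M p)"
proof -
  have pM: "p \<in> topspace (mtop M)" using topspace_incl assms by blast
  show ?thesis
    unfolding incl_eq[abs_def]
    by (rule N.linear_dir_deriv[OF smooth_fun_on_chart_incl[OF M.chart_at(1)[OF pM]]])
      (use assms M.chart_at[OF pM] in auto)
qed

text \<open>The chain rule through the preferred charts of \<open>N\<close> and \<open>M\<close> at
  \<open>p\<close>; \<open>incl N M p\<close> is by definition the derivative of the inclusion in
  these two charts.\<close>

lemma dir_deriv_incl:
  assumes W: "openin (mtop M) W" and f: "smooth_fun_on M W f" and p: "p \<in> W" "p \<in> topspace (mtop N)"
  shows "dir_deriv N f p v = dir_deriv M f p (incl N M p v)"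
proof (rule N.dir_derivI)
  have pM: "p \<in> topspace (mtop M)" using topspace_incl p by blast
  define c where "c = chart_at N p"
  define d where "d = chart_at M p"
  have c: "c \<in> atlas N" "p \<in> fst c" and d: "d \<in> atlas M" "p \<in> fst d"
    using N.chart_at M.chart_at p pM by (auto simp: c_def d_def)
  let ?V = "fst d \<inter> topspace (mtop N)"
  have 1: "(snd d \<circ> chart_inv c has_derivative incl N M p) (at (snd c p))"
    using N.dir_deriv_has_derivative[OF smooth_fun_on_chart_incl[OF d(1)], of p] p d
    unfolding incl_eq[abs_def] c_def d_def by simp
  have 2: "(f \<circ> chart_inv d has_derivative dir_deriv M f p) (at ((snd d \<circ> chart_inv c) (snd c p)))"
    using M.dir_deriv_has_derivative[OF f p(1) pM] N.chart_inv_chart[OF c] by (simp add: d_def)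
  have o: "open (snd c ` (fst c \<inter> ?V))"
    by (rule N.chart_image_open[OF c(1) openin_incl[OF cont_incl M.chart_open[OF d(1)]]])
  show "(f \<circ> chart_inv (chart_at N p) has_derivative (\<lambda>v. dir_deriv M f p (incl N M p v))) (at (snd (chart_at N p) p))"
    unfolding c_def[symmetric]
    by (rule has_derivative_transform_within_open[OF has_derivative_compose[OF 1 2] o])
      (use c d p N.chart_inv_chart[OF c(1)] M.chart_inv_chart[OF d(1)] in auto)
qed

lemma components_incl:
  assumes "c \<in> atlas M" "p \<in> fst c" "p \<in> topspace (mtop N)"
  shows "components M c p (incl N M p v) = dir_deriv N (snd c) p v"
  unfolding components_def
  using dir_deriv_incl[OF M.chart_open M.smooth_fun_on_chart] assms by auto

end

lemma incl_mfd_compose: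
  assumes "incl_mfd L H" "incl_mfd H M"
  shows "incl_mfd L M"
proof -
  interpret LH: incl_mfd L H by fact
  interpret HM: incl_mfd H M by fact
  have c: "continuous_map (mtop L) (mtop M) (\<lambda>q. q)"
    using continuous_map_compose[OF LH.cont_incl HM.cont_incl] by (simp add: o_def)
  have "smooth_fun_on L (fst d \<inter> topspace (mtop L)) (snd d)" if d: "d \<in> atlas M" for d
    by (rule smooth_fun_on_subset[OF LH.smooth_fun_on_incl[OF
          openin_incl[OF HM.cont_incl HM.M.chart_open[OF d]] HM.smooth_fun_on_chart_incl[OF d]]])
      (use LH.topspace_incl in auto)
  with c have "smooth_map L M (\<lambda>q. q)" using smooth_map_id_iff[OF LH.N.mfd] by blast
  then show ?thesis
    by unfold_locales
qed

text \<open>The preferred chart map of \<open>M\<close> at \<open>p\<close>, restricted to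
  \<open>H\<close>, is a smooth function there, and differentiating it along \<open>L\<close> is an
  instance of the chain rule for \<open>L\<close> in \<open>H\<close>.\<close>

lemma incl_compose:
  assumes "incl_mfd L H" "incl_mfd H M" "p \<in> topspace (mtop L)"
  shows "incl L M p x = incl H M p (incl L H p x)"
proof -
  interpret LH: incl_mfd L H by fact
  interpret HM: incl_mfd H M by fact
  interpret LM: incl_mfd L M by (rule incl_mfd_compose[OF assms(1,2)])
  have p: "p \<in> topspace (mtop H)" "p \<in> topspace (mtop M)" using LH.topspace_incl LM.topspace_incl assms(3) by auto
  note d = HM.M.chart_at[OF p(2)]
  show ?thesis
    unfolding LM.incl_eq HM.incl_eq
    by (rule LH.dir_deriv_incl[OF openin_incl[OF HM.cont_incl HM.M.chart_open[OF d(1)]]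
          HM.smooth_fun_on_chart_incl[OF d(1)]]) (use p d assms(3) in auto)
qed

lemma submanifold_iff:
  "submanifold N M \<and> smooth_manifold M \<longleftrightarrow> incl_mfd N M \<and> (\<forall>p\<in>topspace (mtop N). inj (incl N M p))"
  unfolding submanifold_def incl_mfd_def incl_mfd_axioms_def smooth_mfd_def
  using smooth_map_def continuous_map_def by fastforce

section \<open>Existence of leaves\<close>

lemma submanifold_refl:
  assumes "smooth_manifold N" shows "submanifold N N"
proof -
  interpret smooth_mfd N by unfold_locales (fact assms)
  have "continuous_map (mtop N) (mtop N) (\<lambda>q. q)" by simp
  moreover have "smooth_fun_on N (fst d \<inter> topspace (mtop N)) (snd d)" if "d \<in> atlas N" for d
    using smooth_fun_on_subset[OF smooth_fun_on_chart[OF that]] by auto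
  ultimately have s: "smooth_map N N (\<lambda>q. q)" using smooth_map_id_iff[OF mfd] by blast
  then interpret incl_mfd N N by unfold_locales
  have "incl N N p v = v" if "p \<in> topspace (mtop N)" for p v
    using components_chart_at[OF that] by (simp add: incl_eq components_def)
  then show ?thesis using s mfd by (auto simp: submanifold_def inj_def)
qed

lemma submanifold_incl_mfd: "submanifold N M \<Longrightarrow> smooth_manifold M \<Longrightarrow> incl_mfd N M"
  using submanifold_iff by blast

lemma submanifold_trans:
  assumes "submanifold L N" "submanifold N M" "smooth_manifold M"
  shows "submanifold L M"
proof -
  have N: "smooth_manifold N" using assms by (simp add: submanifold_def)
  have LN: "incl_mfd L N" and NM: "incl_mfd N M"
    using assms N by (auto intro: submanifold_incl_mfd)
  have "inj (incl L M p)" if p: "p \<in> topspace (mtop L)" for p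
  proof -
    have pN: "p \<in> topspace (mtop N)" using p incl_mfd.topspace_incl[OF LN] by blast
    have "incl L M p = incl N M p \<circ> incl L N p"
      using incl_compose[OF LN NM p] by auto
    then show ?thesis using p pN assms(1,2) by (auto simp: submanifold_def intro: inj_compose)
  qed
  then show ?thesis using incl_mfd_compose[OF LN NM] submanifold_iff by blast
qed

text \<open>Both manifolds are modelled on the same space \<open>'f\<close>, so in charts the
  inclusion is a continuous injection between open sets of equal dimension, and invariance of domain
  makes its image open.\<close>

lemma openin_submanifold_same_dim:
  fixes L L' :: "('a, 'f::euclidean_space) manifold"
  assumes "incl_mfd L L'" and V: "openin (mtop L) V"
  shows "openin (mtop L') V"
proof (subst openin_subopen, intro ballI)
  interpret incl_mfd L L' by fact
  fix p assume p: "p \<in> V"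
  then have pL: "p \<in> topspace (mtop L)" using V openin_subset by blast
  then have pL': "p \<in> topspace (mtop L')" using topspace_incl by blast
  define c where "c = chart_at L p"
  define d where "d = chart_at L' p"
  have c: "c \<in> atlas L" "p \<in> fst c" and d: "d \<in> atlas L'" "p \<in> fst d"
    using N.chart_at M.chart_at pL pL' by (auto simp: c_def d_def)
  let ?V = "V \<inter> (fst d \<inter> topspace (mtop L))"
  have oV: "openin (mtop L) ?V" using V openin_incl[OF cont_incl M.chart_open[OF d(1)]] by blast
  define A where "A = snd c ` (fst c \<inter> ?V)"
  have A: "open A" unfolding A_def by (rule N.chart_image_open[OF c(1) oV])
  have "smooth_on (snd c ` (fst c \<inter> (fst d \<inter> topspace (mtop L)))) (snd d \<circ> chart_inv c)"
    using smooth_fun_on_chart_incl[OF d(1)] c by (auto simp: smooth_fun_on_def)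
  then have "smooth_on A (snd d \<circ> chart_inv c)"
    by (rule smooth_on_subset) (auto simp: A_def)
  then have "continuous_on A (snd d \<circ> chart_inv c)" by (rule smooth_on_continuous_on)
  moreover have "inj_on (snd d \<circ> chart_inv c) A"
    unfolding A_def inj_on_def
    using N.chart_inv_chart[OF c(1)] M.chart_inv_chart[OF d(1)] by auto (metis IntI)
  ultimately have o: "open ((snd d \<circ> chart_inv c) ` A)" using invariance_of_domain A by blast
  have im: "(snd d \<circ> chart_inv c) ` A = snd d ` (fst c \<inter> ?V)"
    unfolding A_def image_comp using N.chart_inv_chart[OF c(1)] by (intro image_cong) auto
  have "openin (mtop L') {q \<in> fst d. snd d q \<in> snd d ` (fst c \<inter> ?V)}"
    using M.chart_preimage_open[OF d(1) o] im by simp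
  moreover have "{q \<in> fst d. snd d q \<in> snd d ` (fst c \<inter> ?V)} = fst c \<inter> ?V"
    using inj_on_image_mem_iff[OF M.chart_inj[OF d(1)], of _ "fst c \<inter> ?V"] by blast
  ultimately show "\<exists>T. openin (mtop L') T \<and> p \<in> T \<and> T \<subseteq> V"
    using c d p pL by (intro exI[of _ "fst c \<inter> ?V"]) auto
qed

text \<open>Smoothness of the inclusion gives the transition from charts of \<open>L\<close> to
  charts of \<open>L'\<close>; the opposite one needs an inverse function. Its hypothesis holds
  because the Jacobian is the tangent map of the inclusion written in coordinates, hence
  injective.\<close>

lemma reverse_transition:
  fixes L L' :: "('a, 'f::euclidean_space) manifold"
  assumes "incl_mfd L L'" and inj: "\<And>p. p \<in> topspace (mtop L) \<Longrightarrow> inj (incl L L' p)"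
    and c: "c \<in> atlas L" and d: "d \<in> atlas L'"
  shows "smooth_on (snd d ` (fst d \<inter> fst c)) (snd c \<circ> chart_inv d)"
proof -
  interpret incl_mfd L L' by fact
  have cL: "fst c \<subseteq> topspace (mtop L)" by (rule N.chart_subset[OF c])
  then have eq: "fst c \<inter> (fst d \<inter> topspace (mtop L)) = fst c \<inter> fst d" by auto
  show ?thesis
  proof (rule smooth_on_inverse_function)
    show "open (snd c ` (fst c \<inter> fst d))"
      using N.chart_image_open[OF c openin_incl[OF cont_incl M.chart_open[OF d]]] eq by simp
    show "open (snd d ` (fst d \<inter> fst c))"
      by (rule M.chart_image_open[OF d openin_submanifold_same_dim[OF assms(1) N.chart_open[OF c]]])
    show f: "smooth_on (snd c ` (fst c \<inter> fst d)) (snd d \<circ> chart_inv c)"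
      using smooth_fun_on_chart_incl[OF d] c eq unfolding smooth_fun_on_def by metis
    fix x assume "x \<in> snd c ` (fst c \<inter> fst d)"
    then obtain p where p: "p \<in> fst c" "p \<in> fst d" "x = snd c p" by auto
    have pL: "p \<in> topspace (mtop L)" using cL p by blast
    have "frechet_derivative (snd d \<circ> chart_inv c) (at x) u = components L' d p (incl L L' p (coord_field L c u p))" for u
      using N.dir_deriv_chart[OF smooth_fun_on_chart_incl[OF d] c _ p(1)] p pL
        components_incl[OF d p(2) pL] N.components_coord_field[OF c p(1)] by simp
    then show "inj (frechet_derivative (snd d \<circ> chart_inv c) (at x))"
      unfolding inj_def
      by (metis M.coord_field_components[OF d p(2)] N.components_coord_field[OF c p(1)] inj[OF pL] injD)
  qed (use N.chart_inv_chart[OF c] M.chart_inv_chart[OF d] in auto)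
qed

section \<open>Unions of chains of integral manifolds\<close>

lemma connected_union_space:
  assumes "topspace X = (\<Union>i\<in>I. A i)" "\<And>i. i \<in> I \<Longrightarrow> connectedin X (A i)" "\<And>i. i \<in> I \<Longrightarrow> p \<in> A i" "I \<noteq> {}"
  shows "connected_space X"
proof -
  have "connectedin X (\<Union>(A ` I))"
  proof (rule connectedin_Union)
    show "\<Inter> (A ` I) \<noteq> {}" using assms(3) by blast
  qed (use assms(2) in auto)
  then show ?thesis using assms(1) connectedin_topspace by metis
qed

text \<open>The direct limit of the chain: the final topology for the inclusions of the members,
  with the charts of all members taken together. No new charts have to be made, since each member
  will be open in the limit.\<close>

definition chain_union :: "('a, 'f::euclidean_space) manifold set \<Rightarrow> ('a, 'f) manifold" where
  "chain_union C = \<lparr>mtop = topology (\<lambda>V. V \<subseteq> (\<Union>L\<in>C. topspace (mtop L)) \<and>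
      (\<forall>L\<in>C. openin (mtop L) (V \<inter> topspace (mtop L)))),
    atlas = (\<Union>L\<in>C. atlas L)\<rparr>"

locale manifold_chain =
  fixes C :: "('a, 'f::euclidean_space) manifold set"
  assumes smooth: "L \<in> C \<Longrightarrow> smooth_manifold L"
    and chain: "L \<in> C \<Longrightarrow> L' \<in> C \<Longrightarrow> submanifold L L' \<or> submanifold L' L"
begin

lemma openin_chain_union: "openin (mtop (chain_union C)) V \<longleftrightarrow>
    V \<subseteq> (\<Union>L\<in>C. topspace (mtop L)) \<and> (\<forall>L\<in>C. openin (mtop L) (V \<inter> topspace (mtop L)))"
proof -
  have "istopology (\<lambda>V. V \<subseteq> (\<Union>L\<in>C. topspace (mtop L)) \<and> (\<forall>L\<in>C. openin (mtop L) (V \<inter> topspace (mtop L))))"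
    unfolding istopology_def
  proof (intro conjI allI impI)
    fix V W
    assume V: "V \<subseteq> (\<Union>L\<in>C. topspace (mtop L)) \<and> (\<forall>L\<in>C. openin (mtop L) (V \<inter> topspace (mtop L)))"
      and W: "W \<subseteq> (\<Union>L\<in>C. topspace (mtop L)) \<and> (\<forall>L\<in>C. openin (mtop L) (W \<inter> topspace (mtop L)))"
    show "V \<inter> W \<subseteq> (\<Union>L\<in>C. topspace (mtop L))" using V by auto
    have "V \<inter> W \<inter> T = (V \<inter> T) \<inter> (W \<inter> T)" for T by auto
    then show "\<forall>L\<in>C. openin (mtop L) (V \<inter> W \<inter> topspace (mtop L))" using V W by (metis openin_Int)
  next
    fix K
    assume K: "\<forall>V\<in>K. V \<subseteq> (\<Union>L\<in>C. topspace (mtop L)) \<and> (\<forall>L\<in>C. openin (mtop L) (V \<inter> topspace (mtop L)))"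
    show "\<Union>K \<subseteq> (\<Union>L\<in>C. topspace (mtop L))" using K by blast
    show "\<forall>L\<in>C. openin (mtop L) (\<Union>K \<inter> topspace (mtop L))"
    proof
      fix L assume L: "L \<in> C"
      have "openin (mtop L) W" if "W \<in> (\<lambda>V. V \<inter> topspace (mtop L)) ` K" for W
        using that K L by blast
      then have "openin (mtop L) (\<Union>((\<lambda>V. V \<inter> topspace (mtop L)) ` K))" by (rule openin_Union)
      then show "openin (mtop L) (\<Union>K \<inter> topspace (mtop L))" unfolding Int_Union2 .
    qed
  qed
  then show ?thesis by (simp add: chain_union_def)
qed

lemma topspace_chain_union: "topspace (mtop (chain_union C)) = (\<Union>L\<in>C. topspace (mtop L))"
proof -
  have "(\<Union>L\<in>C. topspace (mtop L)) \<inter> topspace (mtop L) = topspace (mtop L)" if "L \<in> C" for L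
    using that by auto
  then have "openin (mtop (chain_union C)) (\<Union>L\<in>C. topspace (mtop L))"
    unfolding openin_chain_union by simp
  then show ?thesis
    using openin_chain_union[of "topspace (mtop (chain_union C))"] openin_subset by fastforce
qed

lemma atlas_chain_union: "atlas (chain_union C) = (\<Union>L\<in>C. atlas L)"
  by (simp add: chain_union_def)

text \<open>On a larger member the set remains open by invariance of domain; its trace on a smaller
  member is open by continuity of the inclusion.\<close>

lemma openin_chain_unionI:
  assumes L: "L \<in> C" and V: "openin (mtop L) V"
  shows "openin (mtop (chain_union C)) V"
  unfolding openin_chain_union
proof (intro conjI ballI)
  show "V \<subseteq> (\<Union>L\<in>C. topspace (mtop L))" using L V openin_subset by blast
  fix L' assume L': "L' \<in> C"
  consider "submanifold L L'" | "submanifold L' L" using chain[OF L L'] by blast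
  then show "openin (mtop L') (V \<inter> topspace (mtop L'))"
  proof cases
    case 1
    then show ?thesis
      using openin_submanifold_same_dim[OF submanifold_incl_mfd V] smooth[OF L'] by blast
  next
    case 2
    then show ?thesis
      using openin_incl[OF incl_mfd.cont_incl[OF submanifold_incl_mfd] V] smooth[OF L] by blast
  qed
qed

text \<open>Because members are open, the limit induces on each of them its own topology. This
  transfers the homeomorphism property of charts and the connectedness of members to the
  union.\<close>

lemma subtopology_chain_union:
  assumes "L \<in> C" shows "subtopology (mtop (chain_union C)) (topspace (mtop L)) = mtop L"
  unfolding topology_eq openin_subtopology
proof (intro allI iffI)
  fix V assume "\<exists>T. openin (mtop (chain_union C)) T \<and> V = T \<inter> topspace (mtop L)"
  then show "openin (mtop L) V" unfolding openin_chain_union using assms by blast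
next
  fix V assume V: "openin (mtop L) V"
  show "\<exists>T. openin (mtop (chain_union C)) T \<and> V = T \<inter> topspace (mtop L)"
    using openin_chain_unionI[OF assms V] openin_subset[OF V] by blast
qed

lemma chart_of_chain: "c \<in> atlas (chain_union C) \<Longrightarrow> \<exists>L\<in>C. c \<in> atlas L"
  by (simp add: atlas_chain_union)

lemma transition_chain_union:
  assumes "c \<in> atlas (chain_union C)" "d \<in> atlas (chain_union C)"
  shows "smooth_on (snd c ` (fst c \<inter> fst d)) (snd d \<circ> chart_inv c)"
proof -
  obtain L L' where L: "L \<in> C" "c \<in> atlas L" and L': "L' \<in> C" "d \<in> atlas L'"
    using assms chart_of_chain by blast
  consider "submanifold L L'" | "submanifold L' L" using chain[OF L(1) L'(1)] by blast
  then show ?thesis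
  proof cases
    case 1
    then interpret incl_mfd L L' using submanifold_incl_mfd smooth[OF L'(1)] by blast
    have "fst c \<inter> (fst d \<inter> topspace (mtop L)) = fst c \<inter> fst d" using N.chart_subset[OF L(2)] by auto
    then show ?thesis
      using smooth_fun_on_chart_incl[OF L'(2)] L unfolding smooth_fun_on_def by metis
  next
    case 2
    then show ?thesis
      using reverse_transition[OF submanifold_incl_mfd[OF 2 smooth[OF L(1)]] _ L'(2) L(2)]
      by (simp add: submanifold_def)
  qed
qed

lemma smooth_manifold_chain_union: "smooth_manifold (chain_union C)"
  unfolding smooth_manifold_def
proof (intro conjI ballI)
  show "Hausdorff_space (mtop (chain_union C))"
    unfolding Hausdorff_space_def
  proof (intro allI impI, elim conjE)
    fix x y assume xy: "x \<in> topspace (mtop (chain_union C))" "y \<in> topspace (mtop (chain_union C))" "x \<noteq> y"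
    then obtain L1 L2 where L12: "L1 \<in> C" "x \<in> topspace (mtop L1)" "L2 \<in> C" "y \<in> topspace (mtop L2)"
      unfolding topspace_chain_union by blast
    \<comment> \<open>Of two members of a chain the larger contains both points, and sets separating
      them there stay open in the union.\<close>
    then obtain L where L: "L \<in> C" "x \<in> topspace (mtop L)" "y \<in> topspace (mtop L)"
      using chain[OF L12(1,3)] unfolding submanifold_def by blast
    then have "Hausdorff_space (mtop L)" using smooth smooth_manifold_def by blast
    then obtain V W where "openin (mtop L) V" "openin (mtop L) W" "x \<in> V" "y \<in> W" "disjnt V W"
      using L xy unfolding Hausdorff_space_def by blast
    then show "\<exists>V W. openin (mtop (chain_union C)) V \<and> openin (mtop (chain_union C)) W \<and> x \<in> V \<and> y \<in> W \<and> disjnt V W"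
      using openin_chain_unionI[OF L(1)] by blast
  qed
  show "topspace (mtop (chain_union C)) = (\<Union>c\<in>atlas (chain_union C). fst c)"
    using smooth unfolding topspace_chain_union atlas_chain_union smooth_manifold_def by auto
next
  fix c assume "c \<in> atlas (chain_union C)"
  then obtain L where L: "L \<in> C" "c \<in> atlas L" using chart_of_chain by blast
  interpret smooth_mfd L using smooth[OF L(1)] by unfold_locales
  show "openin (mtop (chain_union C)) (fst c)" using openin_chain_unionI[OF L(1) chart_open[OF L(2)]] .
  show "open (snd c ` fst c)" by (rule chart_range_open[OF L(2)])
  have "subtopology (mtop (chain_union C)) (fst c) = subtopology (mtop L) (fst c)"
    using arg_cong[OF subtopology_chain_union[OF L(1)], of "\<lambda>X. subtopology X (fst c)"] chart_subset[OF L(2)]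
    by (simp add: subtopology_subtopology inf.absorb2)
  then show "homeomorphic_map (subtopology (mtop (chain_union C)) (fst c)) (top_of_set (snd c ` fst c)) (snd c)"
    using chart_homeo[OF L(2)] by simp
qed (rule transition_chain_union)

lemma incl_mfd_chain_union:
  assumes L: "L \<in> C" shows "incl_mfd L (chain_union C)"
proof -
  interpret smooth_mfd L using smooth[OF L] by unfold_locales
  have "continuous_map (mtop L) (mtop (chain_union C)) (\<lambda>q. q)"
    using continuous_map_from_subtopology[OF continuous_map_id, of "mtop (chain_union C)" "topspace (mtop L)"]
    unfolding subtopology_chain_union[OF L] id_def .
  moreover have "smooth_fun_on L (fst d \<inter> topspace (mtop L)) (snd d)" if d: "d \<in> atlas (chain_union C)" for d
    unfolding smooth_fun_on_def
  proof
    fix c assume c: "c \<in> atlas L"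
    show "smooth_on (snd c ` (fst c \<inter> (fst d \<inter> topspace (mtop L)))) (snd d \<circ> chart_inv c)"
      by (rule smooth_on_subset[OF transition_chain_union[OF _ d]])
        (use c L in \<open>auto simp: atlas_chain_union\<close>)
  qed
  ultimately have "smooth_map L (chain_union C) (\<lambda>q. q)" using smooth_map_id_iff[OF mfd] by blast
  then show ?thesis using mfd smooth_manifold_chain_union by (unfold_locales)
qed

end

text \<open>The point \<open>p0\<close> common to all members is what makes their union
  connected.\<close>

locale integral_chain = manifold_chain C + H: smooth_mfd H
  for C :: "('a, 'f::euclidean_space) manifold set" and H :: "('a, 'h::euclidean_space) manifold" +
  fixes S :: "'a \<Rightarrow> 'h set" and p0 :: 'a
  assumes integral: "L \<in> C \<Longrightarrow> integral_manifold H S L"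
    and base_point: "L \<in> C \<Longrightarrow> p0 \<in> topspace (mtop L)" and nonempty: "C \<noteq> {}"
begin

lemma incl_mfd_integral: "L \<in> C \<Longrightarrow> incl_mfd L H"
  using integral[unfolded integral_manifold_def] submanifold_incl_mfd[OF _ H.mfd] by blast

lemma incl_mfd_union: "incl_mfd (chain_union C) H"
proof -
  have "continuous_map (mtop (chain_union C)) (mtop H) (\<lambda>q. q)"
    unfolding continuous_map_def
  proof (intro conjI allI impI)
    show "(\<lambda>q. q) \<in> topspace (mtop (chain_union C)) \<rightarrow> topspace (mtop H)"
      unfolding topspace_chain_union using incl_mfd.topspace_incl[OF incl_mfd_integral] by blast
    fix W assume W: "openin (mtop H) W"
    have "{x \<in> topspace (mtop (chain_union C)). x \<in> W} \<inter> topspace (mtop L) = W \<inter> topspace (mtop L)"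
      if "L \<in> C" for L using that by (auto simp: topspace_chain_union)
    then show "openin (mtop (chain_union C)) {x \<in> topspace (mtop (chain_union C)). x \<in> W}"
      unfolding openin_chain_union
      using openin_incl[OF incl_mfd.cont_incl[OF incl_mfd_integral] W] topspace_chain_union by auto
  qed
  moreover have "smooth_fun_on (chain_union C) (fst d \<inter> topspace (mtop (chain_union C))) (snd d)"
    if d: "d \<in> atlas H" for d
    unfolding smooth_fun_on_def
  proof
    fix c assume "c \<in> atlas (chain_union C)"
    then obtain L where L: "L \<in> C" "c \<in> atlas L" using chart_of_chain by blast
    interpret incl_mfd L H by (rule incl_mfd_integral[OF L(1)])
    have "fst c \<inter> (fst d \<inter> topspace (mtop (chain_union C))) = fst c \<inter> (fst d \<inter> topspace (mtop L))"
      using N.chart_subset[OF L(2)] L(1) by (auto simp: topspace_chain_union)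
    then show "smooth_on (snd c ` (fst c \<inter> (fst d \<inter> topspace (mtop (chain_union C))))) (snd d \<circ> chart_inv c)"
      using smooth_fun_on_chart_incl[OF d] L unfolding smooth_fun_on_def by metis
  qed
  ultimately have "smooth_map (chain_union C) H (\<lambda>q. q)"
    using smooth_map_id_iff[OF smooth_manifold_chain_union] by blast
  then show ?thesis using H.mfd smooth_manifold_chain_union by (unfold_locales)
qed

text \<open>The tangent map of a member into \<open>H\<close> factors through the union. The first
  factor is injective between spaces of equal dimension, hence bijective, so injectivity and range
  pass to the second factor.\<close>

lemma incl_chain_union:
  assumes L: "L \<in> C" and p: "p \<in> topspace (mtop L)"
  shows "inj (incl L (chain_union C) p)" "inj (incl (chain_union C) H p)"
    "range (incl (chain_union C) H p) = S p"
proof -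
  interpret LN: incl_mfd L "chain_union C" by (rule incl_mfd_chain_union[OF L])
  have eq: "incl L H p = incl (chain_union C) H p \<circ> incl L (chain_union C) p"
    using incl_compose[OF incl_mfd_chain_union[OF L] incl_mfd_union p] by auto
  have LH: "inj (incl L H p)" "range (incl L H p) = S p"
    using integral[OF L] p by (auto simp: integral_manifold_def submanifold_def)
  show i: "inj (incl L (chain_union C) p)" using LH(1) unfolding eq by (rule inj_on_imageI2)
  have s: "surj (incl L (chain_union C) p)"
    using linear_injective_imp_surjective[OF LN.linear_incl[OF p] i] by simp
  show "inj (incl (chain_union C) H p)"
    using inj_on_imageI[of "incl (chain_union C) H p" "incl L (chain_union C) p" UNIV] LH(1) s eq by metis
  show "range (incl (chain_union C) H p) = S p"
    using LH(2) s eq by (metis image_comp)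
qed

lemma submanifold_chain_union: "L \<in> C \<Longrightarrow> submanifold L (chain_union C)"
  using incl_mfd_chain_union incl_chain_union(1) submanifold_iff by blast

lemma integral_manifold_chain_union: "integral_manifold H S (chain_union C)"
  unfolding integral_manifold_def
proof (intro conjI)
  show "submanifold (chain_union C) H"
    using incl_mfd_union incl_chain_union(2) topspace_chain_union submanifold_iff by (metis UN_E)
  show "\<forall>p\<in>topspace (mtop (chain_union C)). range (incl (chain_union C) H p) = S p"
    using incl_chain_union(3) topspace_chain_union by auto
  have "connectedin (mtop (chain_union C)) (topspace (mtop L))" if L: "L \<in> C" for L
    using integral[OF L] L subtopology_chain_union[OF L]
    by (auto simp: connectedin_def integral_manifold_def topspace_chain_union)
  then show "connected_space (mtop (chain_union C))"
    by (rule connected_union_space[OF topspace_chain_union _ base_point nonempty])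
qed

lemma base_point_chain_union: "p0 \<in> topspace (mtop (chain_union C))"
  using base_point nonempty topspace_chain_union by auto

end

text \<open>Zorn's lemma is applied only to the integral manifolds through \<open>p\<close>. A
  larger integral manifold still contains \<open>p\<close>, so an element maximal among these is
  maximal among all.\<close>

lemma exists_leaf:
  fixes H :: "('a, 'h::euclidean_space) manifold" and L0 :: "('a, 'f::euclidean_space) manifold"
  assumes H: "smooth_manifold H" and L0: "integral_manifold H S L0" "p \<in> topspace (mtop L0)"
  shows "\<exists>L :: ('a, 'f) manifold. leaf H S L \<and> p \<in> topspace (mtop L)"
proof -
  define A where "A = {L :: ('a, 'f) manifold. integral_manifold H S L \<and> p \<in> topspace (mtop L)}"
  \<comment> \<open>Two manifolds that are submanifolds of each other have the same points but
    possibly different atlases, so \<open>submanifold\<close> is not antisymmetric. Demanding strict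
    growth of the point set repairs this and suits \<open>leaf\<close>, whose maximality compares
    point sets only.\<close>
  define P where "P L L' \<longleftrightarrow> L = L' \<or> submanifold L L' \<and> topspace (mtop L) \<noteq> topspace (mtop L')"
    for L L' :: "('a, 'f) manifold"
  have sm: "smooth_manifold L" if "L \<in> A" for L
    using that by (auto simp: A_def integral_manifold_def submanifold_def)
  have sub: "submanifold L L' \<Longrightarrow> topspace (mtop L) \<subseteq> topspace (mtop L')" for L L' :: "('a, 'f) manifold"
    by (simp add: submanifold_def)
  have "partial_order_on A (relation_of P A)"
  proof (rule partial_order_on_relation_ofI)
    fix L L' L'' assume A: "L \<in> A" "L' \<in> A" "L'' \<in> A" and P: "P L L'" "P L' L''"
    show "P L L''"
    proof (cases "L = L' \<or> L' = L''")
      case False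
      then have 1: "submanifold L L'" "submanifold L' L''" "topspace (mtop L) \<noteq> topspace (mtop L')"
        using P by (auto simp: P_def)
      then show ?thesis
        using submanifold_trans[OF 1(1,2) sm[OF A(3)]] sub[OF 1(1)] sub[OF 1(2)] by (auto simp: P_def)
    qed (use P in auto)
  next
    fix L L' assume "P L L'" "P L' L"
    then show "L = L'" using sub by (auto simp: P_def)
  qed (simp add: P_def)
  moreover have "\<exists>u\<in>A. \<forall>a\<in>C. P a u" if C: "C \<in> Chains (relation_of P A)" for C
  proof (cases "C = {}")
    case True
    then show ?thesis using L0 by (auto simp: A_def)
  next
    case False
    have CA: "L \<in> A" if "L \<in> C" for L using C that by (auto simp: Chains_def relation_of_def)
    have CP: "P L L' \<or> P L' L" if "L \<in> C" "L' \<in> C" for L L'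
      using C that by (auto simp: Chains_def relation_of_def)
    have chain: "submanifold L L' \<or> submanifold L' L" if "L \<in> C" "L' \<in> C" for L L'
      using CP[OF that] submanifold_refl[OF sm[OF CA[OF that(1)]]] by (auto simp: P_def)
    interpret integral_chain C H S p
      by unfold_locales (use sm CA chain H False in \<open>auto simp: A_def\<close>)
    let ?N = "chain_union C"
    have N: "?N \<in> A" using integral_manifold_chain_union base_point_chain_union by (simp add: A_def)
    \<comment> \<open>A member with all the points of the union is itself an upper bound. The union
      could not serve then: it may differ from that member in its atlas alone, and \<open>P\<close>
      would not relate the two.\<close>
    show ?thesis
    proof (cases "\<exists>L\<in>C. topspace (mtop L) = topspace (mtop ?N)")
      case True
      then obtain L where L: "L \<in> C" "topspace (mtop L) = topspace (mtop ?N)" by blast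
      have "P L' L" if L': "L' \<in> C" for L'
      proof -
        have "topspace (mtop L') \<subseteq> topspace (mtop L)" using L L' topspace_chain_union by auto
        then show ?thesis using CP[OF L' L(1)] sub by (auto simp: P_def)
      qed
      then show ?thesis using CA[OF L(1)] by blast
    next
      case False
      then show ?thesis using N submanifold_chain_union by (auto simp: P_def)
    qed
  qed
  ultimately obtain L where L: "L \<in> A" "\<forall>L'\<in>A. P L L' \<longrightarrow> L' = L"
    using predicate_Zorn by metis
  have "leaf H S L"
    unfolding leaf_def
  proof (intro conjI allI impI)
    show "integral_manifold H S L" using L by (simp add: A_def)
    fix L' :: "('a, 'f) manifold" assume L': "integral_manifold H S L' \<and> submanifold L L'"
    then have "L' \<in> A" using L(1) sub by (auto simp: A_def)
    then show "topspace (mtop L') = topspace (mtop L)" using L(2) L' by (auto simp: P_def)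
  qed
  then show ?thesis using L by (auto simp: A_def)
qed

section \<open>The connection along a submanifold\<close>

context smooth_mfd begin

lemma vector_field_on_scaleR:
  assumes W: "openin (mtop M) W" and f: "smooth_fun_on M W f" and X: "vector_field_on M W X"
  shows "vector_field_on M W (\<lambda>q. f q *\<^sub>R X q)"
proof (rule vector_field_onI)
  fix c assume c: "c \<in> atlas M"
  have o: "openin (mtop M) (fst c \<inter> W)" using chart_open[OF c] W by blast
  have "smooth_fun_on M (fst c \<inter> W) (\<lambda>q. f q *\<^sub>R components M c q (X q))"
    by (rule smooth_fun_on_scaleR[OF o _ smooth_fun_on_components[OF W X c]])
      (rule smooth_fun_on_subset[OF f], simp)
  then show "smooth_fun_on M (fst c \<inter> W) (\<lambda>q. components M c q (f q *\<^sub>R X q))"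
    by (rule smooth_fun_on_cong[OF o, rotated]) (simp add: linear_scale[OF linear_components[OF c]])
qed

lemma vector_field_on_sum:
  assumes W: "openin (mtop M) W" and X: "\<And>i. i \<in> I \<Longrightarrow> vector_field_on M W (X i)"
  shows "vector_field_on M W (\<lambda>q. \<Sum>i\<in>I. X i q)"
proof (rule vector_field_onI)
  fix c assume c: "c \<in> atlas M"
  have o: "openin (mtop M) (fst c \<inter> W)" using chart_open[OF c] W by blast
  have "smooth_fun_on M (fst c \<inter> W) (\<lambda>q. \<Sum>i\<in>I. components M c q (X i q))"
    by (rule smooth_fun_on_sum[OF o smooth_fun_on_components[OF W X c]])
  then show "smooth_fun_on M (fst c \<inter> W) (\<lambda>q. components M c q (\<Sum>i\<in>I. X i q))"
    by (rule smooth_fun_on_cong[OF o, rotated]) (simp add: linear_sum[OF linear_components[OF c]])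
qed

lemma vector_field_on_const_0: "openin (mtop M) W \<Longrightarrow> vector_field_on M W (\<lambda>q. 0)"
  using vector_field_on_sum[of W "{}"] by simp

lemma coord_field_expand:
  assumes "c \<in> atlas M" "p \<in> fst c"
  shows "v = (\<Sum>b\<in>Basis. (components M c p v \<bullet> b) *\<^sub>R coord_field M c b p)"
  by (subst coord_field_components[OF assms, symmetric]) (rule linear_basis_expand[OF linear_coord_field[OF assms]])

end

section \<open>The metric and its Levi-Civita connection on open sets\<close>

locale metric_connection = smooth_mfd M
  for M :: "('a, 'e::euclidean_space) manifold" +
  fixes g :: "'a \<Rightarrow> 'e \<Rightarrow> 'e \<Rightarrow> real" and D :: "'a \<Rightarrow> 'e \<Rightarrow> ('a \<Rightarrow> 'e) \<Rightarrow> 'e"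
  assumes metric: "lorentzian_metric M g" and levi_civita: "levi_civita M g D"
begin

lemma bilinear_metric: "p \<in> topspace (mtop M) \<Longrightarrow> bilinear (g p)"
  and metric_commute: "p \<in> topspace (mtop M) \<Longrightarrow> g p x y = g p y x"
  using metric unfolding lorentzian_metric_def lorentz_form_def by auto

lemma linear_metric_left: "p \<in> topspace (mtop M) \<Longrightarrow> linear (\<lambda>x. g p x y)"
  and linear_metric_right: "p \<in> topspace (mtop M) \<Longrightarrow> linear (g p x)"
  using bilinear_metric unfolding bilinear_def by auto

lemma smooth_metric:
  "openin (mtop M) W \<Longrightarrow> vector_field_on M W X \<Longrightarrow> vector_field_on M W Y \<Longrightarrow>
    smooth_fun_on M W (\<lambda>p. g p (X p) (Y p))"
  using metric unfolding lorentzian_metric_def smooth_function_on_iff by blast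

lemma affine: "affine_connection M D"
  using levi_civita unfolding levi_civita_def by blast

lemma
  assumes W: "openin (mtop M) W" and Y: "vector_field_on M W Y"
  shows linear_D: "p \<in> W \<Longrightarrow> linear (\<lambda>v. D p v Y)"
    and vector_field_D: "vector_field_on M W X \<Longrightarrow> vector_field_on M W (\<lambda>p. D p (X p) Y)"
    and D_add: "vector_field_on M W Z \<Longrightarrow> p \<in> W \<Longrightarrow> D p v (\<lambda>q. Y q + Z q) = D p v Y + D p v Z"
    and D_scaleR: "smooth_fun_on M W f \<Longrightarrow> p \<in> W \<Longrightarrow>
      D p v (\<lambda>q. f q *\<^sub>R Y q) = dir_deriv M f p v *\<^sub>R Y p + f p *\<^sub>R D p v Y"
    and D_cong: "(\<And>q. q \<in> W \<Longrightarrow> Y' q = Y q) \<Longrightarrow> p \<in> W \<Longrightarrow> D p v Y' = D p v Y"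
proof -
  note A = affine[unfolded affine_connection_def smooth_function_on_iff, THEN spec, THEN mp, OF W,
      THEN spec, THEN mp, OF Y]
  show "p \<in> W \<Longrightarrow> linear (\<lambda>v. D p v Y)" using A[THEN conjunct1] by simp
  note A = A[THEN conjunct2]
  show "vector_field_on M W X \<Longrightarrow> vector_field_on M W (\<lambda>p. D p (X p) Y)" using A[THEN conjunct1] by simp
  note A = A[THEN conjunct2]
  show "vector_field_on M W Z \<Longrightarrow> p \<in> W \<Longrightarrow> D p v (\<lambda>q. Y q + Z q) = D p v Y + D p v Z"
    using A[THEN conjunct1] by simp
  note A = A[THEN conjunct2]
  show "smooth_fun_on M W f \<Longrightarrow> p \<in> W \<Longrightarrow>
      D p v (\<lambda>q. f q *\<^sub>R Y q) = dir_deriv M f p v *\<^sub>R Y p + f p *\<^sub>R D p v Y"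
    using A[THEN conjunct1] by simp
  show "(\<And>q. q \<in> W \<Longrightarrow> Y' q = Y q) \<Longrightarrow> p \<in> W \<Longrightarrow> D p v Y' = D p v Y"
    using A[THEN conjunct2, THEN spec, of Y'] by blast
qed

lemma
  assumes "openin (mtop M) W" "vector_field_on M W X" "vector_field_on M W Y" "p \<in> W"
  shows metric_compatible:
      "dir_deriv M (\<lambda>q. g q (X q) (Y q)) p v = g p (D p v X) (Y p) + g p (X p) (D p v Y)"
    and torsion_free: "D p (X p) Y - D p (Y p) X = lie_bracket M X Y p"
proof -
  have "openin (mtop M) W \<and> vector_field_on M W X \<and> vector_field_on M W Y" using assms by blast
  note L = levi_civita[unfolded levi_civita_def, THEN conjunct2, THEN spec, THEN spec, THEN spec, THEN mp,
      OF this, THEN bspec, OF assms(4)]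
  show "dir_deriv M (\<lambda>q. g q (X q) (Y q)) p v = g p (D p v X) (Y p) + g p (X p) (D p v Y)"
    using L[THEN conjunct2] by simp
  show "D p (X p) Y - D p (Y p) X = lie_bracket M X Y p" using L[THEN conjunct1] .
qed

lemma D_sum:
  assumes W: "openin (mtop M) W" "p \<in> W" and "finite I" and Y: "\<And>i. i \<in> I \<Longrightarrow> vector_field_on M W (Y i)"
  shows "D p v (\<lambda>q. \<Sum>i\<in>I. Y i q) = (\<Sum>i\<in>I. D p v (Y i))"
  using assms(3) Y
proof (induction I)
  case empty
  \<comment> \<open>The zero field is the zero function times a field, so the Leibniz rule
    annihilates it.\<close>
  have "D p v (\<lambda>q. 0 *\<^sub>R (0::'e)) = 0"
    using D_scaleR[OF W(1) vector_field_on_const_0[OF W(1)] smooth_fun_on_const W(2), of v 0]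
    by (simp add: dir_deriv_const)
  then show ?case by simp
next
  case (insert i I)
  have "vector_field_on M W (\<lambda>q. \<Sum>i\<in>I. Y i q)"
    by (rule vector_field_on_sum[OF W(1)]) (use insert in auto)
  from D_add[OF W(1) insert.prems[of i] this W(2)] insert show ?case by simp
qed

text \<open>Coordinate fields have constant components in their own chart, so their Lie bracket
  vanishes and torsion-freeness becomes the symmetry of the Christoffel symbols.\<close>

lemma D_coord_field_commute:
  assumes "p \<in> topspace (mtop M)"
  shows "D p a (coord_field M (chart_at M p) b) = D p b (coord_field M (chart_at M p) a)"
proof -
  let ?c = "chart_at M p"
  note c = chart_at[OF assms]
  have 0: "dir_deriv M (\<lambda>q. components M ?c q (coord_field M ?c b q)) p v = 0" for b v
    using dir_deriv_cong[OF chart_open[OF c(1)] c(2) _ smooth_fun_on_const, of b]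
      components_coord_field[OF c(1)] by (simp add: dir_deriv_const)
  have "D p (coord_field M ?c a p) (coord_field M ?c b) - D p (coord_field M ?c b p) (coord_field M ?c a) = 0"
    using torsion_free[OF chart_open[OF c(1)] vector_field_coord_field[OF c(1)] vector_field_coord_field[OF c(1)] c(2)]
    by (simp add: lie_bracket_def 0)
  then show ?thesis by (simp add: coord_field_chart_at[OF assms])
qed

end

section \<open>Covariant differentiation of fields along a submanifold\<close>

locale metric_connection_along = metric_connection M g D + incl_mfd N M
  for M :: "('a, 'e::euclidean_space) manifold" and g D and N :: "('a, 'f::euclidean_space) manifold"
begin

text \<open>The domain \<open>V\<close> is kept inside one chart \<open>c\<close> of the ambient
  manifold, so that a single system of components describes the field on all of
  \<open>V\<close>.\<close>

definition smooth_along :: "('a, 'e) chart \<Rightarrow> 'a set \<Rightarrow> ('a \<Rightarrow> 'e) \<Rightarrow> bool" where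
  "smooth_along c V Y \<longleftrightarrow> c \<in> atlas M \<and> openin (mtop N) V \<and> V \<subseteq> fst c \<and>
    smooth_fun_on N V (\<lambda>q. components M c q (Y q))"

lemma smooth_alongD:
  assumes "smooth_along c V Y"
  shows "c \<in> atlas M" "openin (mtop N) V" "q \<in> V \<Longrightarrow> q \<in> fst c" "q \<in> V \<Longrightarrow> q \<in> topspace (mtop N)"
    "q \<in> V \<Longrightarrow> q \<in> topspace (mtop M)"
  using assms openin_subset topspace_incl unfolding smooth_along_def by blast+

lemma smooth_along_component:
  "smooth_along c V Y \<Longrightarrow> smooth_fun_on N V (\<lambda>q. components M c q (Y q) \<bullet> b)"
  unfolding smooth_along_def using N.smooth_fun_on_bounded_linear[OF _ bounded_linear_inner_left] by blast

lemma smooth_fun_on_incl_subset: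
  "c \<in> atlas M \<Longrightarrow> smooth_fun_on M (fst c) f \<Longrightarrow> openin (mtop N) V \<Longrightarrow> V \<subseteq> fst c \<Longrightarrow> smooth_fun_on N V f"
  by (rule smooth_fun_on_subset[OF smooth_fun_on_incl[OF chart_open]]) (auto dest: openin_subset)

lemma smooth_along_push:
  assumes c: "c \<in> atlas M" and V: "openin (mtop N) V" "V \<subseteq> fst c" and X: "vector_field_on N V X"
  shows "smooth_along c V (push M N X)"
proof -
  have VN: "V \<subseteq> topspace (mtop N)" using V openin_subset by blast
  have "smooth_fun_on N V (snd c)"
    by (rule smooth_fun_on_subset[OF smooth_fun_on_chart_incl[OF c]]) (use V VN in auto)
  then have "smooth_fun_on N V (\<lambda>q. dir_deriv N (snd c) q (X q))"
    by (rule N.smooth_fun_on_dir_deriv[OF V(1) _ X])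
  then have "smooth_fun_on N V (\<lambda>q. components M c q (push M N X q))"
    by (rule N.smooth_fun_on_cong[OF V(1), rotated]) (use V VN in \<open>auto simp: push_def subset_iff components_incl[OF c]\<close>)
  then show ?thesis using c V by (simp add: smooth_along_def)
qed

text \<open>The local formula for the induced derivative in an arbitrary chart. With
  \<open>c\<close> fixed it exhibits the dependence on \<open>p\<close>, which the formula of
  \<open>nabla_along\<close> hides behind the choice of a chart at every point.\<close>

definition nabla_chart :: "('a, 'e) chart \<Rightarrow> ('a \<Rightarrow> 'e) \<Rightarrow> 'a \<Rightarrow> 'f \<Rightarrow> 'e" where
  "nabla_chart c Y p v = (\<Sum>b\<in>Basis. dir_deriv N (\<lambda>q. components M c q (Y q) \<bullet> b) p v *\<^sub>R coord_field M c b p +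
     (components M c p (Y p) \<bullet> b) *\<^sub>R D p (incl N M p v) (coord_field M c b))"

lemma nabla_along_eq_nabla_chart_at:
  assumes Y: "smooth_along (chart_at M p) V Y" and p: "p \<in> V"
  shows "nabla_along M D N Y p v = nabla_chart (chart_at M p) Y p v"
proof -
  note pN = smooth_alongD(4,5)[OF Y p]
  have "dir_deriv N (\<lambda>q. components M (chart_at M p) q (Y q)) p v =
      (\<Sum>b\<in>Basis. dir_deriv N (\<lambda>q. components M (chart_at M p) q (Y q) \<bullet> b) p v *\<^sub>R b)"
    using Y N.dir_deriv_bounded_linear[OF bounded_linear_inner_left _ p pN(1), of "\<lambda>q. components M (chart_at M p) q (Y q)"]
    by (simp add: smooth_along_def euclidean_representation)
  then show ?thesis
    by (simp add: nabla_along_def nabla_chart_def sum.distrib coord_field_chart_at[OF pN(2)] components_chart_at[OF pN(2)])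
qed

text \<open>Changing charts multiplies components and coordinate fields by the Jacobian
  \<open>J\<close>. Its derivatives arise once from the product rule for the components along
  \<open>N\<close> and once from the Leibniz rule of \<open>D\<close> on \<open>M\<close>, and the
  two contributions coincide.\<close>

lemma nabla_along_eq_nabla_chart:
  assumes Y: "smooth_along c V Y" and p: "p \<in> V"
  shows "nabla_along M D N Y p v = nabla_chart c Y p v"
proof -
  define e where "e = chart_at M p"
  note pN = smooth_alongD(4,5)[OF Y p]
  note c = smooth_alongD(1)[OF Y] smooth_alongD(3)[OF Y p]
  have e: "e \<in> atlas M" "p \<in> fst e" using chart_at[OF pN(2)] by (auto simp: e_def)
  define W where "W = fst c \<inter> fst e"
  define J where "J a b q = components M e q (coord_field M c a q) \<bullet> b" for a b q
  define y where "y a q = components M c q (Y q) \<bullet> a" for a q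
  define V' where "V' = V \<inter> (W \<inter> topspace (mtop N))"
  define w where "w = incl N M p v"
  have W: "openin (mtop M) W" "p \<in> W" using chart_open[OF c(1)] chart_open[OF e(1)] c e by (auto simp: W_def)
  have V': "openin (mtop N) V'" "p \<in> V'"
    using openin_incl[OF cont_incl W(1)] smooth_alongD(2)[OF Y] p W pN by (auto simp: V'_def)
  have Jvec: "smooth_fun_on M W (\<lambda>q. components M e q (coord_field M c a q))" for a
    using smooth_fun_on_components[OF chart_open[OF c(1)] vector_field_coord_field[OF c(1)] e(1)]
    by (simp add: W_def Int_commute)
  have J: "smooth_fun_on M W (J a b)" for a b
    unfolding J_def by (rule smooth_fun_on_bounded_linear[OF W(1) bounded_linear_inner_left Jvec])
  have JN: "smooth_fun_on N V' (J a b)" for a b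
    by (rule smooth_fun_on_subset[OF smooth_fun_on_incl[OF W(1) J]]) (auto simp: V'_def)
  have y: "smooth_fun_on N V' (y a)" for a
    unfolding y_def by (rule smooth_fun_on_subset[OF smooth_along_component[OF Y]]) (auto simp: V'_def)
  have comp: "components M e q (Y q) = (\<Sum>a\<in>Basis. y a q *\<^sub>R components M e q (coord_field M c a q))"
    if "q \<in> W" for q
    using arg_cong[OF coord_field_expand[of c q "Y q"], of "components M e q"] that c e
    by (simp add: W_def y_def linear_sum[OF linear_components[OF e(1)]] linear_scale[OF linear_components[OF e(1)]])
  have compb: "(\<Sum>a\<in>Basis. y a q *\<^sub>R J a b q) = components M e q (Y q) \<bullet> b" if "q \<in> W" for q b
    using comp[OF that] by (simp add: inner_sum_left J_def)
  have "smooth_fun_on N V' (\<lambda>q. \<Sum>b\<in>Basis. (\<Sum>a\<in>Basis. y a q *\<^sub>R J a b q) *\<^sub>R b)"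
    by (intro N.smooth_fun_on_sum N.smooth_fun_on_scaleR N.smooth_fun_on_const y JN V'(1))
  then have "smooth_fun_on N V' (\<lambda>q. components M e q (Y q))"
    by (rule N.smooth_fun_on_cong[OF V'(1), rotated])
      (simp add: compb V'_def euclidean_representation del: real_scaleR_def)
  then have Ye: "smooth_along e V' Y"
    using e V' by (auto simp: smooth_along_def V'_def W_def)
  have dcomp: "dir_deriv N (\<lambda>q. components M e q (Y q) \<bullet> b) p v =
      (\<Sum>a\<in>Basis. y a p * dir_deriv M (J a b) p w + dir_deriv N (y a) p v * J a b p)" for b
  proof -
    have s: "smooth_fun_on N V' (\<lambda>q. y a q *\<^sub>R J a b q)" for a
      by (rule N.smooth_fun_on_scaleR[OF V'(1) y JN])
    have "dir_deriv N (\<lambda>q. components M e q (Y q) \<bullet> b) p v = dir_deriv N (\<lambda>q. \<Sum>a\<in>Basis. y a q *\<^sub>R J a b q) p v"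
      by (rule N.dir_deriv_cong[OF V' _ N.smooth_fun_on_sum[OF V'(1) s]]) (simp add: V'_def compb del: real_scaleR_def)
    also have "\<dots> = (\<Sum>a\<in>Basis. dir_deriv N (\<lambda>q. y a q *\<^sub>R J a b q) p v)"
      by (rule N.dir_deriv_sum[OF s V'(2) pN(1)])
    also have "\<dots> = (\<Sum>a\<in>Basis. y a p *\<^sub>R dir_deriv N (J a b) p v + dir_deriv N (y a) p v *\<^sub>R J a b p)"
      by (intro sum.cong refl N.dir_deriv_scaleR[OF y JN V'(2) pN(1)])
    \<comment> \<open>\<open>J\<close> is defined on an open set of \<open>M\<close>, so its
      derivative along \<open>v\<close> is that along the image \<open>w\<close> of
      \<open>v\<close>; this is the form in which it occurs in \<open>Dc\<close>.\<close>
    also have "\<dots> = (\<Sum>a\<in>Basis. y a p *\<^sub>R dir_deriv M (J a b) p w + dir_deriv N (y a) p v *\<^sub>R J a b p)"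
      unfolding w_def by (simp only: dir_deriv_incl[OF W(1) J W(2) pN(1)])
    finally show ?thesis by simp
  qed
  have coord: "coord_field M c a q = (\<Sum>b\<in>Basis. J a b q *\<^sub>R coord_field M e b q)" if "q \<in> W" for a q
    using coord_field_expand[OF e(1), of q "coord_field M c a q"] that by (simp add: W_def J_def)
  have vf: "vector_field_on M W (coord_field M e b)" "vector_field_on M W (coord_field M c b)" for b
    using vector_field_on_subset[OF vector_field_coord_field] c e by (auto simp: W_def)
  have vfs: "vector_field_on M W (\<lambda>q. J a b q *\<^sub>R coord_field M e b q)" for a b
    by (rule vector_field_on_scaleR[OF W(1) J vf(1)])
  have Dc: "D p w (coord_field M c a) =
      (\<Sum>b\<in>Basis. dir_deriv M (J a b) p w *\<^sub>R coord_field M e b p + J a b p *\<^sub>R D p w (coord_field M e b))" for a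
  proof -
    have "D p w (coord_field M c a) = D p w (\<lambda>q. \<Sum>b\<in>Basis. J a b q *\<^sub>R coord_field M e b q)"
      by (rule D_cong[OF W(1) vector_field_on_sum[OF W(1) vfs] coord W(2)])
    also have "\<dots> = (\<Sum>b\<in>Basis. D p w (\<lambda>q. J a b q *\<^sub>R coord_field M e b q))"
      by (rule D_sum[OF W finite_Basis vfs])
    also have "\<dots> = (\<Sum>b\<in>Basis. dir_deriv M (J a b) p w *\<^sub>R coord_field M e b p + J a b p *\<^sub>R D p w (coord_field M e b))"
      by (intro sum.cong refl D_scaleR[OF W(1) vf(1) J W(2)])
    finally show ?thesis .
  qed
  have "nabla_chart c Y p v = (\<Sum>a\<in>Basis. dir_deriv N (y a) p v *\<^sub>R coord_field M c a p + y a p *\<^sub>R D p w (coord_field M c a))"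
    by (simp add: nabla_chart_def y_def[abs_def] w_def)
  also have "\<dots> = (\<Sum>a\<in>Basis. \<Sum>b\<in>Basis. (y a p * dir_deriv M (J a b) p w + dir_deriv N (y a) p v * J a b p) *\<^sub>R coord_field M e b p
      + (y a p * J a b p) *\<^sub>R D p w (coord_field M e b))"
    unfolding coord[OF W(2)] Dc
    by (simp add: scaleR_sum_right sum.distrib scaleR_add_left scaleR_add_right algebra_simps)
  also have "\<dots> = (\<Sum>b\<in>Basis. \<Sum>a\<in>Basis. (y a p * dir_deriv M (J a b) p w + dir_deriv N (y a) p v * J a b p) *\<^sub>R coord_field M e b p
      + (y a p * J a b p) *\<^sub>R D p w (coord_field M e b))"
    by (rule sum.swap)
  also have "\<dots> = (\<Sum>b\<in>Basis. dir_deriv N (\<lambda>q. components M e q (Y q) \<bullet> b) p v *\<^sub>R coord_field M e b p +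
      (components M e p (Y p) \<bullet> b) *\<^sub>R D p w (coord_field M e b))"
    unfolding dcomp compb[OF W(2), symmetric] sum.distrib scaleR_sum_left[symmetric] by simp
  also have "\<dots> = nabla_chart e Y p v" by (simp add: nabla_chart_def w_def)
  also have "\<dots> = nabla_along M D N Y p v"
    using nabla_along_eq_nabla_chart_at Ye V'(2) unfolding e_def by metis
  finally show ?thesis by simp
qed

lemma smooth_metric_coord_fields:
  assumes "c \<in> atlas M" "openin (mtop N) V" "V \<subseteq> fst c" "vector_field_on M (fst c) A" "vector_field_on M (fst c) B"
  shows "smooth_fun_on N V (\<lambda>q. g q (A q) (B q))"
  using smooth_fun_on_incl_subset[OF assms(1) smooth_metric[OF chart_open[OF assms(1)] assms(4,5)] assms(2,3)] .

text \<open>Smoothness of the metric is given for fields on open sets of \<open>M\<close> only. A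
  field along \<open>N\<close> is expanded in coordinate fields, here in the second slot and
  afterwards in the first.\<close>

lemma smooth_metric_along:
  assumes Z: "smooth_along c V Z" and A: "vector_field_on M (fst c) A"
  shows "smooth_fun_on N V (\<lambda>q. g q (A q) (Z q))"
proof -
  note c = smooth_alongD(1)[OF Z] and V = smooth_alongD(2)[OF Z]
  have Vc: "V \<subseteq> fst c" using smooth_alongD(3)[OF Z] by blast
  have "smooth_fun_on N V (\<lambda>q. \<Sum>d\<in>Basis. (components M c q (Z q) \<bullet> d) *\<^sub>R g q (A q) (coord_field M c d q))"
    by (intro N.smooth_fun_on_sum N.smooth_fun_on_scaleR V smooth_along_component[OF Z]
        smooth_metric_coord_fields[OF c V Vc A vector_field_coord_field[OF c]])
  then show ?thesis
  proof (rule N.smooth_fun_on_cong[OF V, rotated])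
    fix q assume q: "q \<in> V"
    have "g q (A q) (\<Sum>d\<in>Basis. (components M c q (Z q) \<bullet> d) *\<^sub>R coord_field M c d q) =
        (\<Sum>d\<in>Basis. (components M c q (Z q) \<bullet> d) *\<^sub>R g q (A q) (coord_field M c d q))"
      by (simp add: linear_sum[OF linear_metric_right] linear_scale[OF linear_metric_right] smooth_alongD(5)[OF Z q])
    then show "(\<Sum>d\<in>Basis. (components M c q (Z q) \<bullet> d) *\<^sub>R g q (A q) (coord_field M c d q)) = g q (A q) (Z q)"
      using coord_field_expand[OF c smooth_alongD(3)[OF Z q]] by metis
  qed
qed

lemma smooth_metric_along_along:
  assumes Y: "smooth_along c V Y" and Z: "smooth_along c V Z"
  shows "smooth_fun_on N V (\<lambda>q. g q (Y q) (Z q))"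
proof -
  note c = smooth_alongD(1)[OF Z] and V = smooth_alongD(2)[OF Z]
  have "smooth_fun_on N V (\<lambda>q. \<Sum>d\<in>Basis. (components M c q (Y q) \<bullet> d) *\<^sub>R g q (coord_field M c d q) (Z q))"
    by (intro N.smooth_fun_on_sum N.smooth_fun_on_scaleR V smooth_along_component[OF Y]
        smooth_metric_along[OF Z vector_field_coord_field[OF c]])
  then show ?thesis
  proof (rule N.smooth_fun_on_cong[OF V, rotated])
    fix q assume q: "q \<in> V"
    have "g q (\<Sum>d\<in>Basis. (components M c q (Y q) \<bullet> d) *\<^sub>R coord_field M c d q) (Z q) =
        (\<Sum>d\<in>Basis. (components M c q (Y q) \<bullet> d) *\<^sub>R g q (coord_field M c d q) (Z q))"
      by (simp add: linear_sum[OF linear_metric_left] linear_scale[OF linear_metric_left] smooth_alongD(5)[OF Z q])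
    then show "(\<Sum>d\<in>Basis. (components M c q (Y q) \<bullet> d) *\<^sub>R g q (coord_field M c d q) (Z q)) = g q (Y q) (Z q)"
      using coord_field_expand[OF c smooth_alongD(3)[OF Z q]] by metis
  qed
qed

text \<open>Besides the field, the direction \<open>X\<close> is expanded in coordinate fields as
  well; what remains are the fields obtained by differentiating one coordinate field along another,
  smooth on the whole chart domain.\<close>

lemma smooth_metric_nabla_along:
  assumes Y: "smooth_along c V Y" and X: "vector_field_on N V X" and Z: "smooth_along c V Z"
  shows "smooth_fun_on N V (\<lambda>q. g q (nabla_along M D N Y q (X q)) (Z q))"
proof -
  note c = smooth_alongD(1)[OF Z] and V = smooth_alongD(2)[OF Z]
  have Vc: "V \<subseteq> fst c" using smooth_alongD(3)[OF Z] by blast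
  note P = vector_field_coord_field[OF c] and o = chart_open[OF c]
  have X': "smooth_along c V (push M N X)" by (rule smooth_along_push[OF c V Vc X])
  have "smooth_fun_on N V (\<lambda>q. \<Sum>b\<in>Basis.
      dir_deriv N (\<lambda>q. components M c q (Y q) \<bullet> b) q (X q) *\<^sub>R g q (coord_field M c b q) (Z q) +
      (components M c q (Y q) \<bullet> b) *\<^sub>R (\<Sum>a\<in>Basis. (components M c q (push M N X q) \<bullet> a) *\<^sub>R
        g q (D q (coord_field M c a q) (coord_field M c b)) (Z q)))"
    by (intro N.smooth_fun_on_sum N.smooth_fun_on_add N.smooth_fun_on_scaleR V
        N.smooth_fun_on_dir_deriv[OF V _ X] smooth_along_component[OF Y] smooth_along_component[OF X']
        smooth_metric_along[OF Z] P vector_field_D[OF o P P])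
  then show ?thesis
  proof (rule N.smooth_fun_on_cong[OF V, rotated])
    fix q assume q: "q \<in> V"
    note qM = smooth_alongD(5)[OF Z q] and qc = smooth_alongD(3)[OF Z q]
    have "D q (incl N M q (X q)) (coord_field M c b) = (\<Sum>a\<in>Basis. (components M c q (push M N X q) \<bullet> a) *\<^sub>R
        D q (coord_field M c a q) (coord_field M c b))" for b
      using arg_cong[OF coord_field_expand[OF c qc, of "push M N X q"], of "\<lambda>v. D q v (coord_field M c b)"]
      by (simp add: linear_sum[OF linear_D[OF o P qc]] linear_scale[OF linear_D[OF o P qc]] push_def)
    then have "nabla_along M D N Y q (X q) = (\<Sum>b\<in>Basis.
      dir_deriv N (\<lambda>q. components M c q (Y q) \<bullet> b) q (X q) *\<^sub>R coord_field M c b q +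
      (components M c q (Y q) \<bullet> b) *\<^sub>R (\<Sum>a\<in>Basis. (components M c q (push M N X q) \<bullet> a) *\<^sub>R
        D q (coord_field M c a q) (coord_field M c b)))"
      unfolding nabla_along_eq_nabla_chart[OF Y q] nabla_chart_def by simp
    then show "(\<Sum>b\<in>Basis.
      dir_deriv N (\<lambda>q. components M c q (Y q) \<bullet> b) q (X q) *\<^sub>R g q (coord_field M c b q) (Z q) +
      (components M c q (Y q) \<bullet> b) *\<^sub>R (\<Sum>a\<in>Basis. (components M c q (push M N X q) \<bullet> a) *\<^sub>R
        g q (D q (coord_field M c a q) (coord_field M c b)) (Z q))) = g q (nabla_along M D N Y q (X q)) (Z q)"
      by (simp add: linear_sum[OF linear_metric_left[OF qM]] linear_add[OF linear_metric_left[OF qM]]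
          linear_scale[OF linear_metric_left[OF qM]])
  qed
qed

text \<open>Expanding both fields in one chart reduces the claim to the product rule for
  \<open>y a\<close>, \<open>z b\<close> and \<open>G a b\<close>, and to metric compatibility for
  coordinate fields, which are fields on an open set of \<open>M\<close>.\<close>

lemma metric_compatible_along:
  assumes Y: "smooth_along c V Y" and Z: "smooth_along c V Z" and p: "p \<in> V"
  shows "dir_deriv N (\<lambda>q. g q (Y q) (Z q)) p v =
    g p (nabla_along M D N Y p v) (Z p) + g p (Y p) (nabla_along M D N Z p v)"
proof -
  note c = smooth_alongD(1)[OF Z] and V = smooth_alongD(2)[OF Z] and pN = smooth_alongD(4,5)[OF Z p]
  have Vc: "V \<subseteq> fst c" using smooth_alongD(3)[OF Z] by blast
  have pc: "p \<in> fst c" using Vc p by blast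
  note P = vector_field_coord_field[OF c] and o = chart_open[OF c]
  define w where "w = incl N M p v"
  define y where "y a q = components M c q (Y q) \<bullet> a" for a q
  define z where "z a q = components M c q (Z q) \<bullet> a" for a q
  define G where "G a b q = g q (coord_field M c a q) (coord_field M c b q)" for a b q
  define P' where "P' a = D p w (coord_field M c a)" for a
  have y: "smooth_fun_on N V (y a)" and z: "smooth_fun_on N V (z a)" for a
    unfolding y_def z_def by (rule smooth_along_component[OF Y] smooth_along_component[OF Z])+
  have GM: "smooth_fun_on M (fst c) (G a b)" for a b
    unfolding G_def by (rule smooth_metric[OF o P P])
  have G: "smooth_fun_on N V (G a b)" for a b
    by (rule smooth_fun_on_incl_subset[OF c GM V Vc])
  have Yq: "(\<Sum>a\<in>Basis. y a q *\<^sub>R coord_field M c a q) = Y q"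
    and Zq: "(\<Sum>a\<in>Basis. z a q *\<^sub>R coord_field M c a q) = Z q" if "q \<in> V" for q
    unfolding y_def z_def by (rule coord_field_expand[OF c smooth_alongD(3)[OF Z that], symmetric])+
  have bil: "g q (\<Sum>a\<in>A. f a) (\<Sum>b\<in>B. h b) = (\<Sum>a\<in>A. \<Sum>b\<in>B. g q (f a) (h b))" if "q \<in> topspace (mtop M)"
    for q and f h :: "'e \<Rightarrow> 'e" and A B
    by (subst linear_sum[OF linear_metric_left[OF that]]) (intro sum.cong refl linear_sum[OF linear_metric_right[OF that]])
  have sc: "g q (r *\<^sub>R x) x' = r * g q x x'" "g q x (r *\<^sub>R x') = r * g q x x'"
    "g q (x + x') x'' = g q x x'' + g q x' x''" "g q x (x' + x'') = g q x x' + g q x x''"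
    if "q \<in> topspace (mtop M)" for q r x x' x''
    by (simp_all add: linear_scale[OF linear_metric_left[OF that]] linear_scale[OF linear_metric_right[OF that]]
        linear_add[OF linear_metric_left[OF that]] linear_add[OF linear_metric_right[OF that]])
  have gYZ: "g q (Y q) (Z q) = (\<Sum>a\<in>Basis. \<Sum>b\<in>Basis. y a q *\<^sub>R z b q *\<^sub>R G a b q)" if q: "q \<in> V" for q
    unfolding Yq[OF q, symmetric] Zq[OF q, symmetric] bil[OF smooth_alongD(5)[OF Z q]]
    by (simp add: G_def sc[OF smooth_alongD(5)[OF Z q]] mult.left_commute)
  have s1: "smooth_fun_on N V (\<lambda>q. z b q *\<^sub>R G a b q)" for a b by (intro N.smooth_fun_on_scaleR V z G)
  have s2: "smooth_fun_on N V (\<lambda>q. y a q *\<^sub>R z b q *\<^sub>R G a b q)" for a b by (intro N.smooth_fun_on_scaleR V y s1)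
  have s3: "smooth_fun_on N V (\<lambda>q. \<Sum>b\<in>Basis. y a q *\<^sub>R z b q *\<^sub>R G a b q)" for a by (intro N.smooth_fun_on_sum V s2)
  have dG: "dir_deriv N (G a b) p v = g p (P' a) (coord_field M c b p) + g p (coord_field M c a p) (P' b)" for a b
    using dir_deriv_incl[OF o GM pc pN(1), of a b v] metric_compatible[OF o P P pc, of a b w]
    by (simp add: G_def[abs_def] w_def P'_def)
  have "dir_deriv N (\<lambda>q. g q (Y q) (Z q)) p v = dir_deriv N (\<lambda>q. \<Sum>a\<in>Basis. \<Sum>b\<in>Basis. y a q *\<^sub>R z b q *\<^sub>R G a b q) p v"
    by (rule N.dir_deriv_cong[OF V p gYZ[symmetric] N.smooth_fun_on_sum[OF V s3]])
  also have "\<dots> = (\<Sum>a\<in>Basis. \<Sum>b\<in>Basis. dir_deriv N (\<lambda>q. y a q *\<^sub>R z b q *\<^sub>R G a b q) p v)"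
    by (simp only: N.dir_deriv_sum[OF s3 p pN(1)] N.dir_deriv_sum[OF s2 p pN(1)])
  also have "\<dots> = (\<Sum>a\<in>Basis. \<Sum>b\<in>Basis. y a p * (z b p * dir_deriv N (G a b) p v + dir_deriv N (z b) p v * G a b p) +
      dir_deriv N (y a) p v * (z b p * G a b p))"
    unfolding N.dir_deriv_scaleR[OF y s1 p pN(1)] N.dir_deriv_scaleR[OF z G p pN(1)] unfolding real_scaleR_def ..
  finally have lhs: "dir_deriv N (\<lambda>q. g q (Y q) (Z q)) p v = \<dots>" .
  have nY: "nabla_along M D N Y p v = (\<Sum>a\<in>Basis. dir_deriv N (y a) p v *\<^sub>R coord_field M c a p + y a p *\<^sub>R P' a)"
    unfolding nabla_along_eq_nabla_chart[OF Y p] nabla_chart_def y_def[abs_def] P'_def w_def by simp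
  have nZ: "nabla_along M D N Z p v = (\<Sum>a\<in>Basis. dir_deriv N (z a) p v *\<^sub>R coord_field M c a p + z a p *\<^sub>R P' a)"
    unfolding nabla_along_eq_nabla_chart[OF Z p] nabla_chart_def z_def[abs_def] P'_def w_def by simp
  show ?thesis
    unfolding lhs nY nZ Yq[OF p, symmetric] Zq[OF p, symmetric] bil[OF pN(2)] dG sum.distrib[symmetric]
    by (intro sum.cong refl) (simp add: sc[OF pN(2)] G_def algebra_simps)
qed

text \<open>
  \<open>g(\<nabla>\<^sub>i U, \<partial>\<^sub>j) = - g(U, \<nabla>\<^sub>i \<partial>\<^sub>j)\<close>, since \<open>U\<close> is orthogonal to the coordinate fields, and \<open>\<nabla>\<^sub>i \<partial>\<^sub>j\<close>
  is symmetric.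
\<close>

lemma null_form_commute:
  assumes U: "vector_field N U" and p: "p \<in> topspace (mtop N)"
    and ortho: "\<And>q w. q \<in> topspace (mtop N) \<Longrightarrow> g q (push M N U q) (incl N M q w) = 0"
  shows "null_form M g D N U p x y = null_form M g D N U p y x"
proof -
  define c where "c = chart_at N p"
  define e where "e = chart_at M p"
  define V where "V = fst c \<inter> (fst e \<inter> topspace (mtop N))"
  \<comment> \<open>\<open>E v\<close> extends the vector \<open>v\<close> to a field on
    \<open>N\<close> near \<open>p\<close> with constant components in \<open>c\<close>.\<close>
  define E where "E = coord_field N c"
  have pM: "p \<in> topspace (mtop M)" using p topspace_incl by blast
  have c: "c \<in> atlas N" "p \<in> fst c" and e: "e \<in> atlas M" "p \<in> fst e"
    using N.chart_at[OF p] chart_at[OF pM] by (auto simp: c_def e_def)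
  have V: "openin (mtop N) V" "p \<in> V"
    using N.chart_open[OF c(1)] openin_incl[OF cont_incl chart_open[OF e(1)]] c e p by (auto simp: V_def)
  have Ve: "V \<subseteq> fst e" by (auto simp: V_def)
  have E: "vector_field_on N V (E v)" for v
    unfolding E_def by (rule vector_field_on_subset[OF N.vector_field_coord_field[OF c(1)]]) (auto simp: V_def)
  have Ep: "E v p = v" for v unfolding E_def c_def by (rule N.coord_field_chart_at[OF p])
  have sU: "smooth_along e V (push M N U)"
    by (rule smooth_along_push[OF e(1) V(1) Ve vector_field_on_subset[OF U]]) (auto simp: V_def)
  have sE: "smooth_along e V (push M N (E v))" for v
    by (rule smooth_along_push[OF e(1) V(1) Ve E])
  have "dir_deriv N (\<lambda>q. g q (push M N U q) (push M N (E v) q)) p u = dir_deriv N (\<lambda>q. 0) p u" for u v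
    by (rule N.dir_deriv_cong[OF V _ N.smooth_fun_on_const])
      (use ortho in \<open>simp add: push_def[of M N "E v"] V_def\<close>)
  then have zero: "dir_deriv N (\<lambda>q. g q (push M N U q) (push M N (E v) q)) p u = 0" for u v
    unfolding N.dir_deriv_const .
  have form: "null_form M g D N U p u v = g p (push M N U p) (nabla_along M D N (push M N (E v)) p u)" for u v
    using metric_compatible_along[OF sU sE V(2), of v u, unfolded zero]
    by (simp add: null_form_def push_def[of M N "E v" p] Ep)
  \<comment> \<open>The inclusion in coordinates. The components of \<open>E v\<close> are its
    derivatives in direction \<open>v\<close>, so differentiating \<open>E v\<close> along
    \<open>u\<close> gives a second derivative of \<phi> plus a Christoffel term, each symmetric in
    \<open>u\<close> and \<open>v\<close>.\<close>
  define \<phi> where "\<phi> = snd e \<circ> chart_inv c"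
  define S where "S = snd c ` (fst c \<inter> V)"
  have S: "open S" "snd c p \<in> S" using N.chart_image_open[OF c(1) V(1)] c V by (auto simp: S_def)
  have se: "smooth_fun_on N V (snd e)"
    by (rule smooth_fun_on_subset[OF smooth_fun_on_chart_incl[OF e(1)]]) (auto simp: V_def)
  have \<phi>: "smooth_on S \<phi>" using se c by (auto simp: S_def \<phi>_def smooth_fun_on_def)
  have comp: "components M e q (push M N (E v) q) = frechet_derivative \<phi> (at (snd c q)) v" if "q \<in> V" for q v
    using that components_incl[OF e(1), of q "E v q"] N.dir_deriv_chart[OF se c(1) that, of "E v q"]
      N.components_coord_field[OF c(1), of q v]
    by (simp add: V_def push_def \<phi>_def E_def)
  have first: "dir_deriv N (\<lambda>q. components M e q (push M N (E v) q)) p u =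
      frechet_derivative (\<lambda>x. frechet_derivative \<phi> (at x) v) (at (snd c p)) u" for u v
  proof (rule N.dir_derivI)
    show "((\<lambda>q. components M e q (push M N (E v) q)) \<circ> chart_inv (chart_at N p) has_derivative
      frechet_derivative (\<lambda>x. frechet_derivative \<phi> (at x) v) (at (snd c p))) (at (snd (chart_at N p) p))"
      unfolding c_def[symmetric]
      by (rule has_derivative_transform_within_open[OF smooth_on_has_derivative[OF smooth_on_frechet[OF \<phi>] S(2)] S])
        (use N.chart_inv_chart[OF c(1)] comp in \<open>auto simp: S_def\<close>)
  qed
  have second: "(\<Sum>b\<in>Basis. (incl N M p v \<bullet> b) *\<^sub>R D p (incl N M p u) (coord_field M e b)) =
      (\<Sum>b\<in>Basis. \<Sum>a\<in>Basis. ((incl N M p v \<bullet> b) * (incl N M p u \<bullet> a)) *\<^sub>R D p a (coord_field M e b))" for u v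
    by (subst linear_basis_expand[OF linear_D[OF chart_open[OF e(1)] vector_field_coord_field[OF e(1)] e(2)], of "incl N M p u"])
      (simp add: scaleR_sum_right)
  have "(\<Sum>b\<in>Basis. (incl N M p v \<bullet> b) *\<^sub>R D p (incl N M p u) (coord_field M e b)) =
      (\<Sum>b\<in>Basis. (incl N M p u \<bullet> b) *\<^sub>R D p (incl N M p v) (coord_field M e b))" for u v
    unfolding second
    by (subst sum.swap) (intro sum.cong refl arg_cong2[where f=scaleR] mult.commute D_coord_field_commute[OF pM, folded e_def])
  then have "nabla_along M D N (push M N (E v)) p u = nabla_along M D N (push M N (E u)) p v" for u v
    unfolding nabla_along_def e_def[symmetric] first push_def[of M N "E _" p] Ep
    using symmetric_second_derivative[OF S \<phi>] by simp
  then show ?thesis unfolding form by simp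
qed

end

section \<open>Lightlike hypersurfaces\<close>

text \<open>
  In pseudo-orthonormal coordinates with time components \<open>\<xi>\<^sub>0\<close> and \<open>w\<^sub>0\<close>, the Euclidean norm of
  \<open>z = w - (w\<^sub>0 / \<xi>\<^sub>0) \<xi>\<close> satisfies \<open>z \<bullet> z = b(w, w)\<close>.
\<close>

lemma lorentz_form_null_complement:
  assumes b: "lorentz_form b" and \<xi>: "\<xi> \<noteq> 0" "b \<xi> \<xi> = 0" and w: "b \<xi> w = 0"
  shows "b w w \<ge> 0" and "b w w = 0 \<Longrightarrow> \<exists>r. w = r *\<^sub>R \<xi>"
proof -
  obtain F :: "'a \<Rightarrow> 'a" and e where e: "e \<in> Basis" and F: "linear F" "bij F"
    and bF: "\<And>i j. i \<in> Basis \<Longrightarrow> j \<in> Basis \<Longrightarrow> b (F i) (F j) = (if i \<noteq> j then 0 else if i = e then - 1 else 1)"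
  proof -
    from b obtain F :: "'a \<Rightarrow> 'a" and e where "e \<in> Basis" "linear F" "bij F"
      "\<forall>i\<in>Basis. \<forall>j\<in>Basis. b (F i) (F j) = (if i \<noteq> j then 0 else if i = e then - 1 else 1)"
      unfolding lorentz_form_def by (elim conjE exE bexE)
    then show thesis by (intro that[of e F]) blast+
  qed
  have l: "linear (\<lambda>x. b x y)" and r: "linear (b x)" for x y
    using b unfolding lorentz_form_def bilinear_def by auto
  \<comment> \<open>In the pseudo-orthonormal frame \<open>F\<close> the form is the Euclidean
    product with the sign of the \<open>e\<close> coordinate reversed.\<close>
  have coords: "b (F x) (F y) = x \<bullet> y - 2 * (x \<bullet> e) * (y \<bullet> e)" for x y
  proof -
    have "b (F x) (F y) = (\<Sum>i\<in>Basis. (x \<bullet> i) *\<^sub>R b (F i) (F y))"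
      by (rule linear_basis_expand[OF linear_compose[OF F(1) l], unfolded o_def])
    also have "\<dots> = (\<Sum>i\<in>Basis. (x \<bullet> i) *\<^sub>R (\<Sum>j\<in>Basis. (y \<bullet> j) *\<^sub>R b (F i) (F j)))"
    proof -
      have "b (F i) (F y) = (\<Sum>j\<in>Basis. (y \<bullet> j) *\<^sub>R b (F i) (F j))" for i
        by (rule linear_basis_expand[OF linear_compose[OF F(1) r], unfolded o_def])
      then show ?thesis by (intro sum.cong refl arg_cong2[where f=scaleR])
    qed
    also have "\<dots> = (\<Sum>i\<in>Basis. (x \<bullet> i) * (y \<bullet> i) - (if i = e then 2 * (x \<bullet> e) * (y \<bullet> e) else 0))"
    proof (rule sum.cong[OF refl])
      fix i :: 'a assume i: "i \<in> Basis"
      have "(\<Sum>j\<in>Basis. (y \<bullet> j) *\<^sub>R b (F i) (F j)) = (\<Sum>j\<in>Basis. if j = i then (y \<bullet> i) * (if i = e then - 1 else 1) else 0)"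
        by (rule sum.cong) (use i in \<open>auto simp: bF\<close>)
      also have "\<dots> = (y \<bullet> i) * (if i = e then - 1 else 1)" using i by simp
      finally show "(x \<bullet> i) *\<^sub>R (\<Sum>j\<in>Basis. (y \<bullet> j) *\<^sub>R b (F i) (F j)) =
          (x \<bullet> i) * (y \<bullet> i) - (if i = e then 2 * (x \<bullet> e) * (y \<bullet> e) else 0)"
        by simp
    qed
    also have "\<dots> = x \<bullet> y - 2 * (x \<bullet> e) * (y \<bullet> e)"
      using e by (simp add: sum_subtractf euclidean_inner[of x y])
    finally show ?thesis .
  qed
  obtain x where x: "\<xi> = F x" using F(2) by (meson bij_pointE)
  obtain y where y: "w = F y" using F(2) by (meson bij_pointE)
  have x0: "x \<noteq> 0" using \<xi>(1) x linear_0[OF F(1)] by auto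
  have xx: "x \<bullet> x = 2 * (x \<bullet> e) * (x \<bullet> e)" and xy: "x \<bullet> y = 2 * (x \<bullet> e) * (y \<bullet> e)"
    using \<xi>(2) w by (simp_all add: x y coords)
  \<comment> \<open>Without a time component, \<open>xx\<close> would force \<open>x\<close> to
    vanish.\<close>
  have xe: "x \<bullet> e \<noteq> 0" using xx x0 by auto
  define s where "s = (y \<bullet> e) / (x \<bullet> e)"
  define z where "z = y - s *\<^sub>R x"
  have ye: "y \<bullet> e = s * (x \<bullet> e)" using xe by (simp add: s_def)
  have "z \<bullet> z = y \<bullet> y - 2 * s * (x \<bullet> y) + s * s * (x \<bullet> x)"
    by (simp add: z_def inner_diff_left inner_diff_right inner_commute algebra_simps)
  also have "\<dots> = b w w" unfolding xx xy y coords ye by (simp add: algebra_simps)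
  finally have zz: "b w w = z \<bullet> z" by simp
  show "b w w \<ge> 0" using zz by simp
  assume "b w w = 0"
  then have "y = s *\<^sub>R x" using zz by (simp add: z_def)
  then show "\<exists>r. w = r *\<^sub>R \<xi>" using x y linear_scale[OF F(1)] by auto
qed

section \<open>Orthogonal projection and shape operator of a spacelike submanifold\<close>

locale spacelike_submanifold = metric_connection_along +
  assumes positive: "p \<in> topspace (mtop N) \<Longrightarrow> x \<noteq> 0 \<Longrightarrow> g p (incl N M p x) (incl N M p x) > 0"
begin

context
  fixes p assumes p: "p \<in> topspace (mtop N)"
begin

lemma p_ambient: "p \<in> topspace (mtop M)"
  using p topspace_incl by blast

text \<open>The difference of two solutions is tangent and orthogonal to every tangent vector,
  itself included, so positivity makes it vanish.\<close>

lemma tangential_part_eqI: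
  assumes "\<And>w. g p (v - incl N M p t) (incl N M p w) = 0"
  shows "tangential_part M g N p v = t"
  unfolding tangential_part_def
proof (rule the_equality)
  fix t' assume t': "\<forall>w. g p (v - incl N M p t') (incl N M p w) = 0"
  have "incl N M p (t - t') = (v - incl N M p t') - (v - incl N M p t)"
    by (simp add: linear_diff[OF linear_incl[OF p]])
  then have "g p (incl N M p (t - t')) (incl N M p (t - t')) = 0"
    using t'[THEN spec, of "t - t'"] assms[of "t - t'"] by (metis linear_diff[OF linear_metric_left[OF p_ambient]] diff_0_right)
  then show "t' = t" using positive[OF p, of "t - t'"] by fastforce
qed (use assms in blast)

text \<open>Existence of the projection: \<open>T\<close> is the Gram map of the induced metric,
  injective by positivity and hence surjective, so the required pairings with the basis can be
  prescribed.\<close>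

lemma tangential_part_orthogonal: "g p (v - incl N M p (tangential_part M g N p v)) (incl N M p w) = 0"
proof -
  note linI = linear_incl[OF p]
  define T where "T = (\<lambda>t. \<Sum>b\<in>Basis. g p (incl N M p t) (incl N M p b) *\<^sub>R b)"
  have expand: "g p x (incl N M p w) = (\<Sum>b\<in>Basis. (w \<bullet> b) *\<^sub>R g p x (incl N M p b))" for x w
    by (rule linear_basis_expand[OF linear_compose[OF linI linear_metric_right[OF p_ambient]], unfolded o_def])
  have "linear T"
    unfolding T_def
    by (rule linearI) (simp_all add: linear_add[OF linI] linear_scale[OF linI] linear_add[OF linear_metric_left[OF p_ambient]]
        linear_scale[OF linear_metric_left[OF p_ambient]] scaleR_add_left sum.distrib scaleR_sum_right)
  have Tb: "T t \<bullet> b = g p (incl N M p t) (incl N M p b)" if "b \<in> Basis" for t b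
    using that by (simp add: T_def inner_sum_left_Basis)
  have "t = 0" if "T t = 0" for t
  proof (rule ccontr)
    assume "t \<noteq> 0"
    moreover have "g p (incl N M p t) (incl N M p t) = 0"
      unfolding expand[of "incl N M p t" t] using Tb[of _ t] that by simp
    ultimately show False using positive[OF p] by force
  qed
  then have "surj T"
    using \<open>linear T\<close> linear_injective_0 linear_injective_imp_surjective by blast
  then obtain t where t: "T t = (\<Sum>b\<in>Basis. g p v (incl N M p b) *\<^sub>R b)" by (metis surjD)
  have "g p (v - incl N M p t) (incl N M p b) = 0" if "b \<in> Basis" for b
    using Tb[OF that, of t] that by (simp add: t linear_diff[OF linear_metric_left[OF p_ambient]])
  then have 1: "g p (v - incl N M p t) (incl N M p w) = 0" for w
    unfolding expand[of "v - incl N M p t" w] by simp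
  show ?thesis unfolding tangential_part_eqI[OF 1] by (rule 1)
qed

text \<open>Trades the description of the projection by \<open>THE\<close> for pairings with tangent
  vectors. The minus sign in the shape operator turns eigenvalue \<open>r\<close> into tangential
  part \<open>(- r) *\<^sub>R x\<close>.\<close>

lemma shape_operator_eq_scaleR_iff:
  "shape_operator M g D N \<zeta> p x = r *\<^sub>R x \<longleftrightarrow>
    (\<forall>w. - g p (nabla_along M D N \<zeta> p x) (incl N M p w) = r * g p (incl N M p x) (incl N M p w))"
proof -
  define v where "v = nabla_along M D N \<zeta> p x"
  have g: "g p (v - incl N M p ((- r) *\<^sub>R x)) (incl N M p w) =
      g p v (incl N M p w) + r * g p (incl N M p x) (incl N M p w)" for w
    using linear_metric_left[OF p_ambient] linear_incl[OF p]
    by (simp only: linear_diff[OF linear_metric_left[OF p_ambient]] linear_scale[OF linear_metric_left[OF p_ambient]]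
        linear_scale[OF linear_incl[OF p]]) simp
  have "shape_operator M g D N \<zeta> p x = r *\<^sub>R x \<longleftrightarrow> tangential_part M g N p v = (- r) *\<^sub>R x"
    by (auto simp: shape_operator_def v_def minus_equation_iff)
  also have "\<dots> \<longleftrightarrow> (\<forall>w. g p (v - incl N M p ((- r) *\<^sub>R x)) (incl N M p w) = 0)"
    using tangential_part_eqI tangential_part_orthogonal by metis
  also have "\<dots> \<longleftrightarrow> (\<forall>w. - g p v (incl N M p w) = r * g p (incl N M p x) (incl N M p w))"
    unfolding g by (metis add.inverse_inverse add_eq_0_iff2 minus_equation_iff)
  finally show ?thesis by (simp add: v_def)
qed

end

end

section \<open>The induced metric and the null form on a screened hypersurface\<close>

locale screened_hypersurface = metric_connection_along M g D H
  for M :: "('a, 'e::euclidean_space) manifold" and g D and H :: "('a, 'h::euclidean_space) manifold" +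
  fixes S :: "'a \<Rightarrow> 'h set" and U :: "'a \<Rightarrow> 'h"
  assumes lightlike: "lightlike_hypersurface M g H" and screen: "screen_distribution M g H S"
    and lightlike_U: "lightlike_field M g H U"
begin

lemma U_field: "V \<subseteq> topspace (mtop H) \<Longrightarrow> vector_field_on H V U"
  using lightlike_U vector_field_on_subset unfolding lightlike_field_def by blast

context
  fixes p assumes p: "p \<in> topspace (mtop H)"
begin

lemma p_ambient: "p \<in> topspace (mtop M)"
  using p topspace_incl by blast

lemma inj_incl: "inj (incl H M p)"
  using lightlike p by (auto simp: lightlike_hypersurface_def submanifold_def)

lemma lorentz: "lorentz_form (g p)"
  using metric p_ambient by (simp add: lorentzian_metric_def)

text \<open>A nonzero radical vector \<xi> is null and orthogonal to all tangent vectors of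
  \<open>H\<close>. The linear algebra of Lorentz forms then makes the induced metric nonnegative,
  with only multiples of \<xi> as null vectors. As \<open>U\<close> is such a vector and does not
  vanish, it can replace \<xi>.\<close>

lemma induced_metric_nonneg: "g p (incl H M p x) (incl H M p x) \<ge> 0"
  and induced_metric_null: "g p (incl H M p x) (incl H M p x) = 0 \<Longrightarrow> \<exists>r. x = r *\<^sub>R U p"
  and U_orthogonal: "g p (incl H M p (U p)) (incl H M p x) = 0"
proof -
  note linI = linear_incl[OF p]
  have "0 \<in> radical M g H p"
    by (simp add: radical_def linear_0[OF linI] linear_0[OF linear_metric_left[OF p_ambient]])
  moreover have "radical M g H p \<noteq> {0}"
    using lightlike p by (auto simp: lightlike_hypersurface_def)
  ultimately obtain \<xi> where \<xi>: "\<xi> \<in> radical M g H p" "\<xi> \<noteq> 0" by blast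
  have I\<xi>: "incl H M p \<xi> \<noteq> 0" using \<xi>(2) inj_incl linear_0[OF linI] by (metis injD)
  have ortho: "g p (incl H M p \<xi>) (incl H M p w) = 0" for w using \<xi>(1) by (simp add: radical_def)
  note null = lorentz_form_null_complement[OF lorentz I\<xi> ortho ortho]
  show "g p (incl H M p x) (incl H M p x) \<ge> 0" by (rule null(1))
  have proportional: "\<exists>r. x = r *\<^sub>R \<xi>" if "g p (incl H M p x) (incl H M p x) = 0" for x
    using null(2)[OF that] inj_incl linear_scale[OF linI] by (metis injD)
  have "g p (incl H M p (U p)) (incl H M p (U p)) = 0" and U0: "incl H M p (U p) \<noteq> 0"
    using lightlike_U p by (auto simp: lightlike_field_def push_def)
  then obtain r where r: "U p = r *\<^sub>R \<xi>" using proportional by blast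
  show "g p (incl H M p (U p)) (incl H M p x) = 0"
    by (simp add: r linear_scale[OF linI] linear_scale[OF linear_metric_left[OF p_ambient]] ortho)
  have "r \<noteq> 0" using r U0 linear_0[OF linI] by auto
  assume "g p (incl H M p x) (incl H M p x) = 0"
  then obtain s where "x = s *\<^sub>R \<xi>" using proportional by blast
  then have "x = (s / r) *\<^sub>R U p" using \<open>r \<noteq> 0\<close> by (simp add: r)
  then show "\<exists>r. x = r *\<^sub>R U p" ..
qed

lemma multiple_U_radical: "r *\<^sub>R U p \<in> radical M g H p"
  by (simp add: radical_def linear_scale[OF linear_incl[OF p]] linear_scale[OF linear_metric_left[OF p_ambient]] U_orthogonal)

text \<open>By nonnegativity only null vectors could violate this; they are multiples of
  \<open>U\<close>, hence radical, and the screen meets the radical in 0 alone.\<close>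

lemma screen_positive:
  assumes "x \<in> S p" "x \<noteq> 0" shows "g p (incl H M p x) (incl H M p x) > 0"
proof (rule ccontr)
  assume "\<not> ?thesis"
  then have "g p (incl H M p x) (incl H M p x) = 0" using induced_metric_nonneg[of x] by linarith
  then have "x \<in> radical M g H p" using induced_metric_null multiple_U_radical by metis
  then have "x \<in> S p \<inter> radical M g H p" using assms by blast
  then show False using assms(2) screen p by (auto simp: screen_distribution_def)
qed

lemma screen_decomposition: "\<exists>s r. s \<in> S p \<and> x = s + r *\<^sub>R U p"
proof -
  have "x \<in> {x + y |x y. x \<in> S p \<and> y \<in> radical M g H p}"
    using screen p by (auto simp: screen_distribution_def)
  then obtain s t where x: "x = s + t" "s \<in> S p" "t \<in> radical M g H p" by blast
  then have "g p (incl H M p t) (incl H M p t) = 0" by (simp add: radical_def)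
  then show ?thesis using induced_metric_null x by metis
qed

lemma null_form_sym: "null_form M g D H U p x y = null_form M g D H U p y x"
proof (rule null_form_commute[OF U_field[OF order_refl] p])
  fix q w assume "q \<in> topspace (mtop H)"
  then show "g q (push M H U q) (incl H M q w) = 0"
    \<comment> \<open>Orthogonality gets differentiated, so it is needed at every point
      \<open>q\<close> and not just at the fixed \<open>p\<close>.\<close>
    using screened_hypersurface.U_orthogonal[OF screened_hypersurface_axioms] by (simp add: push_def)
qed

lemma linear_null_form: "linear (null_form M g D H U p x)"
  unfolding null_form_def
  by (rule linearI) (simp_all add: linear_add[OF linear_incl[OF p]] linear_scale[OF linear_incl[OF p]]
      linear_add[OF linear_metric_right[OF p_ambient]] linear_scale[OF linear_metric_right[OF p_ambient]])

lemma null_form_U: "null_form M g D H U p x (U p) = 0"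
proof -
  define c where "c = chart_at M p"
  define V where "V = fst c \<inter> topspace (mtop H)"
  have c: "c \<in> atlas M" "p \<in> fst c" using chart_at[OF p_ambient] by (auto simp: c_def)
  have V: "openin (mtop H) V" "p \<in> V" using openin_incl[OF cont_incl chart_open[OF c(1)]] c p by (auto simp: V_def)
  have sU: "smooth_along c V (push M H U)"
    by (rule smooth_along_push[OF c(1) V(1) _ U_field]) (auto simp: V_def)
  have "dir_deriv H (\<lambda>q. g q (push M H U q) (push M H U q)) p x = dir_deriv H (\<lambda>q. 0) p x"
    by (rule N.dir_deriv_cong[OF V _ N.smooth_fun_on_const])
      (use lightlike_U in \<open>auto simp: lightlike_field_def V_def\<close>)
  then show ?thesis
    unfolding metric_compatible_along[OF sU sU V(2)] N.dir_deriv_const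
    using metric_commute[OF p_ambient] by (simp add: null_form_def push_def)
qed

text \<open>Both forms ignore multiples of \<open>U\<close> in the right slot, and by symmetry in
  the left one; so only the screen parts of \<open>x\<close> and \<open>y\<close> matter.\<close>

lemma null_form_screen:
  assumes "\<And>x y. x \<in> S p \<Longrightarrow> y \<in> S p \<Longrightarrow> null_form M g D H U p x y = \<rho> * g p (incl H M p x) (incl H M p y)"
  shows "null_form M g D H U p x y = \<rho> * g p (incl H M p x) (incl H M p y)"
proof -
  obtain s r s' r' where x: "x = s + r *\<^sub>R U p" "s \<in> S p" and y: "y = s' + r' *\<^sub>R U p" "s' \<in> S p"
    using screen_decomposition by metis
  have form_right: "null_form M g D H U p z (w + a *\<^sub>R U p) = null_form M g D H U p z w" for z w a
    by (simp add: linear_add[OF linear_null_form] linear_scale[OF linear_null_form] null_form_U)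
  have metric_right: "g p (incl H M p z) (incl H M p (w + a *\<^sub>R U p)) = g p (incl H M p z) (incl H M p w)" for z w a
    using U_orthogonal[of z] metric_commute[OF p_ambient]
    by (simp add: linear_add[OF linear_incl[OF p]] linear_scale[OF linear_incl[OF p]]
      linear_add[OF linear_metric_right[OF p_ambient]] linear_scale[OF linear_metric_right[OF p_ambient]])
  have "null_form M g D H U p x y = null_form M g D H U p s s'"
    unfolding y form_right by (subst null_form_sym) (simp only: x form_right null_form_sym)
  moreover have "g p (incl H M p x) (incl H M p y) = g p (incl H M p s) (incl H M p s')"
    unfolding y metric_right by (subst metric_commute[OF p_ambient]) (simp only: x metric_right metric_commute[OF p_ambient])
  ultimately show ?thesis using assms[OF x(2) y(2)] by simp
qed

end

section \<open>Integral manifolds of the screen and the conformal factor\<close>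

lemma integral_manifold_spacelike:
  fixes L :: "('a, 'l::euclidean_space) manifold"
  assumes L: "integral_manifold H S L"
  shows "incl_mfd L H" "spacelike_submanifold M g D L"
    and "submanifold L M"
proof -
  show LH: "incl_mfd L H" by (rule submanifold_incl_mfd[OF _ N.mfd]) (use L in \<open>simp add: integral_manifold_def\<close>)
  have HM: "incl_mfd H M" by unfold_locales
  interpret LM: incl_mfd L M by (rule incl_mfd_compose[OF LH HM])
  have sH: "submanifold H M" using lightlike by (simp add: lightlike_hypersurface_def)
  show "submanifold L M" by (rule submanifold_trans[OF _ sH mfd]) (use L in \<open>simp add: integral_manifold_def\<close>)
  show "spacelike_submanifold M g D L"
  proof unfold_locales
    fix p and x :: 'l assume p: "p \<in> topspace (mtop L)" and x: "x \<noteq> 0"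
    have pH: "p \<in> topspace (mtop H)" using p incl_mfd.topspace_incl[OF LH] by blast
    have "incl L H p x \<in> S p" using L p by (auto simp: integral_manifold_def)
    moreover have "incl L H p x \<noteq> 0"
      using L p x linear_0[OF incl_mfd.linear_incl[OF LH p]]
      unfolding integral_manifold_def submanifold_def by (metis injD)
    ultimately show "g p (incl L M p x) (incl L M p x) > 0"
      unfolding incl_compose[OF LH HM p] by (rule screen_positive[OF pH])
  qed
qed

text \<open>The derivatives of \<open>U\<close> along \<open>L\<close> and along \<open>H\<close>
  refer to the same chart of \<open>M\<close> at \<open>p\<close>, so the chain rule for
  \<open>L\<close> in \<open>H\<close> identifies them. The shape operator thereby becomes the null
  form on \<open>S p\<close>, from where proportionality extends to all tangent vectors of
  \<open>H\<close>.\<close>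

lemma shape_operator_integral_manifold:
  fixes L :: "('a, 'l::euclidean_space) manifold"
  assumes L: "integral_manifold H S L" and p: "p \<in> topspace (mtop L)"
  shows "(\<forall>x. shape_operator M g D L (push M H U) p x = r *\<^sub>R x) \<longleftrightarrow>
    (\<forall>x y. null_form M g D H U p x y = r * g p (incl H M p x) (incl H M p y))"
proof -
  interpret LH: incl_mfd L H by (rule integral_manifold_spacelike(1)[OF L])
  interpret LM: spacelike_submanifold M g D L by (rule integral_manifold_spacelike(2)[OF L])
  have HM: "incl_mfd H M" by unfold_locales
  have pH: "p \<in> topspace (mtop H)" using p LH.topspace_incl by blast
  note comp = incl_compose[OF LH.incl_mfd_axioms HM p]
  define c where "c = chart_at M p"
  define V where "V = fst c \<inter> topspace (mtop H)"
  have c: "c \<in> atlas M" "p \<in> fst c" using chart_at[OF p_ambient[OF pH]] by (auto simp: c_def)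
  have V: "openin (mtop H) V" "p \<in> V" using openin_incl[OF cont_incl chart_open[OF c(1)]] c pH by (auto simp: V_def)
  have "smooth_along c V (push M H U)"
    by (rule smooth_along_push[OF c(1) V(1) _ U_field]) (auto simp: V_def)
  then have "smooth_fun_on H V (\<lambda>q. components M c q (push M H U q))" by (simp add: smooth_along_def)
  from LH.dir_deriv_incl[OF V(1) this V(2) p]
  have nabla: "nabla_along M D L (push M H U) p x = nabla_along M D H (push M H U) p (incl L H p x)" for x
    by (simp add: nabla_along_def c_def comp)
  have range: "range (incl L H p) = S p" using L p by (auto simp: integral_manifold_def)
  have "(\<forall>x. shape_operator M g D L (push M H U) p x = r *\<^sub>R x) \<longleftrightarrow>
      (\<forall>x y. null_form M g D H U p (incl L H p x) (incl L H p y) =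
        r * g p (incl H M p (incl L H p x)) (incl H M p (incl L H p y)))"
    unfolding LM.shape_operator_eq_scaleR_iff[OF p] nabla comp null_form_def ..
  also have "\<dots> \<longleftrightarrow> (\<forall>x\<in>S p. \<forall>y\<in>S p. null_form M g D H U p x y = r * g p (incl H M p x) (incl H M p y))"
    unfolding range[symmetric] by blast
  also have "\<dots> \<longleftrightarrow> (\<forall>x y. null_form M g D H U p x y = r * g p (incl H M p x) (incl H M p y))"
    using null_form_screen[OF pH, of r] by blast
  finally show ?thesis .
qed

text \<open>No regularity of \<mu> is assumed. It is recovered locally by evaluating the identity on
  one member of a smooth local frame of \<open>S\<close>, whose squared length is positive and may
  be divided by.\<close>

lemma smooth_conformal_factor:
  assumes nontrivial: "\<And>p. p \<in> topspace (mtop H) \<Longrightarrow> S p \<noteq> {0}"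
    and \<mu>: "\<And>p x y. p \<in> topspace (mtop H) \<Longrightarrow>
      null_form M g D H U p x y = \<mu> p * g p (incl H M p x) (incl H M p y)"
  shows "smooth_function_on H (topspace (mtop H)) \<mu>"
  unfolding smooth_function_on_iff
proof (rule N.smooth_fun_on_local)
  fix p assume p: "p \<in> topspace (mtop H)"
  obtain k :: nat and W E where W: "openin (mtop H) W" "p \<in> W" and E: "\<And>i. i < k \<Longrightarrow> vector_field_on H W (E i)"
    and ES: "\<And>q. q \<in> W \<Longrightarrow> inj_on (\<lambda>i. E i q) {..<k} \<and> independent ((\<lambda>i. E i q) ` {..<k}) \<and>
        S q = span ((\<lambda>i. E i q) ` {..<k})"
  proof -
    from screen obtain k :: nat where "\<forall>p\<in>topspace (mtop H). \<exists>W E. openin (mtop H) W \<and> p \<in> W \<and>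
     (\<forall>i<k. vector_field_on H W (E i)) \<and>
     (\<forall>q\<in>W. inj_on (\<lambda>i::nat. E i q) {..<k} \<and> independent ((\<lambda>i. E i q) ` {..<k}) \<and>
        S q = span ((\<lambda>i. E i q) ` {..<k}))"
      unfolding screen_distribution_def distribution_def by (elim conjE exE)
    from bspec[OF this p] show thesis
      by (elim conjE exE, intro that[of _ k]) auto
  qed
  \<comment> \<open>Nontriviality of \<open>S p\<close> makes the frame nonempty, so that
    \<open>E 0\<close> is available.\<close>
  have k: "0 < k"
  proof (rule ccontr)
    assume "\<not> 0 < k"
    then have "S p = {0}" using ES[OF W(2)] by simp
    then show False using nontrivial[OF p] by blast
  qed
  define X where "X = E 0"
  define c where "c = chart_at M p"
  define V where "V = W \<inter> (fst c \<inter> topspace (mtop H))"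
  have c: "c \<in> atlas M" "p \<in> fst c" using chart_at[OF p_ambient[OF p]] by (auto simp: c_def)
  have V: "openin (mtop H) V" "p \<in> V"
    using openin_incl[OF cont_incl chart_open[OF c(1)]] W c p by (auto simp: V_def)
  have VH: "V \<subseteq> topspace (mtop H)" by (auto simp: V_def)
  have X: "vector_field_on H V X"
    unfolding X_def by (rule vector_field_on_subset[OF E[OF k]]) (auto simp: V_def)
  have pos: "g q (push M H X q) (push M H X q) > 0" if "q \<in> V" for q
  proof -
    have q: "q \<in> W" "q \<in> topspace (mtop H)" using that by (auto simp: V_def)
    have "X q \<in> (\<lambda>i. E i q) ` {..<k}" using k by (auto simp: X_def)
    then have "X q \<in> S q" "X q \<noteq> 0" using ES[OF q(1)] span_base dependent_zero by metis+
    then show ?thesis unfolding push_def by (rule screen_positive[OF q(2)])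
  qed
  have sX: "smooth_along c V (push M H X)"
    by (rule smooth_along_push[OF c(1) V(1) _ X]) (auto simp: V_def)
  have sU: "smooth_along c V (push M H U)"
    by (rule smooth_along_push[OF c(1) V(1) _ U_field]) (auto simp: V_def)
  have "smooth_fun_on H V (\<lambda>q. (- 1) *\<^sub>R g q (nabla_along M D H (push M H U) q (X q)) (push M H X q) *\<^sub>R
      inverse (g q (push M H X q) (push M H X q)))"
    using pos by (intro N.smooth_fun_on_scaleR N.smooth_fun_on_const N.smooth_fun_on_inverse V(1)
        smooth_metric_along_along[OF sX sX] smooth_metric_nabla_along[OF sU X sX]) force
  then have "smooth_fun_on H V \<mu>"
  proof (rule N.smooth_fun_on_cong[OF V(1), rotated])
    fix q assume q: "q \<in> V"
    have "- g q (nabla_along M D H (push M H U) q (X q)) (push M H X q) = \<mu> q * g q (push M H X q) (push M H X q)"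
      using \<mu>[of q "X q" "X q"] q VH by (auto simp: null_form_def push_def)
    then show "(- 1) *\<^sub>R g q (nabla_along M D H (push M H U) q (X q)) (push M H X q) *\<^sub>R
      inverse (g q (push M H X q) (push M H X q)) = \<mu> q"
      using pos[OF q] by (simp add: field_simps)
  qed
  then show "\<exists>V. openin (mtop H) V \<and> p \<in> V \<and> smooth_fun_on H V \<mu>" using V by blast
qed

lemma totally_geodesic_umbilical:
  "totally_geodesic M g D H U \<Longrightarrow> totally_umbilical M g D H U"
  unfolding totally_geodesic_def totally_umbilical_def smooth_function_on_iff
  by (rule exI[of _ "\<lambda>p. 0"]) (simp add: N.smooth_fun_on_const)

end

section \<open>The two equivalences\<close>

theorem corollary6p15:
  fixes M :: "('a, 'm::euclidean_space) manifold"
    and g :: "'a \<Rightarrow> 'm \<Rightarrow> 'm \<Rightarrow> real"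
    and T :: "'a \<Rightarrow> 'm"
    and D :: "'a \<Rightarrow> 'm \<Rightarrow> ('a \<Rightarrow> 'm) \<Rightarrow> 'm"
    and H :: "('a, 'h::euclidean_space) manifold"
    and S :: "'a \<Rightarrow> 'h set"
    and U :: "'a \<Rightarrow> 'h"
    and n :: nat
  assumes "spacetime M g T"
    and "levi_civita M g D"
    and "DIM('m) = n + 2" and "n + 2 \<ge> 4" and "DIM('l::euclidean_space) = n"
    and "lightlike_hypersurface M g H"
    and "screen_distribution M g H S"
    and "integrable_distribution TYPE('l) H S"
    and "lightlike_field M g H U"
  shows "(totally_umbilical M g D H U \<longleftrightarrow>
            (\<forall>L :: ('a, 'l) manifold. leaf H S L \<longrightarrow>
               spacelike_codim2 M g L \<and> umbilical_along M g D L (push M H U))) \<and>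
         (totally_geodesic M g D H U \<longleftrightarrow>
            (\<forall>L :: ('a, 'l) manifold. leaf H S L \<longrightarrow>
               spacelike_codim2 M g L \<and> umbilical_along M g D L (push M H U) \<and>
               stationary M g D L (push M H U)))"
proof -
  have M: "smooth_manifold M" "lorentzian_metric M g" using assms(1) by (auto simp: spacetime_def)
  have HM: "submanifold H M" using assms(6) by (simp add: lightlike_hypersurface_def)
  interpret smooth_mfd M using M by unfold_locales
  interpret incl_mfd H M by (rule submanifold_incl_mfd[OF HM M(1)])
  interpret screened_hypersurface M g D H S U
    using M assms by unfold_locales auto
  have integral: "integral_manifold H S L" if "leaf H S L" for L :: "('a, 'l) manifold"
    using that by (simp add: leaf_def)
  have leaf: "\<exists>L :: ('a, 'l) manifold. leaf H S L \<and> p \<in> topspace (mtop L)" if "p \<in> topspace (mtop H)" for p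
    using assms(8) that exists_leaf[OF N.mfd] unfolding integrable_distribution_def by metis
  have spacelike: "spacelike_codim2 M g L" if "leaf H S L" for L :: "('a, 'l) manifold"
    using integral_manifold_spacelike(2,3)[OF integral[OF that]] assms(3,5)
    by (auto simp: spacelike_codim2_def dest: spacelike_submanifold.positive)
  have shape: "(\<forall>x. shape_operator M g D L (push M H U) p x = r *\<^sub>R x) \<longleftrightarrow>
      (\<forall>x y. null_form M g D H U p x y = r * g p (incl H M p x) (incl H M p y))"
    if "leaf H S L" "p \<in> topspace (mtop L)" for p r and L :: "('a, 'l) manifold"
    by (rule shape_operator_integral_manifold[OF integral[OF that(1)] that(2)])
  have topspace_leaf: "p \<in> topspace (mtop H)" if "leaf H S L" "p \<in> topspace (mtop L)"
    for p and L :: "('a, 'l) manifold"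
    using that by (auto simp: leaf_def integral_manifold_def submanifold_def)
  \<comment> \<open>\<open>S p\<close> is the injective image of the tangent space \<open>'l\<close>
    of a leaf, and a Euclidean space contains a nonzero basis vector.\<close>
  have nontrivial: "S p \<noteq> {0}" if p: "p \<in> topspace (mtop H)" for p
  proof
    assume S0: "S p = {0}"
    obtain L :: "('a, 'l) manifold" where L: "leaf H S L" "p \<in> topspace (mtop L)" using leaf[OF p] by blast
    have "range (incl L H p) = {0}" "inj (incl L H p)"
      using integral[OF L(1)] L(2) S0 by (auto simp: integral_manifold_def submanifold_def)
    then have "x = 0" for x :: 'l using injD[of "incl L H p" x 0] by (metis rangeI singletonD)
    then show False using nonzero_Basis[OF SOME_Basis] by blast
  qed
  have umbilical: "totally_umbilical M g D H U \<longleftrightarrow> (\<forall>L :: ('a, 'l) manifold. leaf H S L \<longrightarrow>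
               spacelike_codim2 M g L \<and> umbilical_along M g D L (push M H U))"
  proof (intro iffI allI impI conjI)
    fix L :: "('a, 'l) manifold" assume "totally_umbilical M g D H U" and L: "leaf H S L"
    show "spacelike_codim2 M g L" by (rule spacelike[OF L])
    obtain \<mu> where "\<And>p x y. p \<in> topspace (mtop H) \<Longrightarrow>
        null_form M g D H U p x y = \<mu> p * g p (incl H M p x) (incl H M p y)"
      using \<open>totally_umbilical M g D H U\<close> unfolding totally_umbilical_def by blast
    then have "\<forall>x. shape_operator M g D L (push M H U) p x = \<mu> p *\<^sub>R x" if "p \<in> topspace (mtop L)" for p
      unfolding shape[OF L that] using topspace_leaf[OF L that] by blast
    then show "umbilical_along M g D L (push M H U)" unfolding umbilical_along_def by blast
  next
    assume leaves: "\<forall>L :: ('a, 'l) manifold. leaf H S L \<longrightarrow>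
      spacelike_codim2 M g L \<and> umbilical_along M g D L (push M H U)"
    \<comment> \<open>A factor is first obtained at each point separately, from whichever leaf
      passes through it; choice then gives a bare function \<mu>, whose smoothness is established
      afterwards.\<close>
    have "\<exists>r. \<forall>x y. null_form M g D H U p x y = r * g p (incl H M p x) (incl H M p y)"
      if p: "p \<in> topspace (mtop H)" for p
    proof -
      obtain L :: "('a, 'l) manifold" where L: "leaf H S L" "p \<in> topspace (mtop L)" using leaf[OF p] by blast
      then show ?thesis using leaves shape[OF L] unfolding umbilical_along_def by blast
    qed
    then obtain \<mu> where \<mu>: "\<And>p x y. p \<in> topspace (mtop H) \<Longrightarrow>
        null_form M g D H U p x y = \<mu> p * g p (incl H M p x) (incl H M p y)"
      by metis
    show "totally_umbilical M g D H U"
      unfolding totally_umbilical_def using smooth_conformal_factor[OF nontrivial \<mu>] \<mu> by blast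
  qed
  have "totally_geodesic M g D H U \<longleftrightarrow> (\<forall>L :: ('a, 'l) manifold. leaf H S L \<longrightarrow>
               spacelike_codim2 M g L \<and> umbilical_along M g D L (push M H U) \<and>
               stationary M g D L (push M H U))"
  proof (intro iffI allI impI)
    fix L :: "('a, 'l) manifold" assume geodesic: "totally_geodesic M g D H U" and L: "leaf H S L"
    have "\<forall>x. shape_operator M g D L (push M H U) p x = 0 *\<^sub>R x" if "p \<in> topspace (mtop L)" for p
      unfolding shape[OF L that] using geodesic topspace_leaf[OF L that] by (simp add: totally_geodesic_def)
    then have "stationary M g D L (push M H U)" by (simp add: stationary_def)
    then show "spacelike_codim2 M g L \<and> umbilical_along M g D L (push M H U) \<and> stationary M g D L (push M H U)"
      using umbilical totally_geodesic_umbilical[OF geodesic] L by blast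
  next
    assume leaves: "\<forall>L :: ('a, 'l) manifold. leaf H S L \<longrightarrow>
      spacelike_codim2 M g L \<and> umbilical_along M g D L (push M H U) \<and> stationary M g D L (push M H U)"
    show "totally_geodesic M g D H U"
      unfolding totally_geodesic_def
    proof (intro ballI allI)
      fix p x y assume p: "p \<in> topspace (mtop H)"
      obtain L :: "('a, 'l) manifold" where L: "leaf H S L" "p \<in> topspace (mtop L)" using leaf[OF p] by blast
      then obtain \<rho> where \<rho>: "\<forall>x. shape_operator M g D L (push M H U) p x = \<rho> p *\<^sub>R x"
        using leaves unfolding umbilical_along_def by blast
      have "(\<Sum>b\<in>Basis. shape_operator M g D L (push M H U) p b \<bullet> b) = 0"
        using leaves L unfolding stationary_def by blast
      \<comment> \<open>The trace of \<rho> times the identity is \<rho> times the dimension, which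
        is positive.\<close>
      then have "\<rho> p * real DIM('l) = 0" using \<rho> by (simp add: mult.commute)
      then have "\<rho> p = 0" by simp
      then show "null_form M g D H U p x y = 0" using \<rho> shape[OF L, of "\<rho> p"] by simp
    qed
  qed
  with umbilical show ?thesis by blast
qed

end
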